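(* Let $\mathcal{T}=(A,T,G)$ be a regularity structure together with a model $(\Pi,\Gamma)$ (with global bounds), such that $T_\alpha$ is a UMD space for every $\alpha\in A$. Let $\alpha_0:=\inf A$, $\alpha_0\notin\mathbb{Z}$, and $\gamma>\alpha_0$. Let $(\Omega,\mathcal{F},\mathbb{F},\mathbb{P})$ be a complete filtered probability space and $W$ a Brownian motion on $[0,T]$ for some $T\in(0,\infty)$. Let $1<p<\infty$, $1<q<\infty$, and let $H$ be a $\mathcal{D}^\gamma_{p,q}$-valued process which is locally $L^2$-stochastically integrable with respect to $W$. Let $\mathcal{R}$ denote a reconstruction operator on $\mathcal{D}^\gamma_{p,q}$ for $\mathcal{T}$ and $(\Pi,\Gamma)$. Then for every test function $\psi\in\mathcal{B}^r$ with $r>|\alpha_0|$, $$\big\langle\mathcal{R}\big((H\bullet W)\big),\psi\big\rangle=\big(\langle\mathcal{R}(H),\psi\rangle\bullet W\big)$$ as real-valued processes on $[0,T]$ ($\mathbb{P}$-almost surely), where $(H\bullet W)$ denotes the stochastic integral of $H$ with respect to $W$.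
   Context: **Notation.** Fix $d\ge1$ and a scaling $\mathfrak{s}=(\mathfrak{s}_1,\dots,\mathfrak{s}_d)$ of positive integers, $|\mathfrak{s}|=\mathfrak{s}_1+\dots+\mathfrak{s}_d$, $\|x\|_{\mathfrak{s}}:=\sup_i|x_i|^{1/\mathfrak{s}_i}$; $B(x,R)$ is the ball for $\|\cdot\|_{\mathfrak{s}}$. $\mathcal{D}'$ is the space of (tempered) distributions on $\mathbb{R}^d$. $\mathcal{B}^r$ is the set of compactly supported $\phi\in\mathcal{C}^r(\mathbb{R}^d)$ with $\|\phi\|_{\mathcal{C}^r}\le1$ and support in $B(0,1)$; $\phi^\lambda_x(y):=\lambda^{-|\mathfrak{s}|}\phi(\lambda^{-\mathfrak{s}_1}(y_1-x_1),\dots,\lambda^{-\mathfrak{s}_d}(y_d-x_d))$. $L^q_\lambda:=L^q((0,1),\lambda^{-1}\mathrm{d}\lambda)$. **Regularity structure.** $\mathcal{T}=(A,T,G)$ consists of: an index set $A\subset\mathbb{R}$, locally finite, bounded from below, with $0\in A$; a graded vector space $T=\bigoplus_{\alpha\in A}T_\alpha$ with each $T_\alpha$ a Banach space and $T_0\approx\mathbb{R}$ with unit vector $\mathbf{1}$; a group $G$ of linear operators on $T$ such that $\Gamma a-a\in\bigoplus_{\beta\in A,\beta<\alpha}T_\beta$ for all $\Gamma\in G$, $\alpha\in A$, $a\in T_\alpha$, and $\Gamma\mathbf{1}=\mathbf{1}$. $|\tau|_\alpha=\|\tau\|_\alpha$ is the norm of the projection of $\tau$ onto $T_\alpha$; $A_\gamma:=\{\alpha\in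 A:\alpha<\gamma\}$, $T^-_\gamma:=\bigoplus_{\alpha\in A_\gamma}T_\alpha$. (The symbol $T$ is also used for the time horizon.) **Model (global bounds).** A model $(\Pi,\Gamma)$ consists of a map $\Gamma\colon\mathbb{R}^d\times\mathbb{R}^d\to G$ with $\Gamma_{x,y}\Gamma_{y,z}=\Gamma_{x,z}$, $\Gamma_{x,x}=1$, and continuous linear maps $\Pi_x\colon T\to\mathcal{D}'$ with $\Pi_y=\Pi_x\circ\Gamma_{x,y}$, such that for every $\gamma>0$ there is $C_\gamma>0$ with $|\langle\Pi_x\tau,\phi^\lambda_x\rangle|\le C_\gamma\lambda^\alpha\|\tau\|_\alpha$ and $\|\Gamma_{x,y}\tau\|_\beta\le C_\gamma\|x-y\|_{\mathfrak{s}}^{\alpha-\beta}\|\tau\|_\alpha$ uniformly over $x,y\in\mathbb{R}^d$, $\lambda\in(0,1]$, $\tau\in T_\alpha$ with $\alpha\le\gamma$, $\beta\le\alpha$, and $\phi\in\mathcal{B}^r$ with $r>|\inf A|$. **Besov space of modelled distributions.** $\mathcal{D}^\gamma_{p,q}$ is the space of measurable $f\colon\mathbb{R}^d\to T^-_\gamma$ with $$|||f|||_{\gamma,p,q}:=\sum_{\alpha\in A_\gamma}\big\||f(x)|_\alpha\big\|_{L^p(\mathrm{d}x)}+\sum_{\alpha\in A_\gamma}\bigg(\int_{B(0,1)}\Big\|\frac{|f(x+h)-\Gamma_{x+h,x}f(x)|_\alpha}{\|h\|_{\mathfrak{s}}^{\gamma-\alpha}}\Big\|_{L^p(\mathrm{d}x)}^q\frac{\mathrm{d}h}{\|h\|_{\mathfrak{s}}^{|\mathfrak{s}|}}\bigg)^{1/q}<\infty.$$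 Since all $T_\alpha$ are UMD and $1<p,q<\infty$, $\mathcal{D}^\gamma_{p,q}$ is a UMD Banach space. **Reconstruction operator.** For $\bar\alpha<0$ and an integer $r'>|\bar\alpha|$, $\mathcal{B}^{\bar\alpha}_{p,q}$ is the space of distributions $\xi$ on $\mathbb{R}^d$ with $\big\|\,\|\sup_{\eta\in\mathcal{B}^{r'}}|\langle\xi,\eta^\lambda_x\rangle|/\lambda^{\bar\alpha}\|_{L^p(\mathrm{d}x)}\big\|_{L^q_\lambda}<\infty$. A reconstruction operator is a linear map $\mathcal{R}$ which is continuous $\mathcal{D}^\gamma_{p,q}\to\mathcal{B}^{\bar\alpha}_{p,q}$ for every $\bar\alpha<\alpha_0$ and satisfies $\big\|\,\|\sup_{\eta\in\mathcal{B}^r}|\langle\mathcal{R}f-\Pi_xf(x),\eta^\lambda_x\rangle|/\lambda^\gamma\|_{L^p(\mathrm{d}x)}\big\|_{L^q_\lambda}\lesssim|||f|||_{\gamma,p,q}$ for all $f\in\mathcal{D}^\gamma_{p,q}$. (Note $\alpha_0<0$ because $0\in A$ and $\alpha_0\notin\mathbb{Z}$.) The pairing $\langle\mathcal{R}f,\psi\rangle$ for $\psi\in\mathcal{B}^r$ is the continuous extension of the duality pairing. **Stochastic integration.** For a UMD Banach space $E$, an elementary process is $H=\sum_{n=1}^N\sum_{m=1}^M\mathbf{1}_{(t_{n-1},t_n]}\mathbf{1}_{A_{mn}}f_{mn}$ with $0=t_0<\dots<t_N=T$, $A_{mn}\in\mathcal{F}_{t_{n-1}}$ pairwise disjoint in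 $m$, $f_{mn}\in E$, and $(H\bullet W)_t=\sum_{n,m}\mathbf{1}_{A_{mn}}(W_{t\wedge t_n}-W_{t\wedge t_{n-1}})f_{mn}$. A strongly measurable adapted $E$-valued process $H$ is $L^2$-stochastically integrable if there are elementary processes $H_n$ with $\langle H_n,x^*\rangle\to\langle H,x^*\rangle$ in $L^2(\Omega;L^2([0,T]))$ for all $x^*\in E^*$ and $(H_n\bullet W)$ convergent in $L^2(\Omega;C([0,T];E))$; the limit is $(H\bullet W)$ (van Neerven–Veraar–Weis integral). $H$ is locally $L^2$-stochastically integrable if there are stopping times $\tau_k\uparrow T$, almost surely eventually equal to $T$, such that $\mathbf{1}_{[0,\tau_k]}H$ is $L^2$-stochastically integrable for each $k$; $(H\bullet W)$ is then defined by localization. *)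

theory Defs
  imports "HOL-Probability.Probability" "HOL-Library.Function_Algebras"
begin

section \<open>Functions as a real vector space\<close>

instantiation "fun" :: (type, real_vector) real_vector
begin

definition scaleR_fun :: "real \<Rightarrow> ('a \<Rightarrow> 'b) \<Rightarrow> 'a \<Rightarrow> 'b"
  where "scaleR_fun c f = (\<lambda>x. c *\<^sub>R f x)"

instance
  by standard (simp_all add: scaleR_fun_def fun_eq_iff scaleR_add_right scaleR_add_left)

end


section \<open>Seminormed spaces given by a carrier and a seminorm\<close>

text \<open>
  The Banach spaces below (the sectors of a regularity structure, the space of modelled
  distributions, spaces of continuous paths) are given by a carrier \<open>E\<close> inside a real vector
  space and a (semi)norm \<open>N\<close>. Function spaces consist of functions rather than of almost
  everywhere equivalence classes; two functions represent the same element of the Banach space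
  iff the seminorm of their difference vanishes. Measurability and duality are invariant
  under this identification; \<open>banach_on\<close> is used for genuine norms only.
\<close>

definition norm_on :: "'e::real_vector set \<Rightarrow> ('e \<Rightarrow> real) \<Rightarrow> bool"
  where "norm_on E N \<longleftrightarrow> subspace E
    \<and> (\<forall>a\<in>E. 0 \<le> N a \<and> (N a = 0 \<longleftrightarrow> a = 0))
    \<and> (\<forall>c. \<forall>a\<in>E. N (c *\<^sub>R a) = \<bar>c\<bar> * N a)
    \<and> (\<forall>a\<in>E. \<forall>b\<in>E. N (a + b) \<le> N a + N b)"

definition banach_on :: "'e::real_vector set \<Rightarrow> ('e \<Rightarrow> real) \<Rightarrow> bool"
  where "banach_on E N \<longleftrightarrow> norm_on E N
    \<and> (\<forall>u::nat \<Rightarrow> 'e. range u \<subseteq> E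
          \<and> (\<forall>\<epsilon>>0. \<exists>n0. \<forall>m\<ge>n0. \<forall>n\<ge>n0. N (u m - u n) < \<epsilon>)
        \<longrightarrow> (\<exists>l\<in>E. (\<lambda>n. N (u n - l)) \<longlonglongrightarrow> 0))"

definition cont_dual :: "'e::real_vector set \<Rightarrow> ('e \<Rightarrow> real) \<Rightarrow> ('e \<Rightarrow> real) set"
  where "cont_dual E N = {\<xi>.
      (\<forall>c. \<forall>a\<in>E. \<xi> (c *\<^sub>R a) = c * \<xi> a)
    \<and> (\<forall>a\<in>E. \<forall>b\<in>E. \<xi> (a + b) = \<xi> a + \<xi> b)
    \<and> (\<exists>C. \<forall>a\<in>E. \<bar>\<xi> a\<bar> \<le> C * N a)}"

definition strongly_measurable ::
    "'w measure \<Rightarrow> 'e::real_vector set \<Rightarrow> ('e \<Rightarrow> real) \<Rightarrow> ('w \<Rightarrow> 'e) \<Rightarrow> bool"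
  where "strongly_measurable M E N f \<longleftrightarrow> f ` space M \<subseteq> E
    \<and> (\<exists>u::nat \<Rightarrow> 'w \<Rightarrow> 'e. (\<forall>n. simple_function M (u n) \<and> u n ` space M \<subseteq> E)
        \<and> (\<forall>w\<in>space M. (\<lambda>n. N (u n w - f w)) \<longlonglongrightarrow> 0))"

text \<open>The Bochner integral of \<open>f\<close> over the finite measure \<open>M\<close> exists and equals \<open>v\<close>.\<close>

definition has_bochner_integral_on ::
    "'w measure \<Rightarrow> 'e::real_vector set \<Rightarrow> ('e \<Rightarrow> real) \<Rightarrow> ('w \<Rightarrow> 'e) \<Rightarrow> 'e \<Rightarrow> bool"
  where "has_bochner_integral_on M E N f v \<longleftrightarrow> strongly_measurable M E N f \<and> v \<in> E
    \<and> (\<exists>u::nat \<Rightarrow> 'w \<Rightarrow> 'e. (\<forall>n. simple_function M (u n) \<and> u n ` space M \<subseteq> E)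
        \<and> (\<lambda>n. \<integral>\<^sup>+w. ennreal (N (f w - u n w)) \<partial>M) \<longlonglongrightarrow> 0
        \<and> (\<lambda>n. N (Bochner_Integration.simple_bochner_integral M (u n) - v)) \<longlonglongrightarrow> 0)"

text \<open>
  An \<open>E\<close>-valued \<open>L\<^sup>p\<close> martingale difference sequence \<open>d 1, \<dots>, d n\<close>. The last condition is
  \<open>\<bbbE>[d k | F (k - 1)] = 0\<close>.
\<close>

definition martingale_differences ::
    "'w measure \<Rightarrow> (nat \<Rightarrow> 'w measure) \<Rightarrow> 'e::real_vector set \<Rightarrow> ('e \<Rightarrow> real) \<Rightarrow> real
      \<Rightarrow> nat \<Rightarrow> (nat \<Rightarrow> 'w \<Rightarrow> 'e) \<Rightarrow> bool"
  where "martingale_differences M F E N p n d \<longleftrightarrow>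
      filtration (space M) F \<and> (\<forall>k. subalgebra M (F k))
    \<and> (\<forall>k\<in>{1..n}. strongly_measurable (F k) E N (d k)
          \<and> (\<integral>\<^sup>+w. ennreal (N (d k w) powr p) \<partial>M) < \<infinity>
          \<and> (\<forall>A\<in>sets (F (k - 1)).
               has_bochner_integral_on M E N (\<lambda>w. indicator A w *\<^sub>R d k w) 0))"

text \<open>
  The UMD property. Every strongly measurable finite sequence generates a countably generated
  \<open>\<sigma>\<close>-algebra, so its law is realised on a probability space over the reals, and it is enough to
  let \<open>P\<close> range over all probability measures (with arbitrary \<open>\<sigma>\<close>-algebras) on that type.
\<close>

definition umd_space :: "'e::real_vector set \<Rightarrow> ('e \<Rightarrow> real) \<Rightarrow> bool"
  where "umd_space E N \<longleftrightarrow> banach_on E N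
    \<and> (\<exists>p>1. \<exists>\<beta>\<ge>0. \<forall>(P::real measure) F n d (\<epsilon>::nat \<Rightarrow> real).
          prob_space P \<and> martingale_differences P F E N p n d \<and> range \<epsilon> \<subseteq> {-1, 1}
        \<longrightarrow> (\<integral>\<^sup>+w. ennreal (N (\<Sum>k=1..n. \<epsilon> k *\<^sub>R d k w) powr p) \<partial>P)
            \<le> ennreal (\<beta> powr p) * (\<integral>\<^sup>+w. ennreal (N (\<Sum>k=1..n. d k w) powr p) \<partial>P))"


section \<open>Test functions and distributions\<close>

definition sc_norm :: "('d::finite \<Rightarrow> nat) \<Rightarrow> real^'d \<Rightarrow> real"
  where "sc_norm s x = Max (range (\<lambda>i. \<bar>x $ i\<bar> powr (1 / real (s i))))"

definition sc_ball :: "('d::finite \<Rightarrow> nat) \<Rightarrow> real^'d \<Rightarrow> real \<Rightarrow> (real^'d) set"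
  where "sc_ball s x R = {y. sc_norm s (y - x) < R}"

definition sc_dim :: "('d::finite \<Rightarrow> nat) \<Rightarrow> nat"
  where "sc_dim s = sum s UNIV"

definition partial_deriv :: "'d::finite \<Rightarrow> (real^'d \<Rightarrow> real) \<Rightarrow> real^'d \<Rightarrow> real"
  where "partial_deriv i f x = deriv (\<lambda>t. f (x + t *\<^sub>R axis i 1)) 0"

text \<open>The list of directions \<open>is\<close> encodes the multi-index of an iterated partial derivative.\<close>

definition iter_deriv :: "'d::finite list \<Rightarrow> (real^'d \<Rightarrow> real) \<Rightarrow> real^'d \<Rightarrow> real"
  where "iter_deriv is f = foldr partial_deriv is f"

definition C_fun :: "nat \<Rightarrow> (real^'d::finite \<Rightarrow> real) \<Rightarrow> bool"
  where "C_fun r f \<longleftrightarrow>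
      (\<forall>is. length is \<le> r \<longrightarrow> continuous_on UNIV (iter_deriv is f))
    \<and> (\<forall>is i x. length is < r \<longrightarrow>
          (\<lambda>t. iter_deriv is f (x + t *\<^sub>R axis i 1)) field_differentiable (at 0))"

definition C_norm :: "nat \<Rightarrow> (real^'d::finite \<Rightarrow> real) \<Rightarrow> real"
  where "C_norm r f = (SUP (is, x) \<in> {is. length is \<le> r} \<times> UNIV. \<bar>iter_deriv is f x\<bar>)"

definition fsupport :: "(real^'d::finite \<Rightarrow> real) \<Rightarrow> (real^'d) set"
  where "fsupport f = closure {x. f x \<noteq> 0}"

definition test_fun :: "(real^'d::finite \<Rightarrow> real) \<Rightarrow> bool"
  where "test_fun f \<longleftrightarrow> (\<forall>r. C_fun r f) \<and> compact (fsupport f)"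

text \<open>The set \<open>\<B>\<^sup>r\<close>.\<close>

definition test_ball :: "('d::finite \<Rightarrow> nat) \<Rightarrow> nat \<Rightarrow> (real^'d \<Rightarrow> real) set"
  where "test_ball s r = {f. C_fun r f \<and> compact (fsupport f) \<and> C_norm r f \<le> 1
           \<and> fsupport f \<subseteq> sc_ball s 0 1}"

definition rescale ::
    "('d::finite \<Rightarrow> nat) \<Rightarrow> real^'d \<Rightarrow> real \<Rightarrow> (real^'d \<Rightarrow> real) \<Rightarrow> real^'d \<Rightarrow> real"
  where "rescale s x l f y = f (\<chi> i. (y $ i - x $ i) / l ^ s i) / l ^ sc_dim s"

text \<open>
  A distribution is represented by a function on \<open>real^'d \<Rightarrow> real\<close> of which only the values on
  \<open>C\<^sub>c\<^sup>\<infinity>\<close> test functions matter.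
\<close>

type_synonym 'd distr = "(real^'d \<Rightarrow> real) \<Rightarrow> real"

definition of_order_on :: "(real^'d::finite) set \<Rightarrow> nat \<Rightarrow> 'd distr \<Rightarrow> bool"
  where "of_order_on K r \<xi> \<longleftrightarrow>
    (\<exists>C. \<forall>f. test_fun f \<and> fsupport f \<subseteq> K \<longrightarrow> \<bar>\<xi> f\<bar> \<le> C * C_norm r f)"

definition distribution :: "'d::finite distr \<Rightarrow> bool"
  where "distribution \<xi> \<longleftrightarrow>
      (\<forall>a b f g. test_fun f \<and> test_fun g \<longrightarrow> \<xi> (a *\<^sub>R f + b *\<^sub>R g) = a * \<xi> f + b * \<xi> g)
    \<and> (\<forall>K. compact K \<longrightarrow> (\<exists>r. of_order_on K r \<xi>))"

definition of_order :: "nat \<Rightarrow> 'd::finite distr \<Rightarrow> bool"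
  where "of_order r \<xi> \<longleftrightarrow> (\<forall>K. compact K \<longrightarrow> of_order_on K r \<xi>)"

text \<open>
  The pairing of a distribution of order at most \<open>r\<close> with a compactly supported \<open>C\<^sup>r\<close> function:
  the extension by continuity of the duality pairing from \<open>C\<^sub>c\<^sup>\<infinity>\<close>.
\<close>

definition approximates :: "nat \<Rightarrow> (nat \<Rightarrow> real^'d::finite \<Rightarrow> real) \<Rightarrow> (real^'d \<Rightarrow> real) \<Rightarrow> bool"
  where "approximates r u f \<longleftrightarrow> (\<forall>n. test_fun (u n))
    \<and> (\<exists>K. compact K \<and> (\<forall>n. fsupport (u n) \<subseteq> K))
    \<and> (\<lambda>n. C_norm r (u n - f)) \<longlonglongrightarrow> 0"

definition pairing :: "nat \<Rightarrow> 'd::finite distr \<Rightarrow> (real^'d \<Rightarrow> real) \<Rightarrow> real"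
  where "pairing r \<xi> f = (THE c. \<forall>u. approximates r u f \<longrightarrow> (\<lambda>n. \<xi> (u n)) \<longlonglongrightarrow> c)"


section \<open>Regularity structures and models\<close>

record 'v reg_struct =
  idx :: "real set"
  sector :: "real \<Rightarrow> 'v set"
  cnorm :: "real \<Rightarrow> 'v \<Rightarrow> real"
  grp :: "('v \<Rightarrow> 'v) set"
  unit_vec :: 'v

definition decomposes :: "real set \<Rightarrow> (real \<Rightarrow> 'v::real_vector set) \<Rightarrow> 'v \<Rightarrow> (real \<Rightarrow> 'v) \<Rightarrow> bool"
  where "decomposes A V \<tau> c \<longleftrightarrow> (\<forall>\<alpha>\<in>A. c \<alpha> \<in> V \<alpha>) \<and> (\<forall>\<alpha>. \<alpha> \<notin> A \<longrightarrow> c \<alpha> = 0)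
    \<and> finite {\<alpha>. c \<alpha> \<noteq> 0} \<and> \<tau> = (\<Sum>\<alpha> | c \<alpha> \<noteq> 0. c \<alpha>)"

definition component :: "'v::real_vector reg_struct \<Rightarrow> real \<Rightarrow> 'v \<Rightarrow> 'v"
  where "component R \<alpha> \<tau> = (THE c. decomposes (idx R) (sector R) \<tau> c) \<alpha>"

definition hnorm :: "'v::real_vector reg_struct \<Rightarrow> real \<Rightarrow> 'v \<Rightarrow> real"
  where "hnorm R \<alpha> \<tau> = cnorm R \<alpha> (component R \<alpha> \<tau>)"

definition idx_below :: "'v::real_vector reg_struct \<Rightarrow> real \<Rightarrow> real set"
  where "idx_below R \<gamma> = {\<alpha> \<in> idx R. \<alpha> < \<gamma>}"

definition space_below :: "'v::real_vector reg_struct \<Rightarrow> real \<Rightarrow> 'v set"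
  where "space_below R \<gamma> = {\<tau>. \<forall>\<alpha>\<in>idx R. \<alpha> \<ge> \<gamma> \<longrightarrow> component R \<alpha> \<tau> = 0}"

text \<open>
  The graded space \<open>T\<close> is the whole type \<open>'v\<close>, as the algebraic internal direct sum of the
  sectors.
\<close>

definition regularity_structure :: "'v::real_vector reg_struct \<Rightarrow> bool"
  where "regularity_structure R \<longleftrightarrow>
      0 \<in> idx R \<and> bdd_below (idx R) \<and> (\<forall>a b. finite (idx R \<inter> {a..b}))
    \<and> (\<forall>\<tau>. \<exists>!c. decomposes (idx R) (sector R) \<tau> c)
    \<and> (\<forall>\<alpha>\<in>idx R. banach_on (sector R \<alpha>) (cnorm R \<alpha>))
    \<and> sector R 0 = span {unit_vec R} \<and> cnorm R 0 (unit_vec R) = 1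
    \<and> (\<forall>g\<in>grp R. linear g)
    \<and> id \<in> grp R \<and> (\<forall>g\<in>grp R. \<forall>h\<in>grp R. g \<circ> h \<in> grp R)
    \<and> (\<forall>g\<in>grp R. \<exists>h\<in>grp R. g \<circ> h = id \<and> h \<circ> g = id)
    \<and> (\<forall>g\<in>grp R. \<forall>\<alpha>\<in>idx R. \<forall>a\<in>sector R \<alpha>. g a - a \<in> space_below R \<alpha>)
    \<and> (\<forall>g\<in>grp R. g (unit_vec R) = unit_vec R)"

text \<open>
  Powers with \<open>0\<^sup>0 = 1\<close>. The library has \<open>0 powr 0 = 0\<close>, which would make the model bound for
  \<open>\<Gamma>\<close> with \<open>x = y\<close> and \<open>\<beta> = \<alpha>\<close> unsatisfiable.
\<close>

definition pow0 :: "real \<Rightarrow> real \<Rightarrow> real"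
  where "pow0 x a = (if a = 0 then 1 else x powr a)"

text \<open>
  Each \<open>Pmod x\<close> is a linear map into the distributions. Its continuity is continuity on every
  Banach space \<open>T\<^sub>\<alpha>\<close>, after pairing with an arbitrary test function. The clause \<open>of_order\<close> says
  that the pairings with \<open>C\<^sup>r\<close> functions in the model bound are defined.
\<close>

definition model ::
    "('d::finite \<Rightarrow> nat) \<Rightarrow> nat \<Rightarrow> 'v::real_vector reg_struct
      \<Rightarrow> (real^'d \<Rightarrow> 'v \<Rightarrow> 'd distr) \<Rightarrow> (real^'d \<Rightarrow> real^'d \<Rightarrow> 'v \<Rightarrow> 'v) \<Rightarrow> bool"
  where "model s r R Pmod \<Gamma> \<longleftrightarrow>
      (\<forall>x y. \<Gamma> x y \<in> grp R)
    \<and> (\<forall>x y z. \<Gamma> x y \<circ> \<Gamma> y z = \<Gamma> x z) \<and> (\<forall>x. \<Gamma> x x = id)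
    \<and> (\<forall>x \<tau>. distribution (Pmod x \<tau>) \<and> of_order r (Pmod x \<tau>))
    \<and> (\<forall>x f. test_fun f \<longrightarrow> linear (\<lambda>\<tau>. Pmod x \<tau> f)
          \<and> (\<forall>\<alpha>\<in>idx R. \<exists>C. \<forall>\<tau>\<in>sector R \<alpha>. \<bar>Pmod x \<tau> f\<bar> \<le> C * cnorm R \<alpha> \<tau>))
    \<and> (\<forall>x y \<tau> f. test_fun f \<longrightarrow> Pmod y \<tau> f = Pmod x (\<Gamma> x y \<tau>) f)
    \<and> (\<forall>\<gamma>>0. \<exists>C>0.
          (\<forall>\<alpha>\<in>idx R. \<alpha> \<le> \<gamma> \<longrightarrow> (\<forall>\<tau>\<in>sector R \<alpha>.
              (\<forall>x. \<forall>l\<in>{0<..1}. \<forall>f\<in>test_ball s r.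
                 \<bar>pairing r (Pmod x \<tau>) (rescale s x l f)\<bar> \<le> C * l powr \<alpha> * cnorm R \<alpha> \<tau>)
            \<and> (\<forall>x y. \<forall>\<beta>\<in>idx R. \<beta> \<le> \<alpha> \<longrightarrow>
                 hnorm R \<beta> (\<Gamma> x y \<tau>) \<le> C * pow0 (sc_norm s (x - y)) (\<alpha> - \<beta>) * cnorm R \<alpha> \<tau>))))"


section \<open>Modelled distributions and reconstruction\<close>

text \<open>Real powers of extended nonnegative reals, for positive exponents.\<close>

definition epowr :: "ennreal \<Rightarrow> real \<Rightarrow> ennreal"
  where "epowr x a = (if x = \<infinity> then \<infinity> else ennreal (enn2real x powr a))"

definition Lp_norm :: "'a measure \<Rightarrow> real \<Rightarrow> ('a \<Rightarrow> ennreal) \<Rightarrow> ennreal"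
  where "Lp_norm M p g = epowr (\<integral>\<^sup>+x. epowr (g x) p \<partial>M) (1 / p)"

definition shift_measure :: "('d::finite \<Rightarrow> nat) \<Rightarrow> (real^'d) measure"
  where "shift_measure s =
    density lborel (\<lambda>h. ennreal (indicator (sc_ball s 0 1) h / sc_norm s h ^ sc_dim s))"

definition scale_measure_log :: "real measure"
  where "scale_measure_log = density lborel (\<lambda>l. ennreal (indicator {0<..<1} l / l))"

text \<open>
  \<open>|||f|||\<close> for \<open>\<gamma>, p, q\<close>. Measurability on \<open>\<real>\<^sup>d\<close> is Borel (\<open>lborel\<close>); every Lebesgue measurable \<open>f\<close>
  has a Borel representative.
\<close>

definition md_norm ::
    "('d::finite \<Rightarrow> nat) \<Rightarrow> 'v::real_vector reg_struct \<Rightarrow> (real^'d \<Rightarrow> real^'d \<Rightarrow> 'v \<Rightarrow> 'v)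
      \<Rightarrow> real \<Rightarrow> real \<Rightarrow> real \<Rightarrow> (real^'d \<Rightarrow> 'v) \<Rightarrow> ennreal"
  where "md_norm s R \<Gamma> \<gamma> p q f =
      (\<Sum>\<alpha>\<in>idx_below R \<gamma>. Lp_norm lborel p (\<lambda>x. ennreal (hnorm R \<alpha> (f x))))
    + (\<Sum>\<alpha>\<in>idx_below R \<gamma>. Lp_norm (shift_measure s) q (\<lambda>h. Lp_norm lborel p (\<lambda>x.
          ennreal (hnorm R \<alpha> (f (x + h) - \<Gamma> (x + h) x (f x)) / sc_norm s h powr (\<gamma> - \<alpha>)))))"

definition modelled ::
    "('d::finite \<Rightarrow> nat) \<Rightarrow> 'v::real_vector reg_struct \<Rightarrow> (real^'d \<Rightarrow> real^'d \<Rightarrow> 'v \<Rightarrow> 'v)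
      \<Rightarrow> real \<Rightarrow> real \<Rightarrow> real \<Rightarrow> (real^'d \<Rightarrow> 'v) set"
  where "modelled s R \<Gamma> \<gamma> p q = {f. (\<forall>x. f x \<in> space_below R \<gamma>)
    \<and> (\<forall>\<alpha>\<in>idx_below R \<gamma>.
          strongly_measurable lborel (sector R \<alpha>) (cnorm R \<alpha>) (\<lambda>x. component R \<alpha> (f x)))
    \<and> md_norm s R \<Gamma> \<gamma> p q f < \<infinity>}"

definition md_seminorm ::
    "('d::finite \<Rightarrow> nat) \<Rightarrow> 'v::real_vector reg_struct \<Rightarrow> (real^'d \<Rightarrow> real^'d \<Rightarrow> 'v \<Rightarrow> 'v)
      \<Rightarrow> real \<Rightarrow> real \<Rightarrow> real \<Rightarrow> (real^'d \<Rightarrow> 'v) \<Rightarrow> real"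
  where "md_seminorm s R \<Gamma> \<gamma> p q f = enn2real (md_norm s R \<Gamma> \<gamma> p q f)"

text \<open>
  The norm common to the Besov spaces and to the reconstruction bound, for a family \<open>\<zeta> x\<close> of
  distributions tested around \<open>x\<close>.
\<close>

definition local_norm ::
    "('d::finite \<Rightarrow> nat) \<Rightarrow> nat \<Rightarrow> real \<Rightarrow> real \<Rightarrow> real \<Rightarrow> (real^'d \<Rightarrow> 'd distr) \<Rightarrow> ennreal"
  where "local_norm s r a p q \<zeta> =
    Lp_norm scale_measure_log q (\<lambda>l. Lp_norm lborel p (\<lambda>x.
      SUP \<eta>\<in>test_ball s r. ennreal (\<bar>pairing r (\<zeta> x) (rescale s x l \<eta>)\<bar> / l powr a)))"

definition besov_norm ::
    "('d::finite \<Rightarrow> nat) \<Rightarrow> nat \<Rightarrow> real \<Rightarrow> real \<Rightarrow> real \<Rightarrow> 'd distr \<Rightarrow> ennreal"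
  where "besov_norm s r a p q \<xi> = local_norm s r a p q (\<lambda>_. \<xi>)"

definition besov ::
    "('d::finite \<Rightarrow> nat) \<Rightarrow> nat \<Rightarrow> real \<Rightarrow> real \<Rightarrow> real \<Rightarrow> 'd distr set"
  where "besov s r a p q = {\<xi>. distribution \<xi> \<and> of_order r \<xi> \<and> besov_norm s r a p q \<xi> < \<infinity>}"

text \<open>
  The Besov space of regularity \<open>a < 0\<close> does not depend on the choice of the integer \<open>k > \<bar>a\<bar>\<close>
  up to equivalence of norms; every such \<open>k\<close> is allowed.
\<close>

definition reconstruction ::
    "('d::finite \<Rightarrow> nat) \<Rightarrow> nat \<Rightarrow> 'v::real_vector reg_struct
      \<Rightarrow> (real^'d \<Rightarrow> 'v \<Rightarrow> 'd distr) \<Rightarrow> (real^'d \<Rightarrow> real^'d \<Rightarrow> 'v \<Rightarrow> 'v)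
      \<Rightarrow> real \<Rightarrow> real \<Rightarrow> real \<Rightarrow> ((real^'d \<Rightarrow> 'v) \<Rightarrow> 'd distr) \<Rightarrow> bool"
  where "reconstruction s r R Pmod \<Gamma> \<gamma> p q Rec \<longleftrightarrow>
    (let D = modelled s R \<Gamma> \<gamma> p q; N = md_norm s R \<Gamma> \<gamma> p q in
      (\<forall>f\<in>D. \<forall>g\<in>D. \<forall>a b \<phi>. test_fun \<phi> \<longrightarrow>
          Rec (a *\<^sub>R f + b *\<^sub>R g) \<phi> = a * Rec f \<phi> + b * Rec g \<phi>)
    \<and> (\<forall>a < Inf (idx R). \<forall>k::nat. real k > \<bar>a\<bar> \<longrightarrow>
          (\<forall>f\<in>D. Rec f \<in> besov s k a p q)
        \<and> (\<forall>f\<in>D. \<forall>\<epsilon>>0. \<exists>\<delta>>0. \<forall>g\<in>D. N (g - f) < \<delta> \<longrightarrow>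
              besov_norm s k a p q (Rec g - Rec f) < \<epsilon>))
    \<and> (\<exists>C::real. \<forall>f\<in>D.
          local_norm s r \<gamma> p q (\<lambda>x. Rec f - Pmod x (f x)) \<le> ennreal C * N f))"


section \<open>Stochastic integration\<close>

definition complete_filtered_prob_space :: "'w measure \<Rightarrow> (real \<Rightarrow> 'w measure) \<Rightarrow> bool"
  where "complete_filtered_prob_space M F \<longleftrightarrow> prob_space M \<and> complete_measure M
    \<and> filtration (space M) F \<and> (\<forall>t. subalgebra M (F t)) \<and> null_sets M \<subseteq> sets (F 0)"

definition brownian_motion ::
    "'w measure \<Rightarrow> (real \<Rightarrow> 'w measure) \<Rightarrow> real \<Rightarrow> (real \<Rightarrow> 'w \<Rightarrow> real) \<Rightarrow> bool"
  where "brownian_motion M F T W \<longleftrightarrow>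
      (\<forall>t\<in>{0..T}. W t \<in> borel_measurable (F t))
    \<and> (AE w in M. W 0 w = 0)
    \<and> (AE w in M. continuous_on {0..T} (\<lambda>t. W t w))
    \<and> (\<forall>u t. 0 \<le> u \<and> u < t \<and> t \<le> T \<longrightarrow>
          distributed M lborel (\<lambda>w. W t w - W u w) (normal_density 0 (sqrt (t - u)))
        \<and> prob_space.indep_set M (sets (F u))
            {(\<lambda>w. W t w - W u w) -` B \<inter> space M | B. B \<in> sets borel})"

text \<open>The data \<open>N, M, t\<^sub>n, A\<^sub>m\<^sub>n, f\<^sub>m\<^sub>n\<close> of an elementary process.\<close>

record ('w, 'e) elem_data =
  el_N :: nat
  el_M :: nat
  el_t :: "nat \<Rightarrow> real"
  el_A :: "nat \<Rightarrow> nat \<Rightarrow> 'w set"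
  el_f :: "nat \<Rightarrow> nat \<Rightarrow> 'e"

definition elementary ::
    "(real \<Rightarrow> 'w measure) \<Rightarrow> real \<Rightarrow> 'e set \<Rightarrow> ('w, 'e) elem_data \<Rightarrow> bool"
  where "elementary F T E D \<longleftrightarrow>
      el_t D 0 = 0 \<and> el_t D (el_N D) = T
    \<and> (\<forall>n\<in>{1..el_N D}. el_t D (n - 1) < el_t D n)
    \<and> (\<forall>n\<in>{1..el_N D}. \<forall>m\<in>{1..el_M D}.
          el_A D m n \<in> sets (F (el_t D (n - 1))) \<and> el_f D m n \<in> E)
    \<and> (\<forall>n\<in>{1..el_N D}. disjoint_family_on (\<lambda>m. el_A D m n) {1..el_M D})"

definition elem_process :: "('w, 'e::real_vector) elem_data \<Rightarrow> real \<Rightarrow> 'w \<Rightarrow> 'e"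
  where "elem_process D t w = (\<Sum>n=1..el_N D. \<Sum>m=1..el_M D.
    (indicator {el_t D (n - 1)<..el_t D n} t * indicator (el_A D m n) w) *\<^sub>R el_f D m n)"

definition elem_integral ::
    "(real \<Rightarrow> 'w \<Rightarrow> real) \<Rightarrow> ('w, 'e::real_vector) elem_data \<Rightarrow> real \<Rightarrow> 'w \<Rightarrow> 'e"
  where "elem_integral W D t w = (\<Sum>n=1..el_N D. \<Sum>m=1..el_M D.
    (indicator (el_A D m n) w * (W (min t (el_t D n)) w - W (min t (el_t D (n - 1))) w))
      *\<^sub>R el_f D m n)"

definition adapted_process ::
    "'w measure \<Rightarrow> (real \<Rightarrow> 'w measure) \<Rightarrow> real \<Rightarrow> 'e::real_vector set \<Rightarrow> ('e \<Rightarrow> real)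
      \<Rightarrow> (real \<Rightarrow> 'w \<Rightarrow> 'e) \<Rightarrow> bool"
  where "adapted_process M F T E N H \<longleftrightarrow>
      strongly_measurable (restrict_space borel {0..T} \<Otimes>\<^sub>M M) E N (\<lambda>(t, w). H t w)
    \<and> (\<forall>t\<in>{0..T}. strongly_measurable (F t) E N (H t))"

definition paths :: "real \<Rightarrow> 'e::real_vector set \<Rightarrow> ('e \<Rightarrow> real) \<Rightarrow> (real \<Rightarrow> 'e) set"
  where "paths T E N = {g. \<forall>t\<in>{0..T}. g t \<in> E
    \<and> ((\<lambda>u. N (g u - g t)) \<longlongrightarrow> 0) (at t within {0..T})}"

definition path_norm :: "real \<Rightarrow> ('e::real_vector \<Rightarrow> real) \<Rightarrow> (real \<Rightarrow> 'e) \<Rightarrow> real"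
  where "path_norm T N g = (SUP t\<in>{0..T}. N (g t))"

text \<open>
  \<open>H\<close> is \<open>L\<^sup>2\<close>-stochastically integrable and \<open>I\<close> is a version of its stochastic integral, i.e. a
  representative of the limit in \<open>L\<^sup>2(\<Omega>; C([0,T]; E))\<close>.
\<close>

definition has_L2_stoch_integral ::
    "'w measure \<Rightarrow> (real \<Rightarrow> 'w measure) \<Rightarrow> real \<Rightarrow> (real \<Rightarrow> 'w \<Rightarrow> real)
      \<Rightarrow> 'e::real_vector set \<Rightarrow> ('e \<Rightarrow> real) \<Rightarrow> (real \<Rightarrow> 'w \<Rightarrow> 'e) \<Rightarrow> (real \<Rightarrow> 'w \<Rightarrow> 'e) \<Rightarrow> bool"
  where "has_L2_stoch_integral M F T W E N H I \<longleftrightarrow>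
      adapted_process M F T E N H
    \<and> strongly_measurable M (paths T E N) (path_norm T N) (\<lambda>w t. I t w)
    \<and> (\<exists>D::nat \<Rightarrow> ('w, 'e) elem_data. (\<forall>n. elementary F T E (D n))
        \<and> (\<forall>\<xi>\<in>cont_dual E N.
             (\<lambda>n. \<integral>\<^sup>+w. (\<integral>\<^sup>+t\<in>{0..T}. ennreal ((\<xi> (elem_process (D n) t w) - \<xi> (H t w))\<^sup>2) \<partial>lborel) \<partial>M)
               \<longlonglongrightarrow> 0)
        \<and> (\<lambda>n. \<integral>\<^sup>+w. (SUP t\<in>{0..T}. ennreal ((N (elem_integral W (D n) t w - I t w))\<^sup>2)) \<partial>M)
             \<longlonglongrightarrow> 0)"

definition localizing ::
    "'w measure \<Rightarrow> (real \<Rightarrow> 'w measure) \<Rightarrow> real \<Rightarrow> (nat \<Rightarrow> 'w \<Rightarrow> real) \<Rightarrow> bool"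
  where "localizing M F T \<tau> \<longleftrightarrow>
      (\<forall>k. stopping_time F (\<tau> k)) \<and> (\<forall>k. \<forall>w\<in>space M. \<tau> k w \<in> {0..T})
    \<and> (AE w in M. incseq (\<lambda>k. \<tau> k w) \<and> (\<forall>\<^sub>F k in sequentially. \<tau> k w = T))"

definition restrict_to :: "('w \<Rightarrow> real) \<Rightarrow> (real \<Rightarrow> 'w \<Rightarrow> 'e::real_vector) \<Rightarrow> real \<Rightarrow> 'w \<Rightarrow> 'e"
  where "restrict_to \<tau> H t w = indicator {0..\<tau> w} t *\<^sub>R H t w"

definition localized_integrals ::
    "'w measure \<Rightarrow> (real \<Rightarrow> 'w measure) \<Rightarrow> real \<Rightarrow> (real \<Rightarrow> 'w \<Rightarrow> real)
      \<Rightarrow> 'e::real_vector set \<Rightarrow> ('e \<Rightarrow> real) \<Rightarrow> (real \<Rightarrow> 'w \<Rightarrow> 'e)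
      \<Rightarrow> (nat \<Rightarrow> 'w \<Rightarrow> real) \<times> (nat \<Rightarrow> real \<Rightarrow> 'w \<Rightarrow> 'e) \<Rightarrow> bool"
  where "localized_integrals M F T W E N H = (\<lambda>(\<tau>, J). localizing M F T \<tau>
    \<and> (\<forall>k. has_L2_stoch_integral M F T W E N (restrict_to (\<tau> k) H) (J k)))"

definition locally_stoch_integrable ::
    "'w measure \<Rightarrow> (real \<Rightarrow> 'w measure) \<Rightarrow> real \<Rightarrow> (real \<Rightarrow> 'w \<Rightarrow> real)
      \<Rightarrow> 'e::real_vector set \<Rightarrow> ('e \<Rightarrow> real) \<Rightarrow> (real \<Rightarrow> 'w \<Rightarrow> 'e) \<Rightarrow> bool"
  where "locally_stoch_integrable M F T W E N H \<longleftrightarrow>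
    adapted_process M F T E N H \<and> (\<exists>L. localized_integrals M F T W E N H L)"

text \<open>
  The integral process \<open>H \<bullet> W\<close>: on \<open>[0, \<tau> k]\<close> it agrees with the integral of \<open>1\<^bsub>[0, \<tau> k]\<^esub> H\<close>.
  Up to indistinguishability it does not depend on the localizing sequence and on the versions
  selected by the choice operator.
\<close>

definition stoch_integral ::
    "'w measure \<Rightarrow> (real \<Rightarrow> 'w measure) \<Rightarrow> real \<Rightarrow> (real \<Rightarrow> 'w \<Rightarrow> real)
      \<Rightarrow> 'e::real_vector set \<Rightarrow> ('e \<Rightarrow> real) \<Rightarrow> (real \<Rightarrow> 'w \<Rightarrow> 'e) \<Rightarrow> real \<Rightarrow> 'w \<Rightarrow> 'e"
  where "stoch_integral M F T W E N H =
    (let (\<tau>, J) = (SOME L. localized_integrals M F T W E N H L) in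
      (\<lambda>t w. if \<exists>k. t \<le> \<tau> k w then J (LEAST k. t \<le> \<tau> k w) t w else 0))"

end

theory Submission
  imports Defs "HOL-Computational_Algebra.Polynomial"
begin

text \<open>
  For a fixed test function \<open>\<psi>\<close> the map \<open>f \<mapsto> \<langle>Rec f, \<psi>\<rangle>\<close> is a bounded linear functional on the space of
  modelled distributions (\<open>reconstruction_functional\<close>), and a bounded linear functional
  commutes with the stochastic integral (\<open>stoch_integral_l\<close>).

  Boundedness has three ingredients. The pairing with a \<open>C\<^sup>k\<close> function is a limit along smooth
  approximations; it exists and is linear in the distribution because mollification makes
  test functions dense (\<open>test_fun_dense\<close>, \<open>pairing_LIMSEQ\<close>). It is controlled by the Besov
  norm because \<open>\<psi>\<close> occurs, as its own rescaling, in the supremum defining this norm for all base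
  points near \<open>0\<close> and all scales near \<open>1\<close> (\<open>pairing_le_besov_norm\<close>). Continuity of \<open>Rec\<close> into a
  Besov space then gives a bound on a ball, and homogeneity gives it everywhere. Linearity on the
  space of modelled distributions presupposes that this is a vector space. Its norm contains
  integrals of increments \<open>f (x + h) - \<Gamma> (x + h) x (f x)\<close>, whose measurability in \<open>(h, x)\<close> rests on
  the strong continuity of \<open>\<Gamma>\<close> (\<open>continuous_\<Gamma>\<close>, \<open>measurable_increment\<close>,
  \<open>quasi_seminorm_modelled\<close>).

  For the second part, a bounded functional \<open>l\<close> maps elementary processes to elementary processes,
  commutes with their integrals, and preserves both kinds of convergence that define the
  integral (\<open>has_L2_stoch_integral_l\<close>). So if \<open>(\<tau>, J)\<close> are a localizing sequence and the
  associated integrals for \<open>H\<close>, then \<open>(\<tau>, l \<circ> J)\<close> are such data for \<open>l \<circ> H\<close>. The integral of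
  \<open>l \<circ> H\<close> may however be built from different data, so it remains to show that real-valued
  integrals do not depend on them (\<open>glued_unique\<close>). By the Ito isometry for step processes
  (\<open>Ito_isometry\<close>), the \<open>L\<^sup>2\<close> limit of the integrands determines the limit of the integrals; to
  compare integrands that agree only up to a stopping time \<open>\<rho>\<close>, step processes are stopped on a
  fine grid shortly after \<open>\<rho>\<close> (\<open>stopped_integral_bound\<close>, \<open>stoch_integral_local\<close>). Path
  continuity turns equality at rational times into indistinguishability.
\<close>

section \<open>Quasi-seminorms and strong measurability\<close>

text \<open>
  The seminorm of \<open>\<D>\<^sup>\<gamma>\<^sub>p\<^sub>,\<^sub>q\<close> enters the theory of stochastic integration only through these
  properties; a triangle inequality up to a constant is enough.
\<close>

definition quasi_seminorm_on :: "'e::real_vector set \<Rightarrow> ('e \<Rightarrow> real) \<Rightarrow> bool"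
  where "quasi_seminorm_on E N \<longleftrightarrow> subspace E \<and> (\<forall>a\<in>E. 0 \<le> N a)
    \<and> (\<forall>c. \<forall>a\<in>E. N (c *\<^sub>R a) \<le> \<bar>c\<bar> * N a)
    \<and> (\<exists>K\<ge>0. \<forall>a\<in>E. \<forall>b\<in>E. N (a + b) \<le> K * (N a + N b))"

lemma norm_on_imp_quasi: "norm_on E N \<Longrightarrow> quasi_seminorm_on E N"
  unfolding norm_on_def quasi_seminorm_on_def by (auto intro!: exI[of _ 1])

lemma strongly_measurableI:
  assumes "\<And>w. w \<in> space M \<Longrightarrow> f w \<in> E" "\<And>n. simple_function M (u n)"
    "\<And>n w. w \<in> space M \<Longrightarrow> u n w \<in> E" "\<And>w. w \<in> space M \<Longrightarrow> (\<lambda>n. N (u n w - f w)) \<longlonglongrightarrow> 0"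
  shows "strongly_measurable M E N f"
  unfolding strongly_measurable_def using assms by (intro conjI exI[of _ u]) auto

lemma strongly_measurable_lincomb:
  assumes q: "quasi_seminorm_on E N" and f: "strongly_measurable M E N f" and g: "strongly_measurable M E N g"
  shows "strongly_measurable M E N (\<lambda>w. a *\<^sub>R f w + b *\<^sub>R g w)"
proof -
  obtain K where E: "subspace E" and N: "\<And>a. a \<in> E \<Longrightarrow> 0 \<le> N a" "\<And>c a. a \<in> E \<Longrightarrow> N (c *\<^sub>R a) \<le> \<bar>c\<bar> * N a"
    and K: "K \<ge> 0" "\<And>a b. a \<in> E \<Longrightarrow> b \<in> E \<Longrightarrow> N (a + b) \<le> K * (N a + N b)"
    using q by (auto simp: quasi_seminorm_on_def)
  obtain u where u0: "\<forall>n. simple_function M (u n) \<and> u n ` space M \<subseteq> E"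
      and lim_u: "\<forall>w\<in>space M. (\<lambda>n. N (u n w - f w)) \<longlonglongrightarrow> 0"
    using f unfolding strongly_measurable_def by (elim exE conjE)
  have u: "simple_function M (u n)" "w \<in> space M \<Longrightarrow> u n w \<in> E" for n w
    using u0 by auto
  obtain v where v0: "\<forall>n. simple_function M (v n) \<and> v n ` space M \<subseteq> E"
      and lim_v: "\<forall>w\<in>space M. (\<lambda>n. N (v n w - g w)) \<longlonglongrightarrow> 0"
    using g unfolding strongly_measurable_def by (elim exE conjE)
  have v: "simple_function M (v n)" "w \<in> space M \<Longrightarrow> v n w \<in> E" for n w
    using v0 by auto
  have fg: "f w \<in> E" "g w \<in> E" if "w \<in> space M" for w
    using f g that by (auto simp: strongly_measurable_def)
  have "simple_function M (\<lambda>w. a *\<^sub>R u n w + b *\<^sub>R v n w)" for n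
    using u(1) v(1) by (rule simple_function_compose2)
  moreover have "(\<lambda>n. N (a *\<^sub>R u n w + b *\<^sub>R v n w - (a *\<^sub>R f w + b *\<^sub>R g w))) \<longlonglongrightarrow> 0" if w: "w \<in> space M" for w
  proof (rule tendsto_sandwich[OF _ _ tendsto_const])
    have d: "u n w - f w \<in> E" "v n w - g w \<in> E" for n
      using u(2) v(2) fg w by (auto intro: subspace_diff[OF E])
    have eq: "a *\<^sub>R u n w + b *\<^sub>R v n w - (a *\<^sub>R f w + b *\<^sub>R g w) = a *\<^sub>R (u n w - f w) + b *\<^sub>R (v n w - g w)" for n
      by (simp add: algebra_simps)
    show "\<forall>\<^sub>F n in sequentially. 0 \<le> N (a *\<^sub>R u n w + b *\<^sub>R v n w - (a *\<^sub>R f w + b *\<^sub>R g w))"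
      unfolding eq using d by (intro always_eventually allI N subspace_add[OF E] subspace_scale[OF E])
    have "N (a *\<^sub>R (u n w - f w) + b *\<^sub>R (v n w - g w)) \<le> K * (\<bar>a\<bar> * N (u n w - f w) + \<bar>b\<bar> * N (v n w - g w))" for n
      using d by (intro order.trans[OF K(2)] mult_left_mono[OF _ K(1)] add_mono N subspace_scale[OF E])
    then show "\<forall>\<^sub>F n in sequentially. N (a *\<^sub>R u n w + b *\<^sub>R v n w - (a *\<^sub>R f w + b *\<^sub>R g w))
        \<le> K * (\<bar>a\<bar> * N (u n w - f w) + \<bar>b\<bar> * N (v n w - g w))"
      unfolding eq by simp
    show "(\<lambda>n. K * (\<bar>a\<bar> * N (u n w - f w) + \<bar>b\<bar> * N (v n w - g w))) \<longlonglongrightarrow> 0"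
      using tendsto_mult_left[OF tendsto_add[OF tendsto_mult_left[OF lim_u[rule_format, OF w], of "\<bar>a\<bar>"] tendsto_mult_left[OF lim_v[rule_format, OF w], of "\<bar>b\<bar>"]], of K]
      by simp
  qed
  moreover have "a *\<^sub>R u n w + b *\<^sub>R v n w \<in> E" "a *\<^sub>R f w + b *\<^sub>R g w \<in> E" if "w \<in> space M" for n w
    using u(2) v(2) fg that by (auto intro!: subspace_add[OF E] subspace_scale[OF E])
  ultimately show ?thesis
    by (intro strongly_measurableI[where u = "\<lambda>n w. a *\<^sub>R u n w + b *\<^sub>R v n w"]) auto
qed

section \<open>Iterated partial derivatives\<close>

lemma iter_deriv_Nil [simp]: "iter_deriv [] f = f"
  and iter_deriv_Cons: "iter_deriv (i # is) f = partial_deriv i (iter_deriv is f)"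
  and iter_deriv_snoc: "iter_deriv (is @ [i]) f = iter_deriv is (partial_deriv i f)"
  by (simp_all add: iter_deriv_def)

lemma partial_deriv_eqI:
  "((\<lambda>t. f (x + t *\<^sub>R axis i 1)) has_field_derivative D) (at 0) \<Longrightarrow> partial_deriv i f x = D"
  unfolding partial_deriv_def by (rule DERIV_imp_deriv)

lemma C_fun_0: "C_fun 0 f \<longleftrightarrow> continuous_on UNIV f"
  by (simp add: C_fun_def)

lemma C_fun_mono: "C_fun r f \<Longrightarrow> r' \<le> r \<Longrightarrow> C_fun r' f"
  by (simp add: C_fun_def)

lemma C_fun_continuous: "C_fun r f \<Longrightarrow> continuous_on UNIV f"
  using C_fun_mono[of r f 0] by (simp add: C_fun_0)

lemma C_fun_iter_continuous:
  "C_fun r f \<Longrightarrow> length is \<le> r \<Longrightarrow> continuous_on UNIV (iter_deriv is f)"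
  by (simp add: C_fun_def)

lemma C_fun_iter_DERIV:
  assumes "C_fun r f" "length is < r"
  shows "((\<lambda>t. iter_deriv is f (x + t *\<^sub>R axis i 1)) has_field_derivative
           iter_deriv (i # is) f x) (at 0)"
  using assms unfolding C_fun_def iter_deriv_Cons partial_deriv_def
  by (simp add: DERIV_deriv_iff_field_differentiable)

text \<open>
  Peeling off the innermost derivative gives a recursion over the order, so closure
  properties of \<open>C_fun\<close> follow by induction from the rules for a single derivative.
\<close>

lemma C_fun_Suc:
  "C_fun (Suc r) f \<longleftrightarrow> continuous_on UNIV f
    \<and> (\<forall>i x. (\<lambda>t. f (x + t *\<^sub>R axis i 1)) field_differentiable (at 0))
    \<and> (\<forall>i. C_fun r (partial_deriv i f))"
proof
  assume f: "C_fun (Suc r) f"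
  have "C_fun r (partial_deriv i f)" for i
    unfolding C_fun_def iter_deriv_snoc[symmetric]
  proof (intro conjI allI impI)
    fix "is" :: "'a list" assume "length is \<le> r"
    then show "continuous_on UNIV (iter_deriv (is @ [i]) f)"
      using f by (intro C_fun_iter_continuous[of "Suc r"]) auto
  next
    fix "is" :: "'a list" and j x assume "length is < r"
    then show "(\<lambda>t. iter_deriv (is @ [i]) f (x + t *\<^sub>R axis j 1)) field_differentiable at 0"
      using f unfolding C_fun_def by auto
  qed
  moreover have "(\<lambda>t. f (x + t *\<^sub>R axis i 1)) field_differentiable (at 0)" for i x
    using C_fun_iter_DERIV[OF f, of "[]"] by (auto simp: field_differentiable_def)
  ultimately show "continuous_on UNIV f
    \<and> (\<forall>i x. (\<lambda>t. f (x + t *\<^sub>R axis i 1)) field_differentiable (at 0))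
    \<and> (\<forall>i. C_fun r (partial_deriv i f))"
    using C_fun_continuous[OF f] by blast
next
  assume *: "continuous_on UNIV f
    \<and> (\<forall>i x. (\<lambda>t. f (x + t *\<^sub>R axis i 1)) field_differentiable (at 0))
    \<and> (\<forall>i. C_fun r (partial_deriv i f))"
  show "C_fun (Suc r) f"
    unfolding C_fun_def
  proof (intro conjI allI impI)
    fix "is" :: "'a list" assume "length is \<le> Suc r"
    then show "continuous_on UNIV (iter_deriv is f)"
      using * by (cases "is" rule: rev_cases) (auto simp: iter_deriv_snoc intro: C_fun_iter_continuous)
  next
    fix "is" :: "'a list" and i x assume "length is < Suc r"
    then show "(\<lambda>t. iter_deriv is f (x + t *\<^sub>R axis i 1)) field_differentiable at 0"
      using * by (cases "is" rule: rev_cases) (auto simp: iter_deriv_snoc C_fun_def)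
  qed
qed

lemma C_fun_SucI:
  assumes "continuous_on UNIV f"
    and D: "\<And>i x. ((\<lambda>t. f (x + t *\<^sub>R axis i 1)) has_field_derivative g i x) (at 0)"
    and "\<And>i. C_fun r (g i)"
  shows "C_fun (Suc r) f"
proof -
  have "partial_deriv i f = g i" for i
    using partial_deriv_eqI[OF D] by auto
  then show ?thesis
    using assms by (auto simp: C_fun_Suc field_differentiable_def)
qed

lemma C_fun_Suc_DERIV:
  assumes "C_fun (Suc r) f"
  shows "((\<lambda>t. f (x + t *\<^sub>R axis i 1)) has_field_derivative partial_deriv i f x) (at 0)"
  using C_fun_iter_DERIV[OF assms, of "[]"] by (simp add: iter_deriv_Cons)

lemma C_fun_const: "C_fun r (\<lambda>x. c)"
proof (induction r arbitrary: c)
  case (Suc r)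
  show ?case by (rule C_fun_SucI[where g = "\<lambda>i x. 0"]) (auto intro: Suc.IH)
qed (simp add: C_fun_0)

lemma C_fun_add: "C_fun r f \<Longrightarrow> C_fun r g \<Longrightarrow> C_fun r (\<lambda>x. f x + g x)"
proof (induction r arbitrary: f g)
  case (Suc r)
  show ?case
  proof (rule C_fun_SucI)
    show "C_fun r (\<lambda>x. partial_deriv i f x + partial_deriv i g x)" for i
      using Suc by (intro Suc.IH) (auto simp: C_fun_Suc)
    show "continuous_on UNIV (\<lambda>x. f x + g x)"
      using Suc.prems by (intro continuous_on_add) (auto dest: C_fun_continuous)
  qed (use Suc.prems in \<open>auto intro!: DERIV_add C_fun_Suc_DERIV\<close>)
qed (auto simp: C_fun_0 intro: continuous_intros)

lemma C_fun_mult: "C_fun r f \<Longrightarrow> C_fun r g \<Longrightarrow> C_fun r (\<lambda>x. f x * g x)"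
proof (induction r arbitrary: f g)
  case (Suc r)
  show ?case
  proof (rule C_fun_SucI)
    fix i x
    show "((\<lambda>t. f (x + t *\<^sub>R axis i 1) * g (x + t *\<^sub>R axis i 1)) has_field_derivative
           partial_deriv i f x * g x + partial_deriv i g x * f x) (at 0)"
      using DERIV_mult[OF C_fun_Suc_DERIV[OF Suc.prems(1)] C_fun_Suc_DERIV[OF Suc.prems(2)], of x i x i]
      by simp
    show "C_fun r (\<lambda>x. partial_deriv i f x * g x + partial_deriv i g x * f x)"
      using Suc.prems by (intro C_fun_add Suc.IH) (auto simp: C_fun_Suc intro: C_fun_mono[OF _ le_SucI])
    show "continuous_on UNIV (\<lambda>x. f x * g x)"
      using Suc.prems by (intro continuous_on_mult) (auto dest: C_fun_continuous)
  qed
qed (auto simp: C_fun_0 intro: continuous_intros)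

lemma C_fun_prod: "(\<And>i. i \<in> I \<Longrightarrow> C_fun r (f i)) \<Longrightarrow> C_fun r (\<lambda>x. \<Prod>i\<in>I. f i x)"
  by (induction I rule: infinite_finite_induct) (auto intro: C_fun_const C_fun_mult)

lemma C_fun_lincomb: "C_fun r f \<Longrightarrow> C_fun r g \<Longrightarrow> C_fun r (a *\<^sub>R f + b *\<^sub>R g)"
  using C_fun_add[OF C_fun_mult[OF C_fun_const] C_fun_mult[OF C_fun_const], of r f g a b]
  by (simp add: plus_fun_def scaleR_fun_def)

lemma C_fun_diff: "C_fun r f \<Longrightarrow> C_fun r g \<Longrightarrow> C_fun r (f - g)"
  using C_fun_lincomb[of r f g 1 "-1"] by simp

lemma iter_deriv_lincomb:
  assumes "C_fun r f" "C_fun r g" "length is \<le> r"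
  shows "iter_deriv is (a *\<^sub>R f + b *\<^sub>R g) x = a * iter_deriv is f x + b * iter_deriv is g x"
  using assms(3)
proof (induction "is" arbitrary: x)
  case (Cons i "is")
  have "((\<lambda>t. a * iter_deriv is f (x + t *\<^sub>R axis i 1) + b * iter_deriv is g (x + t *\<^sub>R axis i 1))
      has_field_derivative a * iter_deriv (i # is) f x + b * iter_deriv (i # is) g x) (at 0)"
    using assms Cons.prems by (intro DERIV_add DERIV_cmult C_fun_iter_DERIV) auto
  moreover have "iter_deriv is (a *\<^sub>R f + b *\<^sub>R g) = (\<lambda>y. a * iter_deriv is f y + b * iter_deriv is g y)"
    by (rule ext) (rule Cons.IH, use Cons.prems in simp)
  ultimately show ?case
    unfolding iter_deriv_Cons by (intro partial_deriv_eqI) (simp only:)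
qed (simp add: scaleR_fun_def)

lemma fsupport_ge: "f x \<noteq> 0 \<Longrightarrow> x \<in> fsupport f"
  using closure_subset[of "{x. f x \<noteq> 0}"] by (auto simp: fsupport_def)

lemma fsupport_lincomb: "fsupport (a *\<^sub>R f + b *\<^sub>R g) \<subseteq> fsupport f \<union> fsupport g"
  unfolding fsupport_def closure_Un[symmetric]
  by (rule closure_mono) (auto simp: scaleR_fun_def)

lemma fsupport_diff: "fsupport (f - g) \<subseteq> fsupport f \<union> fsupport g"
  using fsupport_lincomb[of 1 f "-1" g] by simp

lemma compact_fsupport_subset: "compact K \<Longrightarrow> fsupport f \<subseteq> K \<Longrightarrow> compact (fsupport f)"
  using bounded_subset[of K "fsupport f"] by (simp add: fsupport_def compact_eq_bounded_closed)

lemma test_fun_lincomb: "test_fun f \<Longrightarrow> test_fun g \<Longrightarrow> test_fun (a *\<^sub>R f + b *\<^sub>R g)"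
  unfolding test_fun_def
  using C_fun_lincomb compact_fsupport_subset[OF compact_Un fsupport_lincomb] by blast

lemma test_fun_diff: "test_fun f \<Longrightarrow> test_fun g \<Longrightarrow> test_fun (f - g)"
  using test_fun_lincomb[of f g 1 "-1"] by simp

text \<open>
  A derivative at \<open>x\<close> only depends on the function near \<open>x\<close>, and the complement of the
  support is open.
\<close>

lemma iter_deriv_eq_0:
  assumes "x \<notin> fsupport f"
  shows "iter_deriv is f x = 0"
  using assms
proof (induction "is" arbitrary: x)
  case Nil
  then show ?case using fsupport_ge by auto
next
  case (Cons i "is")
  have "\<forall>\<^sub>F t in nhds 0. x + t *\<^sub>R axis i 1 \<in> - fsupport f"
  proof -
    have "((\<lambda>t::real. x + t *\<^sub>R axis i 1) \<longlongrightarrow> x + 0 *\<^sub>R axis i 1) (nhds 0)"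
      by (intro tendsto_intros filterlim_ident)
    then show ?thesis
      using Cons.prems by (elim topological_tendstoD) (auto simp: fsupport_def)
  qed
  then have "\<forall>\<^sub>F t in nhds 0. iter_deriv is f (x + t *\<^sub>R axis i 1) = 0"
    by (rule eventually_mono) (use Cons.IH in auto)
  then have "((\<lambda>t. iter_deriv is f (x + t *\<^sub>R axis i 1)) has_field_derivative 0) (at 0)"
    by (subst DERIV_cong_ev[OF refl _ refl]) auto
  then show ?case
    unfolding iter_deriv_Cons by (rule partial_deriv_eqI)
qed

lemma finite_multiindices: "finite {is :: 'd::finite list. length is \<le> r}"
  using finite_lists_length_le[of "UNIV :: 'd set" r] by simp

text \<open>
  There are finitely many multi-indices of length at most \<open>r\<close>, and each of these derivatives is
  continuous with compact support. Hence \<open>C_norm\<close> is a genuine supremum and not a default value.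
\<close>

lemma iter_deriv_bounded:
  assumes "C_fun r f" "compact (fsupport f)"
  shows "bdd_above ((\<lambda>(is, x). \<bar>iter_deriv is f x\<bar>) ` ({is. length is \<le> r} \<times> UNIV))"
proof -
  have "\<exists>B. \<forall>x. \<bar>iter_deriv is f x\<bar> \<le> B" if "length is \<le> r" for "is"
  proof -
    have "compact (iter_deriv is f ` fsupport f)"
      using assms that
      by (intro compact_continuous_image) (auto intro: continuous_on_subset[OF C_fun_iter_continuous])
    then obtain B where B: "\<And>x. x \<in> fsupport f \<Longrightarrow> \<bar>iter_deriv is f x\<bar> \<le> B"
      by (auto dest!: compact_imp_bounded simp: bounded_iff) blast
    then have "\<bar>iter_deriv is f x\<bar> \<le> max 0 B" for x
      by (cases "x \<in> fsupport f") (auto simp: iter_deriv_eq_0 le_max_iff_disj)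
    then show ?thesis by blast
  qed
  then obtain B where B: "\<And>is x. length is \<le> r \<Longrightarrow> \<bar>iter_deriv is f x\<bar> \<le> B is"
    by metis
  have "\<bar>iter_deriv is f x\<bar> \<le> (\<Sum>js | length js \<le> r. \<bar>B js\<bar>)" if "length is \<le> r" for "is" x
  proof -
    have "\<bar>B is\<bar> \<le> (\<Sum>js | length js \<le> r. \<bar>B js\<bar>)"
      using that by (intro member_le_sum) (auto simp: finite_multiindices)
    then show ?thesis using B[OF that, of x] by linarith
  qed
  then show ?thesis by (auto simp: bdd_above_def)
qed

lemma abs_iter_deriv_le_C_norm:
  assumes "C_fun r f" "compact (fsupport f)" "length is \<le> r"
  shows "\<bar>iter_deriv is f x\<bar> \<le> C_norm r f"
  unfolding C_norm_def
  using cSUP_upper[OF _ iter_deriv_bounded[OF assms(1,2)], of "(is, x)"] assms(3) by auto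

lemma C_norm_le:
  "(\<And>is x. length is \<le> r \<Longrightarrow> \<bar>iter_deriv is f x\<bar> \<le> B) \<Longrightarrow> C_norm r f \<le> B"
  unfolding C_norm_def by (intro cSUP_least) (auto intro: exI[of _ "[]"])

lemma C_norm_nonneg: "C_fun r f \<Longrightarrow> compact (fsupport f) \<Longrightarrow> 0 \<le> C_norm r f"
  using abs_iter_deriv_le_C_norm[of r f "[]" 0] by simp

lemma C_norm_diff_le:
  assumes "C_fun r f" "compact (fsupport f)" "C_fun r g" "compact (fsupport g)"
      "C_fun r h" "compact (fsupport h)"
  shows "C_norm r (f - g) \<le> C_norm r (f - h) + C_norm r (g - h)"
proof (rule C_norm_le)
  fix "is" :: "'a list" and x assume l: "length is \<le> r"
  have diff: "iter_deriv is (u - v) x = iter_deriv is u x - iter_deriv is v x"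
    if "C_fun r u" "C_fun r v" for u v
    using iter_deriv_lincomb[OF that l, of 1 "-1" x] by simp
  have c: "compact (fsupport (f - h))" "compact (fsupport (g - h))"
    using assms compact_fsupport_subset[OF compact_Un fsupport_diff] by blast+
  show "\<bar>iter_deriv is (f - g) x\<bar> \<le> C_norm r (f - h) + C_norm r (g - h)"
    using abs_iter_deriv_le_C_norm[OF C_fun_diff[OF assms(1,5)] c(1) l, of x]
      abs_iter_deriv_le_C_norm[OF C_fun_diff[OF assms(3,5)] c(2) l, of x]
    by (simp add: diff assms)
qed

section \<open>Mollification\<close>

text \<open>
  The functions \<open>P(1/t) exp(-1/t)\<close> for \<open>t > 0\<close>, extended by zero. This family is closed under
  differentiation, so that each of its members is smooth.
\<close>

definition flat :: "real poly \<Rightarrow> real \<Rightarrow> real"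
  where "flat P t = (if t > 0 then poly P (1 / t) * exp (- (1 / t)) else 0)"

lemma flat_tendsto_0:
  fixes P :: "real poly"
  shows "((\<lambda>t. poly P (1 / t) * exp (- (1 / t))) \<longlongrightarrow> 0) (at_right 0)"
proof -
  have "((\<lambda>u::real. \<Sum>i\<le>degree P. coeff P i * (u ^ i / exp u)) \<longlongrightarrow> (\<Sum>i\<le>degree P. coeff P i * 0)) at_top"
    by (intro tendsto_intros tendsto_power_div_exp_0)
  then have "((\<lambda>u. poly P u * exp (- u)) \<longlongrightarrow> 0) at_top"
    by (simp add: poly_altdef sum_divide_distrib exp_minus field_simps)
  moreover have "filterlim (\<lambda>t::real. 1 / t) at_top (at_right 0)"
    using filterlim_inverse_at_top_right by (simp add: inverse_eq_divide)
  ultimately show ?thesis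
    by (rule filterlim_compose)
qed

lemma DERIV_flat: "(flat P has_field_derivative flat (monom 1 2 * (P - pderiv P)) t) (at t)"
proof (cases t "0::real" rule: linorder_cases)
  case less
  have "((\<lambda>_. 0) has_field_derivative 0) (at t)" by simp
  then have "(flat P has_field_derivative 0) (at t)"
    by (rule has_field_derivative_transform_within_open[where S = "{..<0}"])
      (use less in \<open>auto simp: flat_def\<close>)
  then show ?thesis using less by (simp add: flat_def)
next
  case greater
  have "((\<lambda>t. poly P (1 / t) * exp (- (1 / t))) has_field_derivative
      flat (monom 1 2 * (P - pderiv P)) t) (at t)"
    using greater
    by (auto intro!: derivative_eq_intros DERIV_chain'[where g = "poly P"] poly_DERIV
        simp: flat_def poly_monom power2_eq_square field_simps)
  then show ?thesis
    by (rule has_field_derivative_transform_within_open[where S = "{0<..}"])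
      (use greater in \<open>auto simp: flat_def\<close>)
next
  case equal
  have "((\<lambda>h. flat P h / h) \<longlongrightarrow> 0) (at 0)"
  proof (rule filterlim_split_at)
    show "((\<lambda>h. flat P h / h) \<longlongrightarrow> 0) (at_left 0)"
      by (rule tendsto_eventually) (auto simp: eventually_at_filter flat_def)
    show "((\<lambda>h. flat P h / h) \<longlongrightarrow> 0) (at_right 0)"
      using flat_tendsto_0[of "pCons 0 P"]
      by (rule Lim_transform_eventually) (auto simp: eventually_at_filter flat_def)
  qed
  then show ?thesis
    using equal by (simp add: has_field_derivative_iff flat_def)
qed

lemma C_fun_flat: "C_fun r (\<lambda>x::real^'d::finite. flat P (a + c * x $ i))"
proof (induction r arbitrary: P)
  have cont: "continuous_on UNIV (\<lambda>x::real^'d. flat P (a + c * x $ i))" for P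
  proof -
    have "continuous_on UNIV (flat P)"
      using DERIV_continuous_on[OF DERIV_flat] by blast
    then show ?thesis
      by (rule continuous_on_compose2) (auto intro!: continuous_intros)
  qed
  case 0
  then show ?case using cont by (simp add: C_fun_0)
next
  case (Suc r)
  have cont: "continuous_on UNIV (\<lambda>x::real^'d. flat P (a + c * x $ i))"
    using Suc.IH by (rule C_fun_continuous)
  show ?case
  proof (rule C_fun_SucI)
    fix j :: 'd and x :: "real^'d"
    have "((\<lambda>t. a + c * (x + t *\<^sub>R axis j 1) $ i) has_field_derivative c * axis j 1 $ i) (at 0)"
      by (auto intro!: derivative_eq_intros)
    from DERIV_chain'[OF this DERIV_flat]
    show "((\<lambda>t. flat P (a + c * (x + t *\<^sub>R axis j 1) $ i)) has_field_derivative
        c * axis j 1 $ i * flat (monom 1 2 * (P - pderiv P)) (a + c * x $ i)) (at 0)"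
      by (simp add: mult.commute)
    show "C_fun r (\<lambda>x::real^'d. c * axis j 1 $ i * flat (monom 1 2 * (P - pderiv P)) (a + c * x $ i))"
      by (intro C_fun_mult C_fun_const Suc.IH)
  qed (rule cont)
qed

definition cube :: "real \<Rightarrow> (real^'d::finite) set"
  where "cube R = cbox (\<chi> i. - R) (\<chi> i. R)"

lemma mem_cube: "x \<in> cube R \<longleftrightarrow> (\<forall>i. \<bar>x $ i\<bar> \<le> R)"
  by (auto simp: cube_def mem_box_cart abs_le_iff minus_le_iff)

lemma compact_cube: "compact (cube R)"
  by (simp add: cube_def)

text \<open>
  A normalised product over the coordinates of one-dimensional bumps, where the bump is
  \<open>flat\<close> applied to the distances from the two end points of \<open>[- e, e]\<close>.
\<close>

lemma mollifier_exists:
  assumes "e > 0"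
  obtains \<rho> :: "real^'d::finite \<Rightarrow> real"
  where "\<And>r. C_fun r \<rho>" "\<And>x. 0 \<le> \<rho> x" "\<And>x. x \<notin> cube e \<Longrightarrow> \<rho> x = 0" "integral (cube e) \<rho> = 1"
proof -
  define b :: "real^'d \<Rightarrow> real" where "b x = (\<Prod>i\<in>UNIV. flat 1 (e + 1 * x $ i) * flat 1 (e + (-1) * x $ i))" for x
  have C: "C_fun r b" for r
    unfolding b_def by (intro C_fun_prod C_fun_mult C_fun_flat)
  have nonneg: "0 \<le> b x" for x
    unfolding b_def by (intro prod_nonneg) (auto simp: flat_def)
  have zero: "b x = 0" if x: "x \<notin> cube e" for x
  proof -
    obtain i where "\<not> \<bar>x $ i\<bar> \<le> e" using x by (auto simp: mem_cube)
    then have "flat 1 (e + 1 * x $ i) * flat 1 (e + (-1) * x $ i) = 0"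
      by (auto simp: flat_def)
    then show ?thesis unfolding b_def by (meson finite UNIV_I prod_zero)
  qed
  have "b 0 > 0"
    unfolding b_def using assms by (intro prod_pos) (auto simp: flat_def)
  have cont: "continuous_on (cube e) b"
    using C_fun_continuous[OF C] continuous_on_subset by blast
  have "integral (cube e) b \<noteq> 0"
  proof
    assume "integral (cube e) b = 0"
    then have "\<forall>x\<in>cube e. b x = 0"
      using cont nonneg assms unfolding cube_def
      by (subst (asm) integral_cbox_eq_0_iff) (auto simp: interval_ne_empty_cart)
    then show False using \<open>b 0 > 0\<close> assms by (auto simp: mem_cube)
  qed
  moreover have "integral (cube e) b \<ge> 0"
    using nonneg cont by (intro integral_nonneg) (auto simp: cube_def integrable_continuous)
  ultimately have pos: "integral (cube e) b > 0" by simp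
  show thesis
  proof (rule that[of "\<lambda>x. inverse (integral (cube e) b) * b x"])
    show "C_fun r (\<lambda>x. inverse (integral (cube e) b) * b x)" for r
      by (intro C_fun_mult C_fun_const C)
  qed (use pos nonneg zero in auto)
qed

definition conv :: "(real^'d::finite \<Rightarrow> real) \<Rightarrow> (real^'d \<Rightarrow> real) \<Rightarrow> real^'d \<Rightarrow> real"
  where "conv f g x = integral UNIV (\<lambda>y. f y * g (x - y))"

lemma conv_eq_cube:
  assumes "\<And>x. x \<notin> cube R \<Longrightarrow> f x = 0"
  shows "conv f g x = integral (cube R) (\<lambda>y. f y * g (x - y))"
proof -
  have "(\<lambda>y. f y * g (x - y)) = (\<lambda>y. if y \<in> cube R then f y * g (x - y) else 0)"
    using assms by auto
  then show ?thesis
    unfolding conv_def by (subst (2) integral_restrict_UNIV[symmetric]) simp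
qed

text \<open>
  The derivatives of \<open>conv f g\<close> are computed by differentiating \<open>g\<close>. With both orders of
  the factors available, the convolution of a mollifier with a \<open>C\<^sup>r\<close> function is smooth, and its
  derivatives up to order \<open>r\<close> are the mollified derivatives of that function.
\<close>

lemma conv_commute:
  assumes f: "continuous_on UNIV f" "\<And>x. x \<notin> cube R \<Longrightarrow> f x = 0" and g: "continuous_on UNIV g"
  shows "conv f g x = conv g f x"
proof -
  let ?h = "\<lambda>y. f y * g (x - y)"
  have "continuous_on (cube R) ?h"
    by (intro continuous_intros continuous_on_subset[OF f(1)] continuous_on_compose2[OF g]) auto
  then have "?h integrable_on cube R"
    unfolding cube_def by (rule integrable_continuous)
  then have "(?h has_integral conv f g x) (cube R)"
    using conv_eq_cube[of R f, OF f(2)] by (simp add: integrable_integral)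
  from has_integral_affinity[OF this[unfolded cube_def], of "-1" x]
  have "((\<lambda>y. ?h (x - y)) has_integral conv f g x) ((\<lambda>y. x - y) ` cube R)"
    by (simp add: cube_def)
  then have "((\<lambda>y. ?h (x - y)) has_integral conv f g x) UNIV"
  proof (rule has_integral_on_superset)
    fix y assume y: "y \<notin> (\<lambda>y. x - y) ` cube R"
    have "x - y \<notin> cube R"
    proof
      assume "x - y \<in> cube R"
      then have "x - (x - y) \<in> (\<lambda>y. x - y) ` cube R" by (rule imageI)
      then show False using y by simp
    qed
    then show "?h (x - y) = 0" using f(2) by simp
  qed simp
  then have "integral UNIV (\<lambda>y. ?h (x - y)) = conv f g x"
    by (rule integral_unique)
  then show ?thesis by (simp add: conv_def mult.commute)
qed

lemma continuous_on_conv: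
  assumes f: "continuous_on UNIV f" "\<And>x. x \<notin> cube R \<Longrightarrow> f x = 0" and g: "continuous_on UNIV g"
  shows "continuous_on UNIV (conv f g)"
proof -
  have "continuous_on UNIV (\<lambda>x. integral (cube R) (\<lambda>y. f y * g (x - y)))"
    unfolding cube_def split_beta
    by (intro integral_continuous_on_param)
      (auto simp: split_beta intro!: continuous_intros continuous_on_compose2[OF f(1)] continuous_on_compose2[OF g])
  moreover have "conv f g = (\<lambda>x. integral (cube R) (\<lambda>y. f y * g (x - y)))"
    using conv_eq_cube[of R f, OF f(2)] by (intro ext) simp
  ultimately show ?thesis by simp
qed

lemma DERIV_conv:
  assumes f: "continuous_on UNIV f" "\<And>x. x \<notin> cube R \<Longrightarrow> f x = 0" and g: "continuous_on UNIV g"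
    and D: "\<And>x. ((\<lambda>t. g (x + t *\<^sub>R axis i 1)) has_field_derivative D x) (at 0)"
    and D': "continuous_on UNIV D"
  shows "((\<lambda>t. conv f g (x + t *\<^sub>R axis i 1)) has_field_derivative conv f D x) (at 0)"
proof -
  have "((\<lambda>t. integral (cube R) (\<lambda>y. f y * g (x + t *\<^sub>R axis i 1 - y))) has_field_derivative
      integral (cube R) (\<lambda>y. f y * D (x + 0 *\<^sub>R axis i 1 - y))) (at 0 within UNIV)"
    unfolding cube_def
  proof (rule leibniz_rule_field_derivative)
    fix t and y :: "real^'a"
    have "((\<lambda>t'. g ((x - y + t *\<^sub>R axis i 1) + t' *\<^sub>R axis i 1)) has_field_derivative D (x - y + t *\<^sub>R axis i 1)) (at 0)"
      by (rule D)
    then have "((\<lambda>t'. (\<lambda>t. g (x - y + t *\<^sub>R axis i 1)) (t' + t)) has_field_derivative D (x - y + t *\<^sub>R axis i 1)) (at 0)"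
      by (simp add: algebra_simps)
    then have "((\<lambda>t. g (x - y + t *\<^sub>R axis i 1)) has_field_derivative D (x - y + t *\<^sub>R axis i 1)) (at (0 + t))"
      by (subst DERIV_shift)
    then show "((\<lambda>t. f y * g (x + t *\<^sub>R axis i 1 - y)) has_field_derivative
        f y * D (x + t *\<^sub>R axis i 1 - y)) (at t within UNIV)"
      by (intro DERIV_cmult) (simp add: algebra_simps)
  next
    fix t :: real
    show "(\<lambda>y. f y * g (x + t *\<^sub>R axis i 1 - y)) integrable_on cbox (\<chi> i. - R) (\<chi> i. R)"
      by (intro integrable_continuous continuous_intros continuous_on_compose2[OF f(1)]
          continuous_on_compose2[OF g]) auto
  next
    show "continuous_on (UNIV \<times> cbox (\<chi> i. - R) (\<chi> i. R))
        (\<lambda>(t, y). f y * D (x + t *\<^sub>R axis i 1 - y))"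
      unfolding split_beta
      by (intro continuous_intros continuous_on_compose2[OF f(1)] continuous_on_compose2[OF D']) auto
  qed auto
  then show ?thesis
    by (simp add: conv_eq_cube[OF f(2)])
qed

lemma C_fun_conv:
  assumes f: "continuous_on UNIV f" "\<And>x. x \<notin> cube R \<Longrightarrow> f x = 0"
  shows "C_fun r g \<Longrightarrow> C_fun r (conv f g)"
    and "C_fun r g \<Longrightarrow> length is \<le> r \<Longrightarrow> iter_deriv is (conv f g) = conv f (iter_deriv is g)"
proof -
  have D: "((\<lambda>t. conv f g (x + t *\<^sub>R axis i 1)) has_field_derivative conv f (partial_deriv i g) x) (at 0)"
    if "C_fun (Suc r) g" for g x i r
    using that by (intro DERIV_conv[OF f] C_fun_Suc_DERIV) (auto simp: C_fun_Suc intro: C_fun_continuous)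
  show "C_fun r g \<Longrightarrow> C_fun r (conv f g)"
  proof (induction r arbitrary: g)
    case 0
    then show ?case using continuous_on_conv[OF f] by (simp add: C_fun_0)
  next
    case (Suc r)
    show ?case
      by (rule C_fun_SucI[OF _ D[OF Suc.prems] Suc.IH])
        (use Suc.prems in \<open>auto simp: C_fun_Suc intro!: continuous_on_conv[OF f]\<close>)
  qed
  show "C_fun r g \<Longrightarrow> length is \<le> r \<Longrightarrow> iter_deriv is (conv f g) = conv f (iter_deriv is g)"
  proof (induction r arbitrary: g "is")
    case (Suc r)
    show ?case
    proof (cases "is" rule: rev_cases)
      case (snoc js i)
      have "partial_deriv i (conv f g) = conv f (partial_deriv i g)"
        using partial_deriv_eqI[OF D[OF Suc.prems(1)]] by blast
      then show ?thesis
        using Suc snoc by (simp add: iter_deriv_snoc C_fun_Suc)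
    qed simp
  qed simp
qed

lemma conv_mollifier_close:
  assumes \<rho>: "continuous_on UNIV \<rho>" "\<And>x. 0 \<le> \<rho> x" "\<And>x. x \<notin> cube e \<Longrightarrow> \<rho> x = 0" "integral (cube e) \<rho> = 1"
    and h: "continuous_on UNIV h" "\<And>y. y \<in> cube e \<Longrightarrow> \<bar>h (x - y) - h x\<bar> \<le> c"
  shows "\<bar>conv \<rho> h x - h x\<bar> \<le> c"
proof -
  have int: "(\<lambda>y. \<rho> y * k y) integrable_on cube e" if "continuous_on UNIV k" for k
    unfolding cube_def using continuous_on_subset[OF \<rho>(1)] continuous_on_subset[OF that]
    by (intro integrable_continuous continuous_intros) auto
  have h': "continuous_on UNIV (\<lambda>y. h (x - y))"
    by (intro continuous_on_compose2[OF h(1)] continuous_intros) auto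
  have "conv \<rho> h x - h x = integral (cube e) (\<lambda>y. \<rho> y * h (x - y)) - integral (cube e) (\<lambda>y. \<rho> y * h x)"
    by (simp add: conv_eq_cube[OF \<rho>(3)] \<rho>(4))
  also have "\<dots> = integral (cube e) (\<lambda>y. \<rho> y * (h (x - y) - h x))"
    using int[OF h'] int[OF continuous_on_const]
    by (subst Henstock_Kurzweil_Integration.integral_diff[symmetric]) (simp_all add: right_diff_distrib)
  also have "\<bar>\<dots>\<bar> \<le> integral (cube e) (\<lambda>y. \<rho> y * c)"
    unfolding real_norm_def[symmetric]
  proof (rule integral_norm_bound_integral)
    show "norm (\<rho> y * (h (x - y) - h x)) \<le> \<rho> y * c" if "y \<in> cube e" for y
      using h(2)[OF that] \<rho>(2)[of y] by (simp add: abs_mult mult_left_mono)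
  qed (intro int continuous_intros h')+
  also have "\<dots> = c" using \<rho>(4) by simp
  finally show ?thesis .
qed

text \<open>
  All derivatives up to order \<open>r\<close> of a compactly supported \<open>C\<^sup>r\<close> function are uniformly
  continuous, so convolution with a mollifier of small support moves none of them by much.
\<close>

lemma iter_deriv_uniformly_continuous:
  fixes f :: "real^'d::finite \<Rightarrow> real"
  assumes "C_fun r f" "compact (fsupport f)" "e > 0"
  obtains \<delta> where "\<delta> > 0"
    "\<And>is x y. length is \<le> r \<Longrightarrow> dist y x < \<delta> \<Longrightarrow> \<bar>iter_deriv is f y - iter_deriv is f x\<bar> < e"
proof -
  have "\<forall>\<^sub>F d in at_right 0. \<forall>x y. dist y x < d \<longrightarrow> \<bar>iter_deriv is f y - iter_deriv is f x\<bar> < e"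
    if "length is \<le> r" for "is"
  proof -
    have "\<exists>K. compact K \<and> (\<forall>x y. x \<in> fsupport f \<and> dist y x \<le> 1 \<longrightarrow> x \<in> K \<and> y \<in> K)"
    proof -
      obtain B where "\<And>x. x \<in> fsupport f \<Longrightarrow> norm x \<le> B"
        using compact_imp_bounded[OF assms(2)] by (auto simp: bounded_iff)
      then have "x \<in> cball 0 (B + 1) \<and> y \<in> cball 0 (B + 1)" if "x \<in> fsupport f" "dist y x \<le> 1" for x y
        using that norm_triangle_sub[of y x] by (fastforce simp: dist_norm norm_minus_commute)
      then show ?thesis by (intro exI[of _ "cball 0 (B + 1)"]) auto
    qed
    then obtain K where K: "compact K" "\<And>x y. x \<in> fsupport f \<Longrightarrow> dist y x \<le> 1 \<Longrightarrow> x \<in> K \<and> y \<in> K"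
      by blast
    have "uniformly_continuous_on K (iter_deriv is f)"
      using K(1) continuous_on_subset[OF C_fun_iter_continuous[OF assms(1) that]]
      by (intro compact_uniformly_continuous) auto
    then obtain d where d: "d > 0" "\<And>x y. x \<in> K \<Longrightarrow> y \<in> K \<Longrightarrow> dist y x < d \<Longrightarrow>
        dist (iter_deriv is f y) (iter_deriv is f x) < e"
      using \<open>e > 0\<close> by (auto simp: uniformly_continuous_on_def)
    have "\<bar>iter_deriv is f y - iter_deriv is f x\<bar> < e" if "dist y x < min d 1" for x y
    proof (cases "x \<in> fsupport f \<or> y \<in> fsupport f")
      case True
      then have "x \<in> K" "y \<in> K" using K(2)[of x y] K(2)[of y x] that by (auto simp: dist_commute)
      then show ?thesis using d(2) that by (simp add: dist_real_def)
    qed (use \<open>e > 0\<close> in \<open>auto simp: iter_deriv_eq_0\<close>)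
    then show ?thesis
      using d(1) by (auto simp: eventually_at_right_field intro!: exI[of _ "min d 1"])
  qed
  then have "\<forall>\<^sub>F d in at_right 0. \<forall>is\<in>{is. length is \<le> r}. \<forall>x y. dist y x < d \<longrightarrow>
      \<bar>iter_deriv is f y - iter_deriv is f x\<bar> < e"
    by (intro eventually_ball_finite finite_multiindices) auto
  then have "\<forall>\<^sub>F d in at_right 0. 0 < d \<and> (\<forall>is\<in>{is. length is \<le> r}. \<forall>x y. dist y x < d \<longrightarrow>
      \<bar>iter_deriv is f y - iter_deriv is f x\<bar> < e)"
    using eventually_at_right_less[of "0::real"] by eventually_elim auto
  then obtain d where "0 < d \<and> (\<forall>is\<in>{is. length is \<le> r}. \<forall>x y. dist y x < d \<longrightarrow>
      \<bar>iter_deriv is f y - iter_deriv is f x\<bar> < e)"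
    using eventually_happens trivial_limit_at_right_real by blast
  then show thesis using that by blast
qed

lemma test_fun_dense:
  fixes f :: "real^'d::finite \<Rightarrow> real"
  assumes C: "C_fun r f" and R: "fsupport f \<subseteq> cube R" and e: "e > 0"
  shows "\<exists>u. test_fun u \<and> fsupport u \<subseteq> cube (R + 1) \<and> C_norm r (u - f) \<le> e"
proof -
  have cs: "compact (fsupport f)"
    using R compact_cube compact_fsupport_subset by blast
  obtain \<delta> where \<delta>: "\<delta> > 0"
    "\<And>is x y. length is \<le> r \<Longrightarrow> dist y x < \<delta> \<Longrightarrow> \<bar>iter_deriv is f y - iter_deriv is f x\<bar> < e"
    using iter_deriv_uniformly_continuous[OF C cs e] by metis
  define \<eta> where "\<eta> = min 1 (\<delta> / (2 * real CARD('d)))"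
  have \<eta>: "\<eta> > 0" "\<eta> \<le> 1" "real CARD('d) * \<eta> < \<delta>"
    using \<delta>(1) by (auto simp: \<eta>_def min_def field_simps)
  obtain \<rho> :: "real^'d \<Rightarrow> real" where \<rho>: "\<And>r. C_fun r \<rho>" "\<And>x. 0 \<le> \<rho> x"
      "\<And>x. x \<notin> cube \<eta> \<Longrightarrow> \<rho> x = 0" "integral (cube \<eta>) \<rho> = 1"
    using mollifier_exists[OF \<eta>(1)] by metis
  have f0: "f x = 0" if "x \<notin> cube R" for x
    using that R fsupport_ge by blast
  let ?u = "conv \<rho> f"
  have "\<rho> y * f (x - y) = 0" if "x \<notin> cube (R + 1)" for x y
  proof (cases "y \<in> cube \<eta>")
    case True
    obtain i where "\<bar>x $ i\<bar> > R + 1" using \<open>x \<notin> cube (R + 1)\<close> by (auto simp: mem_cube not_le)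
    moreover have "\<bar>y $ i\<bar> \<le> 1" using True \<eta>(2) by (auto simp: mem_cube intro: order.trans)
    ultimately have "\<bar>(x - y) $ i\<bar> > R" by simp
    then have "x - y \<notin> cube R" by (auto simp: mem_cube not_le)
    then show ?thesis using f0 by simp
  qed (simp add: \<rho>(3))
  then have u0: "?u x = 0" if "x \<notin> cube (R + 1)" for x
    using that unfolding conv_def by (subst integral_cong[where g = "\<lambda>_. 0"]) auto
  then have supp: "fsupport ?u \<subseteq> cube (R + 1)"
    unfolding fsupport_def by (intro closure_minimal compact_imp_closed[OF compact_cube]) blast
  have "?u = conv f \<rho>"
    using conv_commute[OF C_fun_continuous[OF \<rho>(1)] \<rho>(3) C_fun_continuous[OF C]] by blast
  then have "C_fun k ?u" for k
    using C_fun_conv(1)[OF C_fun_continuous[OF C] f0 \<rho>(1)] by simp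
  then have test: "test_fun ?u"
    using compact_fsupport_subset[OF compact_cube supp] by (simp add: test_fun_def)
  have "C_norm r (?u - f) \<le> e"
  proof (rule C_norm_le)
    fix "is" :: "'d list" and x assume l: "length is \<le> r"
    have "iter_deriv is (?u - f) x = iter_deriv is ?u x - iter_deriv is f x"
      using iter_deriv_lincomb[OF _ C l, of ?u 1 "-1" x] test by (simp add: test_fun_def)
    also have "\<dots> = conv \<rho> (iter_deriv is f) x - iter_deriv is f x"
      using C_fun_conv(2)[OF C_fun_continuous[OF \<rho>(1)] \<rho>(3) C l] by simp
    also have "\<bar>\<dots>\<bar> \<le> e"
    proof (rule conv_mollifier_close[OF C_fun_continuous[OF \<rho>(1)] \<rho>(2,3,4)])
      show "continuous_on UNIV (iter_deriv is f)"
        by (rule C_fun_iter_continuous[OF C l])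
      fix y :: "real^'d" assume "y \<in> cube \<eta>"
      then have "norm y \<le> (\<Sum>i\<in>(UNIV::'d set). \<eta>)"
        by (intro order.trans[OF norm_le_l1_cart] sum_mono) (auto simp: mem_cube)
      then have "dist (x - y) x < \<delta>"
        using \<eta>(3) by (simp add: dist_norm)
      then show "\<bar>iter_deriv is f (x - y) - iter_deriv is f x\<bar> \<le> e"
        using \<delta>(2)[OF l] by (simp add: less_imp_le)
    qed
    finally show "\<bar>iter_deriv is (?u - f) x\<bar> \<le> e" .
  qed
  with test supp show ?thesis by blast
qed

section \<open>The pairing with finitely differentiable test functions\<close>

lemma approximates_exists:
  fixes f :: "real^'d::finite \<Rightarrow> real"
  assumes C: "C_fun r f" and cs: "compact (fsupport f)"
  shows "\<exists>u. approximates r u f"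
proof -
  obtain B where "\<And>x. x \<in> fsupport f \<Longrightarrow> norm x \<le> B"
    using compact_imp_bounded[OF cs] by (auto simp: bounded_iff)
  then have R: "fsupport f \<subseteq> cube B"
    using component_le_norm_cart order.trans by (fastforce simp: mem_cube)
  have "\<forall>n. \<exists>u. test_fun u \<and> fsupport u \<subseteq> cube (B + 1) \<and> C_norm r (u - f) \<le> inverse (real (Suc n))"
    using test_fun_dense[OF C R] by simp
  then obtain u where u: "\<And>n. test_fun (u n)" "\<And>n. fsupport (u n) \<subseteq> cube (B + 1)"
      "\<And>n. C_norm r (u n - f) \<le> inverse (real (Suc n))"
    by metis
  have "(\<lambda>n. C_norm r (u n - f)) \<longlonglongrightarrow> 0"
  proof (rule tendsto_sandwich[OF _ _ tendsto_const LIMSEQ_inverse_real_of_nat])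
    show "\<forall>\<^sub>F n in sequentially. 0 \<le> C_norm r (u n - f)"
    proof (intro always_eventually allI C_norm_nonneg C_fun_diff C)
      fix n
      show "C_fun r (u n)" using u(1) by (auto simp: test_fun_def)
      show "compact (fsupport (u n - f))"
        using u(1) cs compact_fsupport_subset[OF compact_Un fsupport_diff] by (auto simp: test_fun_def)
    qed
  qed (use u(3) in auto)
  then show ?thesis
    unfolding approximates_def using u(1,2) compact_cube by blast
qed

lemma pairing_cong:
  "(\<And>\<phi>. test_fun \<phi> \<Longrightarrow> \<xi> \<phi> = \<zeta> \<phi>) \<Longrightarrow> pairing r \<xi> f = pairing r \<zeta> f"
  unfolding pairing_def approximates_def by (intro arg_cong[where f = The] ext) auto

text \<open>
  Without an approximating sequence every number would satisfy the condition that defines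
  \<open>pairing\<close>; the density of test functions makes the description definite.
\<close>

lemma pairing_eqI:
  assumes "C_fun r f" "compact (fsupport f)"
    and lim: "\<And>u. approximates r u f \<Longrightarrow> (\<lambda>n. \<xi> (u n)) \<longlonglongrightarrow> c"
  shows "pairing r \<xi> f = c"
  unfolding pairing_def
proof (rule the_equality)
  obtain u where u: "approximates r u f"
    using approximates_exists[OF assms(1,2)] by blast
  fix c' assume "\<forall>u. approximates r u f \<longrightarrow> (\<lambda>n. \<xi> (u n)) \<longlonglongrightarrow> c'"
  then show "c' = c" using u lim LIMSEQ_unique by blast
qed (use lim in blast)

lemma distribution_diff:
  assumes "distribution \<xi>" "test_fun f" "test_fun g"
  shows "\<xi> (f - g) = \<xi> f - \<xi> g"
proof -
  have "\<xi> (1 *\<^sub>R f + (-1) *\<^sub>R g) = 1 * \<xi> f + (-1) * \<xi> g"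
    using assms unfolding distribution_def by blast
  then show ?thesis by simp
qed

text \<open>
  A distribution of order \<open>r\<close> is Lipschitz in the \<open>C\<^sup>r\<close> norm on functions supported in a common
  compact set. So its values along an approximating sequence are Cauchy, and any two
  approximating sequences have the same limit.
\<close>

lemma pairing_LIMSEQ:
  fixes f :: "real^'d::finite \<Rightarrow> real"
  assumes \<xi>: "distribution \<xi>" "of_order r \<xi>" and f: "C_fun r f" "compact (fsupport f)"
    and u: "approximates r u f"
  shows "(\<lambda>n. \<xi> (u n)) \<longlonglongrightarrow> pairing r \<xi> f"
proof -
  have bound: "\<exists>C\<ge>0. \<forall>m n. \<bar>\<xi> (u m) - \<xi> (v n)\<bar> \<le> C * (C_norm r (u m - f) + C_norm r (v n - f))"
    if u: "approximates r u f" and v: "approximates r v f" for u v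
  proof -
    obtain K where K: "compact K" "\<And>n. fsupport (u n) \<subseteq> K" "\<And>n. test_fun (u n)"
      using u by (auto simp: approximates_def)
    obtain L where L: "compact L" "\<And>n. fsupport (v n) \<subseteq> L" "\<And>n. test_fun (v n)"
      using v by (auto simp: approximates_def)
    have "compact (K \<union> L)" using K(1) L(1) by (rule compact_Un)
    then obtain C where C: "\<And>g. test_fun g \<Longrightarrow> fsupport g \<subseteq> K \<union> L \<Longrightarrow> \<bar>\<xi> g\<bar> \<le> C * C_norm r g"
      using \<xi>(2) unfolding of_order_def of_order_on_def by meson
    have "\<bar>\<xi> (u m) - \<xi> (v n)\<bar> \<le> \<bar>C\<bar> * (C_norm r (u m - f) + C_norm r (v n - f))" for m n
    proof -
      have cf: "C_fun r (u m)" "compact (fsupport (u m))" "C_fun r (v n)" "compact (fsupport (v n))"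
        using K(3) L(3) by (auto simp: test_fun_def)
      have "\<bar>\<xi> (u m) - \<xi> (v n)\<bar> = \<bar>\<xi> (u m - v n)\<bar>"
        using distribution_diff[OF \<xi>(1) K(3) L(3)] by simp
      also have "\<dots> \<le> C * C_norm r (u m - v n)"
        using K(2)[of m] L(2)[of n] fsupport_diff[of "u m" "v n"]
        by (intro C test_fun_diff K(3) L(3)) blast
      also have "\<dots> \<le> \<bar>C\<bar> * C_norm r (u m - v n)"
        using test_fun_diff[OF K(3)[of m] L(3)[of n]]
        by (intro mult_right_mono C_norm_nonneg) (auto simp: test_fun_def)
      also have "\<dots> \<le> \<bar>C\<bar> * (C_norm r (u m - f) + C_norm r (v n - f))"
        by (intro mult_left_mono C_norm_diff_le cf f) auto
      finally show ?thesis .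
    qed
    then show ?thesis by (intro exI[of _ "\<bar>C\<bar>"]) simp
  qed
  have lim0: "(\<lambda>n. C_norm r (v n - f)) \<longlonglongrightarrow> 0" if "approximates r v f" for v
    using that by (simp add: approximates_def)
  obtain C where C: "C \<ge> 0"
      "\<And>m n. \<bar>\<xi> (u m) - \<xi> (u n)\<bar> \<le> C * (C_norm r (u m - f) + C_norm r (u n - f))"
    using bound[OF u u] by blast
  have "Cauchy (\<lambda>n. \<xi> (u n))"
  proof (rule CauchyI)
    fix e :: real assume "e > 0"
    have "(\<lambda>n. C * C_norm r (u n - f)) \<longlonglongrightarrow> 0"
      using tendsto_mult_left[OF lim0[OF u], of C] by simp
    then have "\<forall>\<^sub>F n in sequentially. C * C_norm r (u n - f) < e / 2"
      using \<open>e > 0\<close> by (intro order_tendstoD) auto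
    then obtain N where N: "\<And>n. n \<ge> N \<Longrightarrow> C * C_norm r (u n - f) < e / 2"
      by (auto simp: eventually_sequentially)
    show "\<exists>N. \<forall>m\<ge>N. \<forall>n\<ge>N. norm (\<xi> (u m) - \<xi> (u n)) < e"
    proof (intro exI allI impI)
      fix m n assume "m \<ge> N" "n \<ge> N"
      then show "norm (\<xi> (u m) - \<xi> (u n)) < e"
        using C(2)[of m n] N[of m] N[of n] by (simp add: distrib_left)
    qed
  qed
  then obtain c where c: "(\<lambda>n. \<xi> (u n)) \<longlonglongrightarrow> c"
    using Cauchy_convergent convergent_def by blast
  have "pairing r \<xi> f = c"
  proof (rule pairing_eqI[OF f])
    fix v assume v: "approximates r v f"
    obtain C where C: "\<And>m n. \<bar>\<xi> (u m) - \<xi> (v n)\<bar> \<le> C * (C_norm r (u m - f) + C_norm r (v n - f))"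
      using bound[OF u v] by blast
    have "(\<lambda>n. C * (C_norm r (u n - f) + C_norm r (v n - f))) \<longlonglongrightarrow> 0"
      using tendsto_mult_left[OF tendsto_add[OF lim0[OF u] lim0[OF v]], of C] by simp
    then have "(\<lambda>n. \<xi> (u n) - \<xi> (v n)) \<longlonglongrightarrow> 0"
      by (rule Lim_null_comparison[rotated]) (use C in auto)
    from tendsto_diff[OF c this] show "(\<lambda>n. \<xi> (v n)) \<longlonglongrightarrow> c" by simp
  qed
  then show ?thesis using c by simp
qed

lemma pairing_lincomb:
  fixes f :: "real^'d::finite \<Rightarrow> real"
  assumes "distribution \<xi>" "of_order r \<xi>" "distribution \<zeta>" "of_order r \<zeta>"
    and f: "C_fun r f" "compact (fsupport f)"
    and eq: "\<And>\<phi>. test_fun \<phi> \<Longrightarrow> \<theta> \<phi> = a * \<xi> \<phi> + b * \<zeta> \<phi>"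
  shows "pairing r \<theta> f = a * pairing r \<xi> f + b * pairing r \<zeta> f"
proof (rule pairing_eqI[OF f])
  fix u assume u: "approximates r u f"
  have "(\<lambda>n. a * \<xi> (u n) + b * \<zeta> (u n)) \<longlonglongrightarrow> a * pairing r \<xi> f + b * pairing r \<zeta> f"
    using assms u by (intro tendsto_intros pairing_LIMSEQ)
  then show "(\<lambda>n. \<theta> (u n)) \<longlonglongrightarrow> a * pairing r \<xi> f + b * pairing r \<zeta> f"
    using u by (simp add: eq approximates_def)
qed

section \<open>Pairings are bounded by Besov norms\<close>

lemma epowr_ennreal: "0 \<le> x \<Longrightarrow> epowr (ennreal x) a = ennreal (x powr a)"
  by (simp add: epowr_def)

lemma epowr_mono: "x \<le> y \<Longrightarrow> 0 \<le> a \<Longrightarrow> epowr x a \<le> epowr y a"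
  by (cases x; cases y) (auto simp: epowr_def powr_mono2 top_unique)

lemma Lp_norm_ge:
  assumes p: "p > 0" and A: "A \<in> sets M" "ennreal m \<le> emeasure M A" "0 \<le> m"
    and g: "0 \<le> b" "\<And>x. x \<in> A \<Longrightarrow> ennreal b \<le> g x"
  shows "ennreal (b * m powr (1 / p)) \<le> Lp_norm M p g"
proof -
  have "ennreal (b powr p * m) = ennreal (b powr p) * ennreal m"
    by (simp add: ennreal_mult A(3))
  also have "\<dots> \<le> ennreal (b powr p) * emeasure M A"
    by (intro mult_left_mono A) auto
  also have "\<dots> = (\<integral>\<^sup>+x. epowr (ennreal b) p * indicator A x \<partial>M)"
    using A(1) g(1) by (simp add: nn_integral_cmult_indicator epowr_ennreal)
  also have "\<dots> \<le> (\<integral>\<^sup>+x. epowr (g x) p \<partial>M)"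
    using g p by (intro nn_integral_mono) (auto simp: indicator_def intro: epowr_mono)
  finally have "epowr (ennreal (b powr p * m)) (1 / p) \<le> Lp_norm M p g"
    unfolding Lp_norm_def using p by (intro epowr_mono) auto
  then show ?thesis
    using p g(1) A(3) by (simp add: epowr_ennreal powr_mult powr_powr)
qed

lemma sc_norm_less_iff:
  fixes x :: "real^'d::finite"
  assumes "\<forall>i. s i > 0" "R > 0"
  shows "sc_norm s x < R \<longleftrightarrow> (\<forall>i. \<bar>x $ i\<bar> < R ^ s i)"
proof -
  have "\<bar>x $ i\<bar> powr (1 / real (s i)) < R \<longleftrightarrow> \<bar>x $ i\<bar> < R ^ s i" for i
  proof -
    have n: "real (s i) > 0" using assms(1) by simp
    have 1: "(\<bar>x $ i\<bar> powr (1 / real (s i))) powr real (s i) = \<bar>x $ i\<bar>"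
      using n by (simp add: powr_powr)
    have 2: "R powr real (s i) = R ^ s i" using assms(2) by (simp add: powr_realpow)
    have "\<bar>x $ i\<bar> powr (1 / real (s i)) < R \<longleftrightarrow>
        (\<bar>x $ i\<bar> powr (1 / real (s i))) powr real (s i) < R powr real (s i)"
      using n assms(2) powr_less_mono2[of "real (s i)" "\<bar>x $ i\<bar> powr (1 / real (s i))" R]
        powr_mono2[of "real (s i)" R "\<bar>x $ i\<bar> powr (1 / real (s i))"]
      by (auto simp: not_less[symmetric])
    then show ?thesis by (simp add: 1 2)
  qed
  then show ?thesis
    unfolding sc_norm_def by (subst Max_less_iff) auto
qed

lemma sc_ball_0_1: "\<forall>i. s i > 0 \<Longrightarrow> sc_ball s 0 1 = {y::real^'d::finite. \<forall>i. \<bar>y $ i\<bar> < 1}"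
  by (simp add: sc_ball_def sc_norm_less_iff)

lemma DERIV_comp_dilation:
  fixes x :: "real^'d::finite"
  assumes "((\<lambda>t. f (x + (\<chi> j. c j * y $ j) + t *\<^sub>R axis i 1)) has_field_derivative D) (at 0)"
  shows "((\<lambda>t. f (x + (\<chi> j. c j * (y + t *\<^sub>R axis i 1) $ j))) has_field_derivative c i * D) (at 0)"
proof -
  have "x + (\<chi> j. c j * (y + t *\<^sub>R axis i 1) $ j) = x + (\<chi> j. c j * y $ j) + (c i * t) *\<^sub>R axis i 1" for t
    by (auto simp: vec_eq_iff axis_def algebra_simps)
  moreover have "((\<lambda>t. c i * t) has_field_derivative c i) (at 0)"
    by (auto intro!: derivative_eq_intros)
  from DERIV_chain'[OF this, of "\<lambda>t. f (x + (\<chi> j. c j * y $ j) + t *\<^sub>R axis i 1)" D]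
  have "((\<lambda>t. f (x + (\<chi> j. c j * y $ j) + (c i * t) *\<^sub>R axis i 1)) has_field_derivative c i * D) (at 0)"
    using assms by (simp add: mult.commute)
  ultimately show ?thesis by (simp only:)
qed

lemma C_fun_dilation:
  fixes x :: "real^'d::finite"
  shows "C_fun r f \<Longrightarrow> C_fun r (\<lambda>y. f (x + (\<chi> j. c j * y $ j)))"
proof (induction r arbitrary: f)
  case (Suc r)
  have "continuous_on UNIV (\<lambda>y. f (x + (\<chi> j. c j * y $ j)))"
    by (rule continuous_on_compose2[OF C_fun_continuous[OF Suc.prems]])
      (auto intro!: continuous_intros)
  moreover have "C_fun r (\<lambda>y. c i * partial_deriv i f (x + (\<chi> j. c j * y $ j)))" for i
    using Suc.prems by (intro C_fun_mult C_fun_const Suc.IH) (simp add: C_fun_Suc)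
  ultimately show ?case
    by (rule C_fun_SucI[OF _ DERIV_comp_dilation[OF C_fun_Suc_DERIV[OF Suc.prems]]])
next
  case 0
  then show ?case unfolding C_fun_0
    by (rule continuous_on_compose2) (auto intro!: continuous_intros)
qed

lemma iter_deriv_dilation:
  fixes x :: "real^'d::finite"
  assumes "C_fun r f" "length is \<le> r"
  shows "iter_deriv is (\<lambda>y. a * f (x + (\<chi> j. c j * y $ j))) y
    = a * (\<Prod>i\<leftarrow>is. c i) * iter_deriv is f (x + (\<chi> j. c j * y $ j))"
  using assms(2)
proof (induction "is" arbitrary: y)
  case (Cons i "is")
  have "iter_deriv is (\<lambda>y. a * f (x + (\<chi> j. c j * y $ j))) =
      (\<lambda>y. a * (\<Prod>i\<leftarrow>is. c i) * iter_deriv is f (x + (\<chi> j. c j * y $ j)))"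
    using Cons by (intro ext) simp
  moreover have "((\<lambda>t. a * (\<Prod>i\<leftarrow>is. c i) * iter_deriv is f (x + (\<chi> j. c j * (y + t *\<^sub>R axis i 1) $ j)))
      has_field_derivative a * (\<Prod>i\<leftarrow>is. c i) * (c i * iter_deriv (i # is) f (x + (\<chi> j. c j * y $ j)))) (at 0)"
    using Cons.prems by (intro DERIV_cmult DERIV_comp_dilation C_fun_iter_DERIV[OF assms(1)]) simp
  ultimately show ?case
    unfolding iter_deriv_Cons by (subst partial_deriv_eqI) (auto simp: ac_simps)
qed simp

text \<open>
  The support of a test function \<open>\<psi>\<close> in the unit ball has positive distance from the
  sphere. Hence \<open>\<psi>\<close> is itself of the form \<open>\<eta>\<^sup>\<lambda>\<^sub>x\<close> with \<open>\<eta>\<close> in the same class, for all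
  \<open>(x, \<lambda>)\<close> close to \<open>(0, 1)\<close>.
\<close>

lemma test_ball_rescale:
  fixes \<psi> :: "real^'d::finite \<Rightarrow> real"
  assumes s: "\<forall>i. s i > 0" and \<psi>: "\<psi> \<in> test_ball s k"
  shows "\<exists>l0 e. 0 < l0 \<and> l0 < 1 \<and> 0 < e \<and>
    (\<forall>l x. l0 < l \<and> l < 1 \<and> (\<forall>i. \<bar>x $ i\<bar> < e) \<longrightarrow> (\<exists>\<eta>\<in>test_ball s k. rescale s x l \<eta> = \<psi>))"
proof -
  have C: "C_fun k \<psi>" and cs: "compact (fsupport \<psi>)" and n1: "C_norm k \<psi> \<le> 1"
    and ball: "fsupport \<psi> \<subseteq> {y. \<forall>i. \<bar>y $ i\<bar> < 1}"
    using \<psi> s by (auto simp: test_ball_def sc_ball_0_1)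
  have "\<exists>c. 0 \<le> c \<and> c < 1 \<and> (\<forall>z\<in>fsupport \<psi>. \<bar>z $ i\<bar> \<le> c)" for i
  proof (cases "fsupport \<psi> = {}")
    case False
    have "\<exists>w\<in>fsupport \<psi>. \<forall>z\<in>fsupport \<psi>. \<bar>z $ i\<bar> \<le> \<bar>w $ i\<bar>"
      by (intro continuous_attains_sup cs False continuous_intros)
    then obtain w where "w \<in> fsupport \<psi>" "\<And>z. z \<in> fsupport \<psi> \<Longrightarrow> \<bar>z $ i\<bar> \<le> \<bar>w $ i\<bar>" by blast
    then show ?thesis using ball by (intro exI[of _ "\<bar>w $ i\<bar>"]) auto
  qed (auto intro: exI[of _ 0])
  then obtain c' where c': "\<And>i. 0 \<le> c' i" "\<And>i. c' i < 1" "\<And>i z. z \<in> fsupport \<psi> \<Longrightarrow> \<bar>z $ i\<bar> \<le> c' i"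
    by metis
  define c where "c = Max (range c')"
  have c: "c < 1" "\<And>i. c' i \<le> c"
    using c' by (auto simp: c_def)
  have c0: "0 \<le> c" using c(2) c'(1) order.trans by blast
  define e where "e = (1 - c) / 2"
  define l0 where "l0 = ((1 + c) / 2) powr (1 / real (sc_dim s))"
  have dim: "sc_dim s > 0"
    using s by (auto simp: sc_dim_def sum_pos)
  have l0: "0 < l0" "l0 < 1"
    using c c0 dim powr_less_mono2[of "1 / real (sc_dim s)" "(1 + c) / 2" 1] by (auto simp: l0_def)
  have l0_pow: "l0 ^ sc_dim s = (1 + c) / 2"
    using l0(1) dim c0 by (simp add: powr_realpow[symmetric] l0_def powr_powr)
  have "\<exists>\<eta>\<in>test_ball s k. rescale s x l \<eta> = \<psi>" if l: "l0 < l" "l < 1" and x: "\<And>i. \<bar>x $ i\<bar> < e" for l x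
  proof -
    have l_pos: "l > 0" using l l0 by simp
    have pow: "(1 + c) / 2 < l ^ s i" for i
    proof -
      have "l0 ^ sc_dim s < l ^ sc_dim s"
        using l l0 dim by (intro power_strict_mono) auto
      also have "\<dots> \<le> l ^ s i"
        using l l_pos by (intro power_decreasing) (auto simp: sc_dim_def intro: member_le_sum)
      finally show ?thesis by (simp add: l0_pow)
    qed
    define A where "A y = x + (\<chi> i. l ^ s i * y $ i)" for y
    define \<eta> where "\<eta> y = l ^ sc_dim s * \<psi> (A y)" for y
    have C\<eta>: "C_fun k \<eta>"
      unfolding \<eta>_def A_def by (intro C_fun_mult C_fun_const C_fun_dilation C)
    have in_ball: "\<bar>y $ i\<bar> < 1" if "A y \<in> fsupport \<psi>" for y i
    proof -
      have "\<bar>x $ i + l ^ s i * y $ i\<bar> \<le> c"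
        using c'(3)[OF that, of i] c(2)[of i] by (simp add: A_def)
      then have "\<bar>l ^ s i * y $ i\<bar> < (1 + c) / 2"
        using x[of i] by (simp add: e_def abs_if split: if_splits)
      then have "\<bar>l ^ s i * y $ i\<bar> < l ^ s i"
        using pow[of i] by linarith
      then show ?thesis using l_pos by (simp add: abs_mult)
    qed
    have supp: "fsupport \<eta> \<subseteq> {y. A y \<in> fsupport \<psi>}"
      unfolding fsupport_def[of \<eta>]
    proof (rule closure_minimal)
      show "{y. \<eta> y \<noteq> 0} \<subseteq> {y. A y \<in> fsupport \<psi>}"
        by (auto simp: \<eta>_def fsupport_ge)
      have "closed (A -` fsupport \<psi>)"
        unfolding A_def by (intro closed_vimage compact_imp_closed[OF cs] continuous_intros)
      then show "closed {y. A y \<in> fsupport \<psi>}" by (simp add: vimage_def)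
    qed
    have "fsupport \<eta> \<subseteq> cube 1"
      using supp in_ball by (fastforce simp: mem_cube less_imp_le)
    then have cs\<eta>: "compact (fsupport \<eta>)"
      using compact_cube compact_fsupport_subset by blast
    have "C_norm k \<eta> \<le> 1"
    proof (rule C_norm_le)
      fix "is" :: "'d list" and y assume len: "length is \<le> k"
      have "0 \<le> (\<Prod>i\<leftarrow>is. l ^ s i) \<and> (\<Prod>i\<leftarrow>is. l ^ s i) \<le> 1"
        using l l_pos by (induction "is") (auto intro!: mult_le_one power_le_one)
      then have "0 \<le> l ^ sc_dim s * (\<Prod>i\<leftarrow>is. l ^ s i) \<and> l ^ sc_dim s * (\<Prod>i\<leftarrow>is. l ^ s i) \<le> 1"
        using l l_pos by (auto intro!: mult_le_one power_le_one)
      then have "\<bar>l ^ sc_dim s * (\<Prod>i\<leftarrow>is. l ^ s i) * iter_deriv is \<psi> (A y)\<bar> \<le> 1 * C_norm k \<psi>"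
        unfolding abs_mult[of "l ^ sc_dim s * (\<Prod>i\<leftarrow>is. l ^ s i)"]
        by (intro mult_mono abs_iter_deriv_le_C_norm[OF C cs len]) auto
      then show "\<bar>iter_deriv is \<eta> y\<bar> \<le> 1"
        using n1 by (simp add: \<eta>_def[abs_def] A_def iter_deriv_dilation[OF C len])
    qed
    then have "\<eta> \<in> test_ball s k"
      unfolding test_ball_def sc_ball_0_1[OF s] using C\<eta> cs\<eta> supp in_ball by blast
    moreover have "rescale s x l \<eta> y = \<psi> y" for y
    proof -
      have "A (\<chi> i. (y $ i - x $ i) / l ^ s i) = y"
        using l_pos by (simp add: A_def vec_eq_iff)
      then show ?thesis using l_pos by (simp add: rescale_def \<eta>_def)
    qed
    ultimately show ?thesis by blast
  qed
  moreover have "e > 0" using c by (simp add: e_def)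
  ultimately show ?thesis using l0 by blast
qed

text \<open>
  Restrict both integrals in the Besov norm to a neighbourhood of \<open>(0, 1)\<close> on which \<open>\<psi>\<close> is one
  of the rescaled test functions in the supremum. The integrand is there at least a
  multiple of \<open>\<bar>\<langle>\<xi>, \<psi>\<rangle>\<bar>\<close> that does not depend on \<open>\<xi>\<close>.
\<close>

lemma pairing_le_besov_norm:
  fixes \<psi> :: "real^'d::finite \<Rightarrow> real"
  assumes s: "\<forall>i. s i > 0" and \<psi>: "\<psi> \<in> test_ball s k" and "p > 0" "q > 0" "a < 0"
  shows "\<exists>c>0. \<forall>\<xi>. ennreal (c * \<bar>pairing k \<xi> \<psi>\<bar>) \<le> besov_norm s k a p q \<xi>"
proof -
  obtain l0 e where l0: "0 < l0" "l0 < 1" and e: "0 < e"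
    and resc: "\<And>l x. l0 < l \<Longrightarrow> l < 1 \<Longrightarrow> (\<And>i. \<bar>x $ i\<bar> < e) \<Longrightarrow>
      \<exists>\<eta>\<in>test_ball s k. rescale s x l \<eta> = \<psi>"
    using test_ball_rescale[OF s \<psi>] by metis
  define U :: "(real^'d) set" where "U = box (\<chi> i. - e) (\<chi> i. e)"
  have U: "x \<in> U \<longleftrightarrow> (\<forall>i. \<bar>x $ i\<bar> < e)" for x
    by (auto simp: U_def mem_box_cart abs_less_iff minus_less_iff)
  define m where "m = measure lborel U"
  have m: "emeasure lborel U = ennreal m" "m > 0"
  proof -
    have fin: "emeasure lborel U \<noteq> \<infinity>"
      unfolding U_def by (simp add: emeasure_lborel_box_eq)
    then show *: "emeasure lborel U = ennreal m"
      by (simp add: m_def emeasure_eq_ennreal_measure)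
    have "box (\<chi> i. - e) (\<chi> i. e) \<noteq> ({} :: (real^'d) set)"
      using e by (auto simp: interval_ne_empty_cart)
    then have "\<not> negligible U"
      unfolding U_def by (intro open_not_negligible) auto
    then have "emeasure lborel U \<noteq> 0"
      using null_sets_completionI[of U lborel] by (auto simp: negligible_iff_null_sets U_def)
    then show "m > 0" using * by (auto simp: m_def zero_less_measure_iff)
  qed
  define \<kappa> where "\<kappa> = l0 powr (- a)"
  have scale: "ennreal (1 - l0) \<le> emeasure scale_measure_log {l0<..<1}"
  proof -
    have "ennreal (1 - l0) = emeasure lborel {l0<..<1}" using l0 by simp
    also have "\<dots> = (\<integral>\<^sup>+l. indicator {l0<..<1} l \<partial>lborel)" by simp
    also have "\<dots> \<le> (\<integral>\<^sup>+l. ennreal (indicator {0<..<1} l / l) * indicator {l0<..<1} l \<partial>lborel)"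
      using l0 by (intro nn_integral_mono) (auto simp: indicator_def)
    also have "\<dots> = emeasure scale_measure_log {l0<..<1}"
      unfolding scale_measure_log_def by (subst emeasure_density) auto
    finally show ?thesis .
  qed
  let ?c = "\<kappa> * m powr (1 / p) * (1 - l0) powr (1 / q)"
  have "ennreal (?c * \<bar>pairing k \<xi> \<psi>\<bar>) \<le> besov_norm s k a p q \<xi>" for \<xi>
  proof -
    let ?v = "\<bar>pairing k \<xi> \<psi>\<bar>"
    let ?S = "\<lambda>l x. SUP \<eta>\<in>test_ball s k. ennreal (\<bar>pairing k \<xi> (rescale s x l \<eta>)\<bar> / l powr a)"
    have S: "ennreal (?v * \<kappa>) \<le> ?S l x" if "l \<in> {l0<..<1}" "x \<in> U" for l x
    proof -
      obtain \<eta> where \<eta>: "\<eta> \<in> test_ball s k" "rescale s x l \<eta> = \<psi>"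
        using resc[of l x] \<open>l \<in> {l0<..<1}\<close> \<open>x \<in> U\<close> by (auto simp: U)
      have "\<kappa> \<le> l powr (- a)"
        unfolding \<kappa>_def using that l0 \<open>a < 0\<close> by (intro powr_mono2) auto
      then have "?v * \<kappa> \<le> ?v / l powr a"
        by (simp add: powr_minus_divide mult_left_mono divide_inverse powr_minus)
      then have "ennreal (?v * \<kappa>) \<le> ennreal (\<bar>pairing k \<xi> (rescale s x l \<eta>)\<bar> / l powr a)"
        unfolding \<eta>(2) by (rule ennreal_leI)
      also have "\<dots> \<le> ?S l x" by (rule SUP_upper[OF \<eta>(1)])
      finally show ?thesis .
    qed
    have "ennreal (?v * \<kappa> * m powr (1 / p)) \<le> Lp_norm lborel p (?S l)" if "l \<in> {l0<..<1}" for l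
    proof (rule Lp_norm_ge[where A = U])
      show "U \<in> sets lborel" by (simp add: U_def)
      show "ennreal (?v * \<kappa>) \<le> ?S l x" if "x \<in> U" for x using S \<open>l \<in> {l0<..<1}\<close> that by blast
    qed (use m \<open>p > 0\<close> in \<open>auto simp: \<kappa>_def\<close>)
    then have "ennreal (?v * \<kappa> * m powr (1 / p) * (1 - l0) powr (1 / q)) \<le>
        Lp_norm scale_measure_log q (\<lambda>l. Lp_norm lborel p (?S l))"
      using scale l0 m \<open>q > 0\<close> by (intro Lp_norm_ge[where A = "{l0<..<1}"])
        (auto simp: scale_measure_log_def \<kappa>_def)
    then show ?thesis
      by (simp add: besov_norm_def local_norm_def mult_ac)
  qed
  moreover have "?c > 0" using l0 m by (simp add: \<kappa>_def)
  ultimately show ?thesis by blast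
qed

section \<open>Components in a regularity structure\<close>

locale reg_structure =
  fixes R :: "'v::real_vector reg_struct"
  assumes R: "regularity_structure R"
begin

lemma norm_on_sector: "\<alpha> \<in> idx R \<Longrightarrow> norm_on (sector R \<alpha>) (cnorm R \<alpha>)"
  using R by (auto simp: regularity_structure_def banach_on_def)

lemma subspace_sector: "\<alpha> \<in> idx R \<Longrightarrow> subspace (sector R \<alpha>)"
  using norm_on_sector by (auto simp: norm_on_def)

lemma decomposes_unique: "\<exists>!c. decomposes (idx R) (sector R) \<tau> c"
  using R by (auto simp: regularity_structure_def)

lemma decomposes_component: "decomposes (idx R) (sector R) \<tau> (\<lambda>\<alpha>. component R \<alpha> \<tau>)"
  unfolding component_def by (rule theI'[OF decomposes_unique])

lemma component_eqI: "decomposes (idx R) (sector R) \<tau> c \<Longrightarrow> component R \<alpha> \<tau> = c \<alpha>"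
  using decomposes_unique[of \<tau>] decomposes_component[of \<tau>] by metis

lemma component_in_sector: "\<alpha> \<in> idx R \<Longrightarrow> component R \<alpha> \<tau> \<in> sector R \<alpha>"
  and component_outside: "\<alpha> \<notin> idx R \<Longrightarrow> component R \<alpha> \<tau> = 0"
  and finite_components: "finite {\<alpha>. component R \<alpha> \<tau> \<noteq> 0}"
  and sum_components: "(\<Sum>\<alpha> | component R \<alpha> \<tau> \<noteq> 0. component R \<alpha> \<tau>) = \<tau>"
  using decomposes_component[of \<tau>] by (auto simp: decomposes_def)

lemma linear_component: "linear (component R \<alpha>)"
proof -
  have comb: "component R \<alpha> (a *\<^sub>R \<sigma> + b *\<^sub>R \<tau>) = a *\<^sub>R component R \<alpha> \<sigma> + b *\<^sub>R component R \<alpha> \<tau>" for a b \<sigma> \<tau>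
  proof (rule component_eqI)
    let ?c = "\<lambda>\<alpha>. a *\<^sub>R component R \<alpha> \<sigma> + b *\<^sub>R component R \<alpha> \<tau>"
    let ?S = "{\<alpha>. component R \<alpha> \<sigma> \<noteq> 0} \<union> {\<alpha>. component R \<alpha> \<tau> \<noteq> 0}"
    have S: "finite ?S" using finite_components by simp
    have sub: "{\<alpha>. ?c \<alpha> \<noteq> 0} \<subseteq> ?S" by auto
    have "(\<Sum>\<alpha>\<in>?S. component R \<alpha> \<rho>) = \<rho>" if "\<rho> = \<sigma> \<or> \<rho> = \<tau>" for \<rho>
    proof -
      have "(\<Sum>\<alpha>\<in>?S. component R \<alpha> \<rho>) = (\<Sum>\<alpha> | component R \<alpha> \<rho> \<noteq> 0. component R \<alpha> \<rho>)"
        using that by (intro sum.mono_neutral_right S) auto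
      then show ?thesis by (simp add: sum_components)
    qed
    then have "a *\<^sub>R \<sigma> + b *\<^sub>R \<tau> = (\<Sum>\<alpha>\<in>?S. ?c \<alpha>)"
      by (simp add: sum.distrib scaleR_sum_right[symmetric])
    also have "\<dots> = (\<Sum>\<alpha> | ?c \<alpha> \<noteq> 0. ?c \<alpha>)"
      by (intro sum.mono_neutral_right S) auto
    finally show "decomposes (idx R) (sector R) (a *\<^sub>R \<sigma> + b *\<^sub>R \<tau>) ?c"
      unfolding decomposes_def using finite_subset[OF sub S]
      by (auto simp: component_outside intro!: subspace_add subspace_scale subspace_sector component_in_sector)
  qed
  show ?thesis
    using comb[of 1 _ 1] comb[of _ _ 0] by (intro linearI) auto
qed

lemma component_of_sector:
  assumes "\<alpha> \<in> idx R" "\<tau> \<in> sector R \<alpha>"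
  shows "component R \<beta> \<tau> = (if \<beta> = \<alpha> then \<tau> else 0)"
proof (rule component_eqI)
  have "(\<Sum>\<beta> | (if \<beta> = \<alpha> then \<tau> else 0) \<noteq> 0. if \<beta> = \<alpha> then \<tau> else 0) = (\<Sum>\<beta>\<in>{\<alpha>}. if \<beta> = \<alpha> then \<tau> else 0)"
    by (intro sum.mono_neutral_left) auto
  moreover have "finite {\<beta>. (if \<beta> = \<alpha> then \<tau> else 0) \<noteq> 0}"
    by (rule finite_subset[of _ "{\<alpha>}"]) auto
  ultimately show "decomposes (idx R) (sector R) \<tau> (\<lambda>\<beta>. if \<beta> = \<alpha> then \<tau> else 0)"
    unfolding decomposes_def using assms by (auto intro!: subspace_0 subspace_sector)
qed

lemma finite_idx_below: "finite (idx_below R \<gamma>)"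
proof -
  obtain b where "\<And>\<alpha>. \<alpha> \<in> idx R \<Longrightarrow> b \<le> \<alpha>"
    using R by (auto simp: regularity_structure_def bdd_below_def)
  then have "idx_below R \<gamma> \<subseteq> idx R \<inter> {b..\<gamma>}"
    by (auto simp: idx_below_def)
  moreover have "finite (idx R \<inter> {b..\<gamma>})"
    using R by (auto simp: regularity_structure_def)
  ultimately show ?thesis by (rule finite_subset)
qed

lemma space_below_sum:
  assumes "\<tau> \<in> space_below R \<gamma>"
  shows "(\<Sum>\<alpha>\<in>idx_below R \<gamma>. component R \<alpha> \<tau>) = \<tau>"
proof -
  have "(\<Sum>\<alpha>\<in>idx_below R \<gamma>. component R \<alpha> \<tau>) = (\<Sum>\<alpha> | component R \<alpha> \<tau> \<noteq> 0. component R \<alpha> \<tau>)"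
    using assms component_outside
    by (intro sum.mono_neutral_right finite_idx_below) (auto simp: idx_below_def space_below_def not_less[symmetric])
  then show ?thesis by (simp add: sum_components)
qed

lemma subspace_space_below: "subspace (space_below R \<gamma>)"
  by (rule subspaceI)
    (auto simp: space_below_def linear_0[OF linear_component] linear_add[OF linear_component] linear_cmul[OF linear_component])

lemma space_below_exists: "\<exists>\<gamma>. \<tau> \<in> space_below R \<gamma>"
proof -
  obtain B where "\<And>\<alpha>. component R \<alpha> \<tau> \<noteq> 0 \<Longrightarrow> \<alpha> \<le> B"
    using bdd_above_finite[OF finite_components] by (auto simp: bdd_above_def)
  then show ?thesis
    by (intro exI[of _ "B + 1"]) (fastforce simp: space_below_def)
qed

lemma hnorm_nonneg: "\<alpha> \<in> idx R \<Longrightarrow> 0 \<le> hnorm R \<alpha> \<tau>"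
  using norm_on_sector component_in_sector by (auto simp: norm_on_def hnorm_def)

lemma hnorm_0: "\<alpha> \<in> idx R \<Longrightarrow> hnorm R \<alpha> 0 = 0"
  using norm_on_sector[of \<alpha>] subspace_0[OF subspace_sector, of \<alpha>]
  by (simp add: norm_on_def hnorm_def linear_0[OF linear_component])

lemma hnorm_scaleR: "\<alpha> \<in> idx R \<Longrightarrow> hnorm R \<alpha> (c *\<^sub>R \<tau>) = \<bar>c\<bar> * hnorm R \<alpha> \<tau>"
  using norm_on_sector component_in_sector
  by (auto simp: norm_on_def hnorm_def linear_cmul[OF linear_component])

lemma hnorm_add: "\<alpha> \<in> idx R \<Longrightarrow> hnorm R \<alpha> (\<sigma> + \<tau>) \<le> hnorm R \<alpha> \<sigma> + hnorm R \<alpha> \<tau>"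
  using norm_on_sector component_in_sector
  by (auto simp: norm_on_def hnorm_def linear_add[OF linear_component])

lemma hnorm_minus_commute: "\<alpha> \<in> idx R \<Longrightarrow> hnorm R \<alpha> (\<sigma> - \<tau>) = hnorm R \<alpha> (\<tau> - \<sigma>)"
  using hnorm_scaleR[of \<alpha> "-1" "\<sigma> - \<tau>"] by simp

lemma hnorm_diff_abs: "\<alpha> \<in> idx R \<Longrightarrow> \<bar>hnorm R \<alpha> \<sigma> - hnorm R \<alpha> \<tau>\<bar> \<le> hnorm R \<alpha> (\<sigma> - \<tau>)"
  using hnorm_add[of \<alpha> "\<sigma> - \<tau>" \<tau>] hnorm_add[of \<alpha> "\<tau> - \<sigma>" \<sigma>] hnorm_minus_commute[of \<alpha> \<sigma> \<tau>] by simp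

lemma hnorm_sum:
  assumes "\<alpha> \<in> idx R" "finite S"
  shows "hnorm R \<alpha> (\<Sum>i\<in>S. f i) \<le> (\<Sum>i\<in>S. hnorm R \<alpha> (f i))"
  using assms(2)
proof (induction S rule: finite_induct)
  case (insert i S)
  then show ?case using hnorm_add[OF assms(1), of "f i" "\<Sum>i\<in>S. f i"] by simp
qed (simp add: hnorm_0 assms(1))

end

section \<open>Strong continuity of \<open>\<Gamma>\<close>\<close>

locale reg_model = reg_structure R for R :: "'v::real_vector reg_struct" +
  fixes s :: "'d::finite \<Rightarrow> nat" and r :: nat
    and Pmod :: "real^'d \<Rightarrow> 'v \<Rightarrow> 'd distr" and \<Gamma> :: "real^'d \<Rightarrow> real^'d \<Rightarrow> 'v \<Rightarrow> 'v"
  assumes s: "\<forall>i. s i > 0" and mod: "model s r R Pmod \<Gamma>"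
begin

lemma linear_\<Gamma>: "linear (\<Gamma> x y)"
  using R mod by (auto simp: regularity_structure_def model_def)

lemma \<Gamma>_comp: "\<Gamma> x y (\<Gamma> y z \<tau>) = \<Gamma> x z \<tau>"
proof -
  have "\<Gamma> x y \<circ> \<Gamma> y z = \<Gamma> x z" using mod by (auto simp: model_def)
  then show ?thesis by (metis comp_apply)
qed

lemma component_\<Gamma>_ge:
  assumes "\<alpha> \<in> idx R" "\<tau> \<in> sector R \<alpha>" "\<alpha> \<le> \<beta>"
  shows "component R \<beta> (\<Gamma> x y \<tau> - \<tau>) = 0"
proof (cases "\<beta> \<in> idx R")
  case True
  have "\<Gamma> x y \<tau> - \<tau> \<in> space_below R \<alpha>"
    using R mod assms by (auto simp: regularity_structure_def model_def)
  then show ?thesis using True assms(3) by (simp add: space_below_def)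
qed (simp add: component_outside)

lemma \<Gamma>_bound:
  "\<exists>C>0. \<forall>\<alpha>\<in>idx R. \<alpha> \<le> \<gamma> \<longrightarrow> (\<forall>\<tau>\<in>sector R \<alpha>. \<forall>x y. \<forall>\<beta>\<in>idx R. \<beta> \<le> \<alpha> \<longrightarrow>
    hnorm R \<beta> (\<Gamma> x y \<tau>) \<le> C * pow0 (sc_norm s (x - y)) (\<alpha> - \<beta>) * cnorm R \<alpha> \<tau>)"
proof -
  have "max 1 \<gamma> > 0" by simp
  then obtain C where "C > 0" "\<And>\<alpha> \<tau> x y \<beta>. \<alpha> \<in> idx R \<Longrightarrow> \<alpha> \<le> max 1 \<gamma> \<Longrightarrow> \<tau> \<in> sector R \<alpha> \<Longrightarrow> \<beta> \<in> idx R \<Longrightarrow>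
      \<beta> \<le> \<alpha> \<Longrightarrow> hnorm R \<beta> (\<Gamma> x y \<tau>) \<le> C * pow0 (sc_norm s (x - y)) (\<alpha> - \<beta>) * cnorm R \<alpha> \<tau>"
    using mod unfolding model_def by meson
  then show ?thesis by (intro exI[of _ C]) auto
qed

lemma space_below_\<Gamma>:
  assumes "\<tau> \<in> space_below R \<gamma>"
  shows "\<Gamma> x y \<tau> \<in> space_below R \<gamma>"
  unfolding space_below_def
proof (intro CollectI ballI impI)
  fix \<beta> assume \<beta>: "\<beta> \<in> idx R" "\<beta> \<ge> \<gamma>"
  have "component R \<beta> (\<Gamma> x y (component R \<alpha> \<tau>)) = 0" if \<alpha>: "\<alpha> \<in> idx_below R \<gamma>" for \<alpha>
  proof -
    have "\<alpha> \<in> idx R" "\<alpha> < \<beta>" using \<alpha> \<beta> by (auto simp: idx_below_def)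
    then show ?thesis
      using component_\<Gamma>_ge[of \<alpha> "component R \<alpha> \<tau>" \<beta> x y] component_of_sector[of \<alpha> "component R \<alpha> \<tau>" \<beta>] component_in_sector
      by (simp add: linear_diff[OF linear_component])
  qed
  moreover have "component R \<beta> (\<Gamma> x y \<tau>) = (\<Sum>\<alpha>\<in>idx_below R \<gamma>. component R \<beta> (\<Gamma> x y (component R \<alpha> \<tau>)))"
    by (subst space_below_sum[OF assms, symmetric])
      (simp only: linear_sum[OF linear_\<Gamma>] linear_sum[OF linear_component])
  ultimately show "component R \<beta> (\<Gamma> x y \<tau>) = 0" by simp
qed

lemma sc_norm_nonneg: "0 \<le> sc_norm s x"
  unfolding sc_norm_def by (subst Max_ge_iff) auto

lemma continuous_sc_norm: "continuous_on UNIV (sc_norm s)"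
proof -
  have fin: "continuous_on UNIV (\<lambda>x. Max ((\<lambda>i. \<bar>x $ i\<bar> powr (1 / real (s i))) ` I))"
    if "finite I" "I \<noteq> {}" for I :: "'d set"
    using that
  proof (induction I rule: finite_ne_induct)
    case (singleton i)
    then show ?case using s by (auto intro!: continuous_intros continuous_on_powr')
  next
    case (insert i I)
    have "continuous_on UNIV (\<lambda>x::real^'d. \<bar>x $ i\<bar> powr (1 / real (s i)))"
      using s by (auto intro!: continuous_intros continuous_on_powr')
    then show ?case using insert by (auto intro!: continuous_on_max)
  qed
  show ?thesis unfolding sc_norm_def[abs_def] using fin[of UNIV] by simp
qed

lemma sc_norm_0: "sc_norm s 0 = 0"
  by (simp add: sc_norm_def)

text \<open>
  On \<open>T\<^sub>\<alpha>\<close> the operator \<open>\<Gamma>\<^sub>x\<^sub>,\<^sub>y\<close> differs from the identity only by components of degree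
  \<open>\<beta> < \<alpha>\<close>, and these are of order \<open>\<parallel>x - y\<parallel>\<^sup>\<alpha>\<^sup>-\<^sup>\<beta>\<close>.
\<close>

lemma \<Gamma>_tendsto_id:
  assumes \<beta>: "\<beta> \<in> idx R" and lim: "((\<lambda>z. sc_norm s (X z - Y z)) \<longlongrightarrow> 0) F"
  shows "((\<lambda>z. hnorm R \<beta> (\<Gamma> (X z) (Y z) \<tau> - \<tau>)) \<longlongrightarrow> 0) F"
proof -
  have sector: "((\<lambda>z. hnorm R \<beta> (\<Gamma> (X z) (Y z) \<tau> - \<tau>)) \<longlongrightarrow> 0) F"
    if \<alpha>: "\<alpha> \<in> idx R" and \<tau>: "\<tau> \<in> sector R \<alpha>" for \<alpha> \<tau>
  proof (cases "\<beta> < \<alpha>")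
    case True
    obtain C where C: "\<And>x y. hnorm R \<beta> (\<Gamma> x y \<tau>) \<le> C * pow0 (sc_norm s (x - y)) (\<alpha> - \<beta>) * cnorm R \<alpha> \<tau>"
      using \<Gamma>_bound[of \<alpha>] \<alpha> \<tau> \<beta> True by (meson less_imp_le order.refl)
    have eq: "hnorm R \<beta> (\<Gamma> x y \<tau> - \<tau>) = hnorm R \<beta> (\<Gamma> x y \<tau>)" for x y
      using component_of_sector[OF \<alpha> \<tau>, of \<beta>] True by (simp add: hnorm_def linear_diff[OF linear_component])
    show ?thesis
    proof (rule tendsto_sandwich[OF _ _ tendsto_const])
      show "\<forall>\<^sub>F z in F. hnorm R \<beta> (\<Gamma> (X z) (Y z) \<tau> - \<tau>) \<le> C * sc_norm s (X z - Y z) powr (\<alpha> - \<beta>) * cnorm R \<alpha> \<tau>"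
        using C True by (simp add: eq pow0_def)
      have "((\<lambda>z. C * sc_norm s (X z - Y z) powr (\<alpha> - \<beta>) * cnorm R \<alpha> \<tau>) \<longlongrightarrow> C * 0 * cnorm R \<alpha> \<tau>) F"
        using True by (intro tendsto_mult tendsto_const tendsto_zero_powrI[OF lim]) (auto simp: sc_norm_nonneg)
      then show "((\<lambda>z. C * sc_norm s (X z - Y z) powr (\<alpha> - \<beta>) * cnorm R \<alpha> \<tau>) \<longlongrightarrow> 0) F" by simp
    qed (simp add: hnorm_nonneg \<beta>)
  next
    case False
    then show ?thesis
      using component_\<Gamma>_ge[OF \<alpha> \<tau>] hnorm_0[OF \<beta>] by (simp add: hnorm_def linear_0[OF linear_component])
  qed
  obtain \<gamma> where \<gamma>: "\<tau> \<in> space_below R \<gamma>" using space_below_exists by blast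
  let ?g = "\<lambda>z. \<Sum>\<alpha>\<in>idx_below R \<gamma>. hnorm R \<beta> (\<Gamma> (X z) (Y z) (component R \<alpha> \<tau>) - component R \<alpha> \<tau>)"
  show ?thesis
  proof (rule tendsto_sandwich[OF _ _ tendsto_const])
    have "\<Gamma> x y \<tau> - \<tau> = (\<Sum>\<alpha>\<in>idx_below R \<gamma>. \<Gamma> x y (component R \<alpha> \<tau>) - component R \<alpha> \<tau>)" for x y
      using space_below_sum[OF \<gamma>] linear_sum[OF linear_\<Gamma>, of x y "\<lambda>\<alpha>. component R \<alpha> \<tau>" "idx_below R \<gamma>"]
      by (simp add: sum_subtractf)
    then show "\<forall>\<^sub>F z in F. hnorm R \<beta> (\<Gamma> (X z) (Y z) \<tau> - \<tau>) \<le> ?g z"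
      by (simp add: hnorm_sum[OF \<beta> finite_idx_below])
    have "(?g \<longlongrightarrow> (\<Sum>\<alpha>\<in>idx_below R \<gamma>. 0)) F"
      by (intro tendsto_sum sector) (auto simp: idx_below_def component_in_sector)
    then show "(?g \<longlongrightarrow> 0) F" by simp
  qed (simp add: hnorm_nonneg \<beta>)
qed

lemma \<Gamma>_locally_bounded:
  assumes \<beta>: "\<beta> \<in> idx R" and \<rho>: "0 \<le> \<rho>"
  shows "\<exists>C\<ge>0. \<forall>x y. \<forall>\<tau>\<in>space_below R \<gamma>. sc_norm s (x - y) \<le> \<rho> \<longrightarrow>
    hnorm R \<beta> (\<Gamma> x y \<tau>) \<le> C * (\<Sum>\<alpha>\<in>idx_below R \<gamma>. hnorm R \<alpha> \<tau>)"
proof -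
  obtain C where C: "C > 0" "\<And>\<alpha> \<tau> x y. \<alpha> \<in> idx R \<Longrightarrow> \<alpha> \<le> \<gamma> \<Longrightarrow> \<tau> \<in> sector R \<alpha> \<Longrightarrow> \<beta> \<le> \<alpha> \<Longrightarrow>
      hnorm R \<beta> (\<Gamma> x y \<tau>) \<le> C * pow0 (sc_norm s (x - y)) (\<alpha> - \<beta>) * cnorm R \<alpha> \<tau>"
    using \<Gamma>_bound[of \<gamma>] \<beta> by meson
  define B where "B = (1 + \<rho>) powr (\<bar>\<gamma>\<bar> + \<bar>\<beta>\<bar>)"
  have bound: "hnorm R \<beta> (\<Gamma> x y (component R \<alpha> \<tau>)) \<le> C * B * hnorm R \<alpha> \<tau>"
    if \<alpha>: "\<alpha> \<in> idx_below R \<gamma>" and xy: "sc_norm s (x - y) \<le> \<rho>" for x y \<alpha> \<tau>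
  proof (cases "\<beta> \<le> \<alpha>")
    case True
    have \<alpha>': "\<alpha> \<in> idx R" "\<alpha> \<le> \<gamma>" using \<alpha> by (auto simp: idx_below_def)
    have "pow0 (sc_norm s (x - y)) (\<alpha> - \<beta>) \<le> (1 + \<rho>) powr (\<alpha> - \<beta>)"
      using True xy sc_norm_nonneg[of "x - y"] \<rho> by (auto simp: pow0_def intro!: powr_mono2)
    also have "\<dots> \<le> B"
      unfolding B_def using \<rho> \<alpha>' by (intro powr_mono) auto
    finally have "C * pow0 (sc_norm s (x - y)) (\<alpha> - \<beta>) * cnorm R \<alpha> (component R \<alpha> \<tau>) \<le> C * B * hnorm R \<alpha> \<tau>"
      unfolding hnorm_def[symmetric] using C(1) hnorm_nonneg[OF \<alpha>'(1)]
      by (intro mult_right_mono mult_left_mono) auto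
    then show ?thesis
      using C(2)[OF \<alpha>' component_in_sector[OF \<alpha>'(1)] True] order.trans by blast
  next
    case False
    then have \<alpha>': "\<alpha> \<in> idx R" "\<alpha> < \<beta>" using \<alpha> by (auto simp: idx_below_def)
    have "component R \<beta> (\<Gamma> x y (component R \<alpha> \<tau>)) = 0"
      using component_\<Gamma>_ge[OF \<alpha>'(1) component_in_sector[OF \<alpha>'(1)], of \<beta> x y \<tau>] \<alpha>'
        component_of_sector[OF \<alpha>'(1) component_in_sector[OF \<alpha>'(1)], of \<beta> \<tau>]
      by (simp add: linear_diff[OF linear_component])
    then have "hnorm R \<beta> (\<Gamma> x y (component R \<alpha> \<tau>)) = 0"
      using hnorm_0[OF \<beta>] by (simp add: hnorm_def linear_0[OF linear_component])
    then show ?thesis using C(1) hnorm_nonneg[OF \<alpha>'(1)] by (simp add: B_def)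
  qed
  have "hnorm R \<beta> (\<Gamma> x y \<tau>) \<le> C * B * (\<Sum>\<alpha>\<in>idx_below R \<gamma>. hnorm R \<alpha> \<tau>)"
    if "\<tau> \<in> space_below R \<gamma>" "sc_norm s (x - y) \<le> \<rho>" for x y \<tau>
  proof -
    have "hnorm R \<beta> (\<Gamma> x y \<tau>) = hnorm R \<beta> (\<Sum>\<alpha>\<in>idx_below R \<gamma>. \<Gamma> x y (component R \<alpha> \<tau>))"
      by (subst space_below_sum[OF that(1), symmetric]) (simp only: linear_sum[OF linear_\<Gamma>])
    also have "\<dots> \<le> (\<Sum>\<alpha>\<in>idx_below R \<gamma>. hnorm R \<beta> (\<Gamma> x y (component R \<alpha> \<tau>)))"
      by (rule hnorm_sum[OF \<beta> finite_idx_below])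
    also have "\<dots> \<le> C * B * (\<Sum>\<alpha>\<in>idx_below R \<gamma>. hnorm R \<alpha> \<tau>)"
      unfolding sum_distrib_left using bound that by (intro sum_mono) auto
    finally show ?thesis .
  qed
  then show ?thesis
    using C(1) by (intro exI[of _ "C * B"]) (auto simp: B_def)
qed

text \<open>
  Joint continuity in the base point \<open>x\<close> and the increment \<open>h\<close>, written on pairs \<open>(h, x)\<close> as it
  is needed for measurability.
\<close>

lemma continuous_\<Gamma>:
  assumes \<beta>: "\<beta> \<in> idx R"
  shows "continuous_on UNIV (\<lambda>z. hnorm R \<beta> (\<sigma> - \<Gamma> (snd z + fst z) (snd z) \<tau>))"
  unfolding continuous_on_def
proof
  fix z0 :: "(real^'d) \<times> (real^'d)"
  define x0 y0 where "x0 = snd z0" and "y0 = snd z0 + fst z0"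
  let ?y = "\<lambda>z::(real^'d) \<times> (real^'d). snd z + fst z"
  let ?F = "at z0 within UNIV"
  have lim: "((\<lambda>z. sc_norm s (g z)) \<longlongrightarrow> sc_norm s l) ?F" if "(g \<longlongrightarrow> l) ?F" for g l
    using continuous_on_tendsto_compose[OF continuous_sc_norm that] by simp
  have tx: "(snd \<longlongrightarrow> x0) ?F" and ty: "(?y \<longlongrightarrow> y0) ?F"
    unfolding x0_def y0_def by (auto intro!: tendsto_intros)
  obtain \<gamma> where \<gamma>: "\<tau> \<in> space_below R \<gamma>" using space_below_exists by blast
  define \<rho> where "\<rho> = sc_norm s (y0 - x0) + 1"
  have "((\<lambda>z. sc_norm s (?y z - x0)) \<longlongrightarrow> sc_norm s (y0 - x0)) ?F"
    by (intro lim tendsto_diff ty tendsto_const)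
  then have ev: "\<forall>\<^sub>F z in ?F. sc_norm s (?y z - x0) < \<rho>"
    by (rule order_tendstoD) (simp add: \<rho>_def)
  obtain C where C: "\<And>x y \<tau>. \<tau> \<in> space_below R \<gamma> \<Longrightarrow> sc_norm s (x - y) \<le> \<rho> \<Longrightarrow>
      hnorm R \<beta> (\<Gamma> x y \<tau>) \<le> C * (\<Sum>\<alpha>\<in>idx_below R \<gamma>. hnorm R \<alpha> \<tau>)"
    using \<Gamma>_locally_bounded[OF \<beta>, of \<rho> \<gamma>] sc_norm_nonneg[of "y0 - x0"] unfolding \<rho>_def
    by (meson add_nonneg_nonneg zero_le_one)
  let ?G = "\<lambda>z. hnorm R \<beta> (\<Gamma> (?y z) (snd z) \<tau> - \<Gamma> y0 x0 \<tau>)"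
  let ?S = "\<lambda>z. C * (\<Sum>\<alpha>\<in>idx_below R \<gamma>. hnorm R \<alpha> (\<Gamma> x0 (snd z) \<tau> - \<tau>))
      + hnorm R \<beta> (\<Gamma> (?y z) y0 (\<Gamma> y0 x0 \<tau>) - \<Gamma> y0 x0 \<tau>)"
  have "(?G \<longlongrightarrow> 0) ?F"
  proof (rule tendsto_sandwich[OF _ _ tendsto_const])
    show "\<forall>\<^sub>F z in ?F. ?G z \<le> ?S z"
      using ev
    proof eventually_elim
      case (elim z)
      \<comment> \<open>Move the base point first and the end point afterwards.\<close>
      have "\<Gamma> (?y z) (snd z) \<tau> - \<Gamma> y0 x0 \<tau>
          = \<Gamma> (?y z) x0 (\<Gamma> x0 (snd z) \<tau> - \<tau>) + (\<Gamma> (?y z) y0 (\<Gamma> y0 x0 \<tau>) - \<Gamma> y0 x0 \<tau>)"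
        by (simp add: linear_diff[OF linear_\<Gamma>] \<Gamma>_comp)
      also have "hnorm R \<beta> \<dots> \<le> hnorm R \<beta> (\<Gamma> (?y z) x0 (\<Gamma> x0 (snd z) \<tau> - \<tau>))
          + hnorm R \<beta> (\<Gamma> (?y z) y0 (\<Gamma> y0 x0 \<tau>) - \<Gamma> y0 x0 \<tau>)"
        by (rule hnorm_add[OF \<beta>])
      also have "\<dots> \<le> ?S z"
        using elim by (intro add_right_mono C subspace_diff[OF subspace_space_below] space_below_\<Gamma> \<gamma>) auto
      finally show ?case .
    qed
    have "(?S \<longlongrightarrow> C * (\<Sum>\<alpha>\<in>idx_below R \<gamma>. 0) + 0) ?F"
    proof (intro tendsto_add tendsto_mult tendsto_const tendsto_sum \<Gamma>_tendsto_id[OF \<beta>])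
      have "((\<lambda>z. sc_norm s (x0 - snd z)) \<longlongrightarrow> sc_norm s (x0 - x0)) ?F"
        by (intro lim tendsto_diff tx tendsto_const)
      then have "((\<lambda>z. sc_norm s (x0 - snd z)) \<longlongrightarrow> 0) ?F" by (simp add: sc_norm_0)
      then show "((\<lambda>z. hnorm R \<alpha> (\<Gamma> x0 (snd z) \<tau> - \<tau>)) \<longlongrightarrow> 0) ?F" if "\<alpha> \<in> idx_below R \<gamma>" for \<alpha>
        using that by (intro \<Gamma>_tendsto_id) (auto simp: idx_below_def)
      have "((\<lambda>z. sc_norm s (?y z - y0)) \<longlongrightarrow> sc_norm s (y0 - y0)) ?F"
        by (intro lim tendsto_diff ty tendsto_const)
      then show "((\<lambda>z. sc_norm s (?y z - y0)) \<longlongrightarrow> 0) ?F" by (simp add: sc_norm_0)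
    qed
    then show "(?S \<longlongrightarrow> 0) ?F" by simp
  qed (simp add: hnorm_nonneg \<beta>)
  then have "((\<lambda>z. hnorm R \<beta> (\<sigma> - \<Gamma> (?y z) (snd z) \<tau>) - hnorm R \<beta> (\<sigma> - \<Gamma> y0 x0 \<tau>)) \<longlongrightarrow> 0) ?F"
  proof (rule Lim_null_comparison[rotated])
    have "\<bar>hnorm R \<beta> (\<sigma> - \<Gamma> y x \<tau>) - hnorm R \<beta> (\<sigma> - \<Gamma> y0 x0 \<tau>)\<bar> \<le> hnorm R \<beta> (\<Gamma> y x \<tau> - \<Gamma> y0 x0 \<tau>)" for x y
      using hnorm_diff_abs[OF \<beta>, of "\<sigma> - \<Gamma> y x \<tau>" "\<sigma> - \<Gamma> y0 x0 \<tau>"] hnorm_minus_commute[OF \<beta>, of "\<Gamma> y x \<tau>"] by simp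
    then show "\<forall>\<^sub>F z in ?F. norm (hnorm R \<beta> (\<sigma> - \<Gamma> (?y z) (snd z) \<tau>) - hnorm R \<beta> (\<sigma> - \<Gamma> y0 x0 \<tau>)) \<le> ?G z"
      by simp
  qed
  then show "((\<lambda>z. hnorm R \<beta> (\<sigma> - \<Gamma> (?y z) (snd z) \<tau>)) \<longlongrightarrow>
      hnorm R \<beta> (\<sigma> - \<Gamma> (snd z0 + fst z0) (snd z0) \<tau>)) ?F"
    unfolding x0_def y0_def by (rule LIM_zero_cancel)
qed

end

section \<open>The space of modelled distributions\<close>

lemma epowr_cmult:
  assumes "0 \<le> c" "0 < a"
  shows "epowr (ennreal c * x) a = ennreal (c powr a) * epowr x a"
proof (cases x)
  case (real t)
  then show ?thesis
    using assms by (simp add: ennreal_mult[symmetric] epowr_ennreal powr_mult)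
next
  case top
  then show ?thesis
    using assms by (cases "c = 0") (auto simp: epowr_def ennreal_mult_top)
qed

lemma epowr_add:
  assumes "0 < a"
  shows "epowr (x + y) a \<le> ennreal (2 powr a) * (epowr x a + epowr y a)"
proof -
  have "x + y \<le> ennreal 2 * max x y"
    using add_mono[of x "max x y" y "max x y"] by (simp flip: mult_2)
  then have "epowr (x + y) a \<le> epowr (ennreal 2 * max x y) a"
    using assms by (intro epowr_mono) auto
  also have "\<dots> = ennreal (2 powr a) * epowr (max x y) a"
    using assms by (intro epowr_cmult) auto
  also have "epowr (max x y) a \<le> epowr x a + epowr y a"
    by (auto simp: max_def)
  finally show ?thesis by (simp add: mult_left_mono)
qed

lemma measurable_epowr [measurable]: "f \<in> borel_measurable M \<Longrightarrow> (\<lambda>x. epowr (f x) a) \<in> borel_measurable M"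
  unfolding epowr_def by (intro measurable_If) (measurable, auto)

lemma Lp_norm_mono: "(\<And>x. x \<in> space M \<Longrightarrow> f x \<le> g x) \<Longrightarrow> 0 < p \<Longrightarrow> Lp_norm M p f \<le> Lp_norm M p g"
  unfolding Lp_norm_def by (intro epowr_mono nn_integral_mono) auto

lemma Lp_norm_0: "0 < p \<Longrightarrow> Lp_norm M p (\<lambda>x. 0) = 0"
  by (simp add: Lp_norm_def epowr_def)

lemma Lp_norm_cmult:
  assumes "f \<in> borel_measurable M" "0 \<le> c" "0 < p"
  shows "Lp_norm M p (\<lambda>x. ennreal c * f x) = ennreal c * Lp_norm M p f"
  using assms unfolding Lp_norm_def
  by (simp add: epowr_cmult nn_integral_cmult powr_powr)

text \<open>
  One factor 2 comes from the power \<open>p\<close> inside the integral, a further factor of at most 2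
  from the root \<open>1 / p\<close> outside.
\<close>

lemma Lp_norm_add:
  assumes f: "f \<in> borel_measurable M" and g: "g \<in> borel_measurable M" and p: "1 \<le> p"
  shows "Lp_norm M p (\<lambda>x. f x + g x) \<le> 4 * (Lp_norm M p f + Lp_norm M p g)"
proof -
  let ?I = "\<lambda>f. \<integral>\<^sup>+x. epowr (f x) p \<partial>M"
  have "?I (\<lambda>x. f x + g x) \<le> (\<integral>\<^sup>+x. ennreal (2 powr p) * (epowr (f x) p + epowr (g x) p) \<partial>M)"
    using p by (intro nn_integral_mono epowr_add) auto
  also have "\<dots> = ennreal (2 powr p) * (?I f + ?I g)"
    using f g by (simp add: nn_integral_cmult nn_integral_add)
  finally have "Lp_norm M p (\<lambda>x. f x + g x) \<le> epowr (ennreal (2 powr p) * (?I f + ?I g)) (1 / p)"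
    unfolding Lp_norm_def using p by (intro epowr_mono) auto
  also have "\<dots> = 2 * epowr (?I f + ?I g) (1 / p)"
    using p by (subst epowr_cmult) (auto simp: powr_powr)
  also have "\<dots> \<le> 2 * (ennreal (2 powr (1 / p)) * (Lp_norm M p f + Lp_norm M p g))"
    unfolding Lp_norm_def using p by (intro mult_left_mono epowr_add) auto
  also have "\<dots> \<le> 2 * (2 * (Lp_norm M p f + Lp_norm M p g))"
  proof (intro mult_left_mono mult_right_mono)
    show "ennreal (2 powr (1 / p)) \<le> 2"
      using p powr_mono[of "1 / p" 1 2] by (auto simp: ennreal_le_iff simp flip: ennreal_numeral)
  qed auto
  also have "\<dots> = 4 * (Lp_norm M p f + Lp_norm M p g)"
    by (simp add: mult.assoc[symmetric])
  finally show ?thesis .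
qed

lemma borel_measurable_norm_on:
  assumes N: "norm_on E N" and f: "strongly_measurable M E N f"
  shows "(\<lambda>w. N (f w)) \<in> borel_measurable M"
proof -
  have fE: "\<forall>w\<in>space M. f w \<in> E" and "\<exists>u. (\<forall>n. simple_function M (u n) \<and> u n ` space M \<subseteq> E)
      \<and> (\<forall>w\<in>space M. (\<lambda>n. N (u n w - f w)) \<longlonglongrightarrow> 0)"
    using f by (auto simp: strongly_measurable_def)
  then obtain u where u: "\<forall>n. simple_function M (u n) \<and> u n ` space M \<subseteq> E"
      "\<forall>w\<in>space M. (\<lambda>n. N (u n w - f w)) \<longlonglongrightarrow> 0"
    by (elim exE conjE)
  show ?thesis
  proof (rule borel_measurable_LIMSEQ_real)
    show "(\<lambda>w. N (u n w)) \<in> borel_measurable M" for n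
      using u(1) by (intro borel_measurable_simple_function simple_function_compose1[of M "u n" N]) blast
    fix w assume w: "w \<in> space M"
    have tri: "\<bar>N a - N b\<bar> \<le> N (a - b)" if ab: "a \<in> E" "b \<in> E" for a b
    proof -
      have d: "a - b \<in> E" using N ab by (auto simp: norm_on_def intro: subspace_diff)
      have d': "b - a \<in> E" using N ab by (auto simp: norm_on_def intro: subspace_diff)
      have "N ((a - b) + b) \<le> N (a - b) + N b" using N ab d unfolding norm_on_def by blast
      moreover have "N ((b - a) + a) \<le> N (b - a) + N a" using N ab d' unfolding norm_on_def by blast
      moreover have "N ((-1) *\<^sub>R (a - b)) = \<bar>-1\<bar> * N (a - b)" using N d unfolding norm_on_def by blast
      ultimately show ?thesis by simp
    qed
    have "(\<lambda>n. N (u n w) - N (f w)) \<longlonglongrightarrow> 0"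
      by (rule Lim_null_comparison[OF _ u(2)[rule_format, OF w]])
        (use u(1) fE w in \<open>auto simp: image_subset_iff intro!: always_eventually tri\<close>)
    then show "(\<lambda>n. N (u n w)) \<longlonglongrightarrow> N (f w)" by (rule LIM_zero_cancel)
  qed
qed

lemma measurable_compose_finite:
  assumes F: "\<And>a. a \<in> I \<Longrightarrow> F a \<in> measurable M N" and u: "simple_function M u" "u ` space M \<subseteq> I"
    and "finite I"
  shows "(\<lambda>z. F (u z) z) \<in> measurable M N"
proof (rule measurable_compose_countable'[OF F])
  show "u \<in> measurable M (count_space I)"
    using u \<open>finite I\<close> measurable_simple_function[OF u(1)]
    by (subst measurable_count_space_eq2) (auto intro: measurable_sets)
  show "countable I" using \<open>finite I\<close> by (rule countable_finite)
qed auto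

context reg_model
begin

definition sector_measurable :: "real \<Rightarrow> (real^'d \<Rightarrow> 'v) \<Rightarrow> bool"
  where "sector_measurable \<gamma> f \<longleftrightarrow> (\<forall>x. f x \<in> space_below R \<gamma>)
    \<and> (\<forall>\<alpha>\<in>idx_below R \<gamma>. strongly_measurable lborel (sector R \<alpha>) (cnorm R \<alpha>) (\<lambda>x. component R \<alpha> (f x)))"

lemma modelled_iff:
  "f \<in> modelled s R \<Gamma> \<gamma> p q \<longleftrightarrow> sector_measurable \<gamma> f \<and> md_norm s R \<Gamma> \<gamma> p q f < \<infinity>"
  by (auto simp: modelled_def sector_measurable_def)

lemma sector_measurable_lincomb:
  assumes "sector_measurable \<gamma> f" "sector_measurable \<gamma> g"
  shows "sector_measurable \<gamma> (a *\<^sub>R f + b *\<^sub>R g)"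
  unfolding sector_measurable_def
proof (intro conjI allI ballI)
  show "(a *\<^sub>R f + b *\<^sub>R g) x \<in> space_below R \<gamma>" for x
    using assms by (auto simp: sector_measurable_def scaleR_fun_def intro!: subspace_add subspace_scale subspace_space_below)
  fix \<alpha> assume \<alpha>: "\<alpha> \<in> idx_below R \<gamma>"
  then have "strongly_measurable lborel (sector R \<alpha>) (cnorm R \<alpha>) (\<lambda>x. a *\<^sub>R component R \<alpha> (f x) + b *\<^sub>R component R \<alpha> (g x))"
    using assms by (intro strongly_measurable_lincomb norm_on_imp_quasi norm_on_sector)
      (auto simp: idx_below_def sector_measurable_def)
  then show "strongly_measurable lborel (sector R \<alpha>) (cnorm R \<alpha>) (\<lambda>x. component R \<alpha> ((a *\<^sub>R f + b *\<^sub>R g) x))"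
    by (simp add: scaleR_fun_def linear_add[OF linear_component] linear_cmul[OF linear_component])
qed

lemma measurable_hnorm:
  assumes "sector_measurable \<gamma> f" "\<alpha> \<in> idx_below R \<gamma>"
  shows "(\<lambda>x. hnorm R \<alpha> (f x)) \<in> borel_measurable lborel"
  unfolding hnorm_def using assms
  by (intro borel_measurable_norm_on[OF norm_on_sector]) (auto simp: sector_measurable_def idx_below_def)

text \<open>
  A model comes with no measurability of \<open>\<Gamma>\<close>. For a simple function \<open>u\<close> in place of \<open>f\<close> the
  increment is piecewise continuous in \<open>(h, x)\<close> because \<open>\<Gamma>\<close> is strongly continuous, and
  the general case follows by approximation.
\<close>

lemma measurable_increment:
  assumes f: "sector_measurable \<gamma> f" and \<alpha>: "\<alpha> \<in> idx_below R \<gamma>"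
  shows "(\<lambda>z. hnorm R \<alpha> (f (snd z + fst z) - \<Gamma> (snd z + fst z) (snd z) (f (snd z))))
    \<in> borel_measurable (borel \<Otimes>\<^sub>M borel)"
proof -
  have \<alpha>': "\<alpha> \<in> idx R" using \<alpha> by (simp add: idx_below_def)
  have "\<forall>\<beta>\<in>idx_below R \<gamma>. \<exists>u. (\<forall>n. simple_function lborel (u n)) \<and> (\<forall>n x. u n x \<in> sector R \<beta>)
      \<and> (\<forall>x. (\<lambda>n. cnorm R \<beta> (u n x - component R \<beta> (f x))) \<longlonglongrightarrow> 0)"
  proof
    fix \<beta> assume "\<beta> \<in> idx_below R \<gamma>"
    then have "strongly_measurable lborel (sector R \<beta>) (cnorm R \<beta>) (\<lambda>x. component R \<beta> (f x))"
      using f by (simp add: sector_measurable_def)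
    then obtain u where "\<forall>n. simple_function lborel (u n) \<and> u n ` space lborel \<subseteq> sector R \<beta>"
        "\<forall>x\<in>space lborel. (\<lambda>n. cnorm R \<beta> (u n x - component R \<beta> (f x))) \<longlonglongrightarrow> 0"
      unfolding strongly_measurable_def by (elim exE conjE)
    then show "\<exists>u. (\<forall>n. simple_function lborel (u n)) \<and> (\<forall>n x. u n x \<in> sector R \<beta>)
        \<and> (\<forall>x. (\<lambda>n. cnorm R \<beta> (u n x - component R \<beta> (f x))) \<longlonglongrightarrow> 0)"
      by (intro exI[of _ u]) (simp add: image_subset_iff)
  qed
  then obtain u where u: "\<And>\<beta> n. \<beta> \<in> idx_below R \<gamma> \<Longrightarrow> simple_function lborel (u \<beta> n)"
      "\<And>\<beta> n x. \<beta> \<in> idx_below R \<gamma> \<Longrightarrow> u \<beta> n x \<in> sector R \<beta>"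
      "\<And>\<beta> x. \<beta> \<in> idx_below R \<gamma> \<Longrightarrow> (\<lambda>n. cnorm R \<beta> (u \<beta> n x - component R \<beta> (f x))) \<longlonglongrightarrow> 0"
    by metis
  define U where "U n x = (\<Sum>\<beta>\<in>idx_below R \<gamma>. u \<beta> n x)" for n x
  have comp_U: "component R \<beta> (U n x) = (if \<beta> \<in> idx_below R \<gamma> then u \<beta> n x else 0)" for n x \<beta>
  proof -
    have "component R \<beta> (U n x) = (\<Sum>\<alpha>\<in>idx_below R \<gamma>. if \<beta> = \<alpha> then u \<alpha> n x else 0)"
      unfolding U_def linear_sum[OF linear_component]
      using u(2) by (intro sum.cong refl component_of_sector) (auto simp: idx_below_def)
    then show ?thesis by (simp add: sum.delta finite_idx_below)
  qed
  have U_below: "U n x \<in> space_below R \<gamma>" for n x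
    by (auto simp: space_below_def comp_U idx_below_def)
  have f_below: "f x \<in> space_below R \<gamma>" for x using f by (simp add: sector_measurable_def)
  have U_lim: "(\<lambda>n. hnorm R \<beta> (U n x - f x)) \<longlonglongrightarrow> 0" if "\<beta> \<in> idx_below R \<gamma>" for \<beta> x
    using u(3)[OF that, of x] that by (simp add: hnorm_def linear_diff[OF linear_component] comp_U)
  have simple_U: "simple_function borel (U n)" for n
  proof -
    have "simple_function borel (\<lambda>x. \<Sum>\<beta>\<in>I. u \<beta> n x)" if "finite I" "I \<subseteq> idx_below R \<gamma>" for I
      using that
    proof (induction I rule: finite_induct)
      case (insert \<beta> I)
      have "simple_function borel (u \<beta> n)"
        using u(1)[of \<beta> n] insert.prems by (simp add: simple_function_def)
      moreover have "simple_function borel (\<lambda>x. \<Sum>\<beta>\<in>I. u \<beta> n x)"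
        using insert by simp
      ultimately have "simple_function borel (\<lambda>x. u \<beta> n x + (\<Sum>\<beta>\<in>I. u \<beta> n x))"
        by (rule simple_function_compose2)
      then show ?case using insert by simp
    qed simp
    then show ?thesis
      unfolding U_def[abs_def] using finite_idx_below by blast
  qed
  show ?thesis
  proof (rule borel_measurable_LIMSEQ_real)
    fix n
    let ?B = "borel :: (real^'d) measure"
    have fin: "finite (range (U n))"
      using simple_U[of n] by (simp add: simple_function_def)
    have piece: "(\<lambda>z. hnorm R \<alpha> (a - \<Gamma> (snd z + fst z) (snd z) b)) \<in> borel_measurable (?B \<Otimes>\<^sub>M ?B)" for a b
      using continuous_\<Gamma>[OF \<alpha>', of a b] by (simp add: borel_prod borel_measurable_continuous_onI)
    have simple: "simple_function (?B \<Otimes>\<^sub>M ?B) (\<lambda>z. U n (g z))" if "g \<in> measurable (?B \<Otimes>\<^sub>M ?B) ?B" for g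
    proof -
      have "(\<lambda>z. U n (g z)) \<in> measurable (?B \<Otimes>\<^sub>M ?B) (count_space UNIV)"
        using measurable_simple_function[OF simple_U[of n]] that by (rule measurable_compose[rotated])
      then show ?thesis
        using finite_subset[OF _ fin, of "(\<lambda>z. U n (g z)) ` space (?B \<Otimes>\<^sub>M ?B)"]
        by (auto simp: simple_function_def measurable_sets)
    qed
    have "(\<lambda>z. hnorm R \<alpha> (a - \<Gamma> (snd z + fst z) (snd z) (U n (snd z)))) \<in> borel_measurable (?B \<Otimes>\<^sub>M ?B)" for a
      by (rule measurable_compose_finite[where F = "\<lambda>b z. hnorm R \<alpha> (a - \<Gamma> (snd z + fst z) (snd z) b)",
            OF piece simple]) (use fin in auto)
    then show "(\<lambda>z. hnorm R \<alpha> (U n (snd z + fst z) - \<Gamma> (snd z + fst z) (snd z) (U n (snd z)))) \<in> borel_measurable (?B \<Otimes>\<^sub>M ?B)"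
      by (rule measurable_compose_finite[where F = "\<lambda>a z. hnorm R \<alpha> (a - \<Gamma> (snd z + fst z) (snd z) (U n (snd z)))",
            OF _ simple]) (use fin in auto)
  next
    fix z :: "(real^'d) \<times> (real^'d)"
    let ?x = "snd z" and ?y = "snd z + fst z"
    obtain C where C: "\<And>\<tau>. \<tau> \<in> space_below R \<gamma> \<Longrightarrow> hnorm R \<alpha> (\<Gamma> ?y ?x \<tau>) \<le> C * (\<Sum>\<beta>\<in>idx_below R \<gamma>. hnorm R \<beta> \<tau>)"
      using \<Gamma>_locally_bounded[OF \<alpha>' sc_norm_nonneg[of "?y - ?x"], of \<gamma>] by (meson order.refl)
    let ?d = "\<lambda>n. hnorm R \<alpha> (U n ?y - f ?y) + C * (\<Sum>\<beta>\<in>idx_below R \<gamma>. hnorm R \<beta> (U n ?x - f ?x))"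
    have "(\<lambda>n. hnorm R \<alpha> (U n ?y - \<Gamma> ?y ?x (U n ?x)) - hnorm R \<alpha> (f ?y - \<Gamma> ?y ?x (f ?x))) \<longlonglongrightarrow> 0"
    proof (rule Lim_null_comparison)
      show "\<forall>\<^sub>F n in sequentially. norm (hnorm R \<alpha> (U n ?y - \<Gamma> ?y ?x (U n ?x)) - hnorm R \<alpha> (f ?y - \<Gamma> ?y ?x (f ?x))) \<le> ?d n"
      proof (intro always_eventually allI)
        fix n
        have eq: "(U n ?y - \<Gamma> ?y ?x (U n ?x)) - (f ?y - \<Gamma> ?y ?x (f ?x)) = (U n ?y - f ?y) + \<Gamma> ?y ?x (f ?x - U n ?x)"
          by (simp add: linear_diff[OF linear_\<Gamma>])
        have "norm (hnorm R \<alpha> (U n ?y - \<Gamma> ?y ?x (U n ?x)) - hnorm R \<alpha> (f ?y - \<Gamma> ?y ?x (f ?x)))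
            \<le> hnorm R \<alpha> ((U n ?y - f ?y) + \<Gamma> ?y ?x (f ?x - U n ?x))"
          using hnorm_diff_abs[OF \<alpha>', of "U n ?y - \<Gamma> ?y ?x (U n ?x)" "f ?y - \<Gamma> ?y ?x (f ?x)"] unfolding eq by simp
        also have "\<dots> \<le> hnorm R \<alpha> (U n ?y - f ?y) + hnorm R \<alpha> (\<Gamma> ?y ?x (f ?x - U n ?x))"
          by (rule hnorm_add[OF \<alpha>'])
        also have "hnorm R \<alpha> (\<Gamma> ?y ?x (f ?x - U n ?x)) \<le> C * (\<Sum>\<beta>\<in>idx_below R \<gamma>. hnorm R \<beta> (f ?x - U n ?x))"
          by (intro C subspace_diff[OF subspace_space_below] U_below f_below)
        also have "(\<Sum>\<beta>\<in>idx_below R \<gamma>. hnorm R \<beta> (f ?x - U n ?x)) = (\<Sum>\<beta>\<in>idx_below R \<gamma>. hnorm R \<beta> (U n ?x - f ?x))"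
          by (intro sum.cong refl hnorm_minus_commute) (simp add: idx_below_def)
        finally show "norm (hnorm R \<alpha> (U n ?y - \<Gamma> ?y ?x (U n ?x)) - hnorm R \<alpha> (f ?y - \<Gamma> ?y ?x (f ?x))) \<le> ?d n"
          by simp
      qed
      have "?d \<longlonglongrightarrow> 0 + C * (\<Sum>\<beta>\<in>idx_below R \<gamma>. 0)"
        by (intro tendsto_add tendsto_mult tendsto_const tendsto_sum U_lim \<alpha>)
      then show "?d \<longlonglongrightarrow> 0" by simp
    qed
    then show "(\<lambda>n. hnorm R \<alpha> (U n ?y - \<Gamma> ?y ?x (U n ?x))) \<longlonglongrightarrow> hnorm R \<alpha> (f ?y - \<Gamma> ?y ?x (f ?x))"
      by (rule LIM_zero_cancel)
  qed
qed

definition increment :: "real \<Rightarrow> real \<Rightarrow> (real^'d \<Rightarrow> 'v) \<Rightarrow> real^'d \<Rightarrow> real^'d \<Rightarrow> ennreal"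
  where "increment \<gamma> \<alpha> f h x = ennreal (hnorm R \<alpha> (f (x + h) - \<Gamma> (x + h) x (f x)) / sc_norm s h powr (\<gamma> - \<alpha>))"

lemma md_norm_eq:
  "md_norm s R \<Gamma> \<gamma> p q f =
      (\<Sum>\<alpha>\<in>idx_below R \<gamma>. Lp_norm lborel p (\<lambda>x. ennreal (hnorm R \<alpha> (f x))))
    + (\<Sum>\<alpha>\<in>idx_below R \<gamma>. Lp_norm (shift_measure s) q (\<lambda>h. Lp_norm lborel p (increment \<gamma> \<alpha> f h)))"
  by (simp add: md_norm_def increment_def[abs_def])

lemma measurable_increment_joint:
  assumes "sector_measurable \<gamma> f" "\<alpha> \<in> idx_below R \<gamma>"
  shows "(\<lambda>(h, x). increment \<gamma> \<alpha> f h x) \<in> borel_measurable (borel \<Otimes>\<^sub>M lborel)"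
proof -
  have [measurable]: "sc_norm s \<in> borel_measurable borel"
    using continuous_sc_norm by (rule borel_measurable_continuous_onI)
  have [measurable]: "(\<lambda>z. hnorm R \<alpha> (f (snd z + fst z) - \<Gamma> (snd z + fst z) (snd z) (f (snd z)))) \<in> borel_measurable (borel \<Otimes>\<^sub>M borel)"
    using assms by (rule measurable_increment)
  have "(\<lambda>z. ennreal (hnorm R \<alpha> (f (snd z + fst z) - \<Gamma> (snd z + fst z) (snd z) (f (snd z))) / sc_norm s (fst z) powr (\<gamma> - \<alpha>)))
      \<in> borel_measurable (borel \<Otimes>\<^sub>M borel)"
    by measurable
  then show ?thesis
    by (simp add: increment_def split_beta cong: measurable_cong_sets)
qed

lemma measurable_increment_x:
  assumes "sector_measurable \<gamma> f" "\<alpha> \<in> idx_below R \<gamma>"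
  shows "increment \<gamma> \<alpha> f h \<in> borel_measurable lborel"
  using measurable_compose[OF measurable_Pair1', OF _ measurable_increment_joint[OF assms], of h] by simp

lemma measurable_increment_Lp:
  assumes "sector_measurable \<gamma> f" "\<alpha> \<in> idx_below R \<gamma>"
  shows "(\<lambda>h. Lp_norm lborel p (increment \<gamma> \<alpha> f h)) \<in> borel_measurable (shift_measure s)"
proof -
  have [measurable]: "(\<lambda>(h, x). increment \<gamma> \<alpha> f h x) \<in> borel_measurable (borel \<Otimes>\<^sub>M lborel)"
    using assms by (rule measurable_increment_joint)
  have "(\<lambda>h. Lp_norm lborel p (increment \<gamma> \<alpha> f h)) \<in> borel_measurable borel"
    unfolding Lp_norm_def by measurable
  then show ?thesis
    by (simp add: shift_measure_def cong: measurable_cong_sets)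
qed

lemma increment_add:
  assumes "\<alpha> \<in> idx_below R \<gamma>"
  shows "increment \<gamma> \<alpha> (f + g) h x \<le> increment \<gamma> \<alpha> f h x + increment \<gamma> \<alpha> g h x"
proof -
  have \<alpha>: "\<alpha> \<in> idx R" using assms by (simp add: idx_below_def)
  let ?i = "\<lambda>f. f (x + h) - \<Gamma> (x + h) x (f x)"
  have eq: "?i (f + g) = ?i f + ?i g" by (simp add: linear_add[OF linear_\<Gamma>])
  have "hnorm R \<alpha> (?i (f + g)) \<le> hnorm R \<alpha> (?i f) + hnorm R \<alpha> (?i g)"
    unfolding eq by (rule hnorm_add[OF \<alpha>])
  then show ?thesis
    using hnorm_nonneg[OF \<alpha>]
    by (simp add: increment_def ennreal_plus[symmetric] add_divide_distrib[symmetric] divide_right_mono ennreal_leI del: ennreal_plus)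
qed

lemma increment_scaleR:
  assumes "\<alpha> \<in> idx_below R \<gamma>"
  shows "increment \<gamma> \<alpha> (c *\<^sub>R f) h x = ennreal \<bar>c\<bar> * increment \<gamma> \<alpha> f h x"
proof -
  have \<alpha>: "\<alpha> \<in> idx R" using assms by (simp add: idx_below_def)
  let ?i = "\<lambda>f. f (x + h) - \<Gamma> (x + h) x (f x)"
  have "?i (c *\<^sub>R f) = c *\<^sub>R ?i f" by (simp add: scaleR_fun_def linear_cmul[OF linear_\<Gamma>] scaleR_diff_right)
  then show ?thesis
    using hnorm_nonneg[OF \<alpha>] by (simp add: increment_def hnorm_scaleR[OF \<alpha>] ennreal_mult[symmetric])
qed

text \<open>The constant is the square of the one in \<open>Lp_norm_add\<close>, because the \<open>q\<close>-norm contains a \<open>p\<close>-norm.\<close>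

lemma md_norm_add:
  assumes f: "sector_measurable \<gamma> f" and g: "sector_measurable \<gamma> g" and p: "1 \<le> p" and q: "1 \<le> q"
  shows "md_norm s R \<Gamma> \<gamma> p q (f + g) \<le> 16 * (md_norm s R \<Gamma> \<gamma> p q f + md_norm s R \<Gamma> \<gamma> p q g)"
proof -
  let ?P = "\<lambda>f \<alpha>. Lp_norm lborel p (\<lambda>x. ennreal (hnorm R \<alpha> (f x)))"
  let ?L = "\<lambda>f \<alpha> h. Lp_norm lborel p (increment \<gamma> \<alpha> f h)"
  let ?Q = "\<lambda>f \<alpha>. Lp_norm (shift_measure s) q (?L f \<alpha>)"
  have P: "?P (f + g) \<alpha> \<le> 16 * (?P f \<alpha> + ?P g \<alpha>)" if \<alpha>: "\<alpha> \<in> idx_below R \<gamma>" for \<alpha>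
  proof -
    have \<alpha>': "\<alpha> \<in> idx R" using \<alpha> by (simp add: idx_below_def)
    have "?P (f + g) \<alpha> \<le> Lp_norm lborel p (\<lambda>x. ennreal (hnorm R \<alpha> (f x)) + ennreal (hnorm R \<alpha> (g x)))"
      using p hnorm_nonneg[OF \<alpha>'] hnorm_add[OF \<alpha>']
      by (intro Lp_norm_mono) (auto simp: ennreal_plus[symmetric] ennreal_leI simp del: ennreal_plus)
    also have "\<dots> \<le> 4 * (?P f \<alpha> + ?P g \<alpha>)"
      using p measurable_hnorm[OF f \<alpha>] measurable_hnorm[OF g \<alpha>] by (intro Lp_norm_add) auto
    also have "\<dots> \<le> 16 * (?P f \<alpha> + ?P g \<alpha>)" by (intro mult_right_mono) auto
    finally show ?thesis .
  qed
  have Q: "?Q (f + g) \<alpha> \<le> 16 * (?Q f \<alpha> + ?Q g \<alpha>)" if \<alpha>: "\<alpha> \<in> idx_below R \<gamma>" for \<alpha>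
  proof -
    note [measurable] = measurable_increment_Lp[OF f \<alpha>, of p] measurable_increment_Lp[OF g \<alpha>, of p]
    have "?L (f + g) \<alpha> h \<le> 4 * (?L f \<alpha> h + ?L g \<alpha> h)" for h
    proof -
      have "?L (f + g) \<alpha> h \<le> Lp_norm lborel p (\<lambda>x. increment \<gamma> \<alpha> f h x + increment \<gamma> \<alpha> g h x)"
        using p increment_add[OF \<alpha>] by (intro Lp_norm_mono) auto
      also have "\<dots> \<le> 4 * (?L f \<alpha> h + ?L g \<alpha> h)"
        using measurable_increment_x[OF f \<alpha>] measurable_increment_x[OF g \<alpha>] p by (intro Lp_norm_add) auto
      finally show ?thesis .
    qed
    then have "?Q (f + g) \<alpha> \<le> Lp_norm (shift_measure s) q (\<lambda>h. ennreal 4 * (?L f \<alpha> h + ?L g \<alpha> h))"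
      using q by (intro Lp_norm_mono) auto
    also have "\<dots> = 4 * Lp_norm (shift_measure s) q (\<lambda>h. ?L f \<alpha> h + ?L g \<alpha> h)"
      using q by (subst Lp_norm_cmult) auto
    also have "\<dots> \<le> 4 * (4 * (?Q f \<alpha> + ?Q g \<alpha>))"
      using q by (intro mult_left_mono Lp_norm_add) auto
    finally show ?thesis by (simp add: mult.assoc[symmetric])
  qed
  have "md_norm s R \<Gamma> \<gamma> p q (f + g) \<le> (\<Sum>\<alpha>\<in>idx_below R \<gamma>. 16 * (?P f \<alpha> + ?P g \<alpha>)) + (\<Sum>\<alpha>\<in>idx_below R \<gamma>. 16 * (?Q f \<alpha> + ?Q g \<alpha>))"
    unfolding md_norm_eq by (intro add_mono sum_mono P Q)
  also have "\<dots> = 16 * (md_norm s R \<Gamma> \<gamma> p q f + md_norm s R \<Gamma> \<gamma> p q g)"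
    by (simp add: md_norm_eq sum_distrib_left[symmetric] sum.distrib distrib_left ac_simps)
  finally show ?thesis .
qed

lemma md_norm_scaleR:
  assumes f: "sector_measurable \<gamma> f" and p: "0 < p" and q: "0 < q"
  shows "md_norm s R \<Gamma> \<gamma> p q (c *\<^sub>R f) = ennreal \<bar>c\<bar> * md_norm s R \<Gamma> \<gamma> p q f"
proof -
  have "Lp_norm lborel p (\<lambda>x. ennreal (hnorm R \<alpha> ((c *\<^sub>R f) x))) = ennreal \<bar>c\<bar> * Lp_norm lborel p (\<lambda>x. ennreal (hnorm R \<alpha> (f x)))"
    if \<alpha>: "\<alpha> \<in> idx_below R \<gamma>" for \<alpha>
    using \<alpha> p measurable_hnorm[OF f \<alpha>] hnorm_nonneg
    by (subst Lp_norm_cmult[symmetric]) (auto simp: idx_below_def scaleR_fun_def hnorm_scaleR ennreal_mult)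
  moreover have "Lp_norm (shift_measure s) q (\<lambda>h. Lp_norm lborel p (increment \<gamma> \<alpha> (c *\<^sub>R f) h))
      = ennreal \<bar>c\<bar> * Lp_norm (shift_measure s) q (\<lambda>h. Lp_norm lborel p (increment \<gamma> \<alpha> f h))"
    if \<alpha>: "\<alpha> \<in> idx_below R \<gamma>" for \<alpha>
  proof -
    have "Lp_norm lborel p (increment \<gamma> \<alpha> (c *\<^sub>R f) h) = ennreal \<bar>c\<bar> * Lp_norm lborel p (increment \<gamma> \<alpha> f h)" for h
      using p measurable_increment_x[OF f \<alpha>] by (subst Lp_norm_cmult[symmetric]) (auto simp: increment_scaleR[OF \<alpha>, abs_def])
    then show ?thesis
      using q measurable_increment_Lp[OF f \<alpha>] by (simp add: Lp_norm_cmult)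
  qed
  ultimately show ?thesis
    by (simp add: md_norm_eq sum_distrib_left[symmetric] distrib_left)
qed

lemma zero_in_modelled:
  assumes "0 < p" "0 < q"
  shows "0 \<in> modelled s R \<Gamma> \<gamma> p q"
proof -
  have "sector_measurable \<gamma> 0"
    unfolding sector_measurable_def
  proof (intro conjI ballI allI)
    fix \<alpha> assume "\<alpha> \<in> idx_below R \<gamma>"
    then have \<alpha>: "\<alpha> \<in> idx R" by (simp add: idx_below_def)
    then have "cnorm R \<alpha> 0 = 0" using hnorm_0[OF \<alpha>] by (simp add: hnorm_def linear_0[OF linear_component])
    then show "strongly_measurable lborel (sector R \<alpha>) (cnorm R \<alpha>) (\<lambda>x. component R \<alpha> (0 x))"
      using subspace_0[OF subspace_sector[OF \<alpha>]]
      by (intro strongly_measurableI[where u = "\<lambda>n x. 0"]) (auto simp: linear_0[OF linear_component])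
  qed (simp add: subspace_0[OF subspace_space_below])
  moreover have "md_norm s R \<Gamma> \<gamma> p q 0 = 0"
    using assms by (auto simp: md_norm_eq increment_def[abs_def] linear_0[OF linear_\<Gamma>] hnorm_0 idx_below_def Lp_norm_0 intro!: sum.neutral)
  ultimately show ?thesis by (simp add: modelled_iff)
qed

lemma quasi_seminorm_modelled:
  assumes p: "1 < p" and q: "1 < q"
  shows "quasi_seminorm_on (modelled s R \<Gamma> \<gamma> p q) (md_seminorm s R \<Gamma> \<gamma> p q)"
proof -
  let ?D = "modelled s R \<Gamma> \<gamma> p q" and ?n = "md_norm s R \<Gamma> \<gamma> p q"
  have add: "f + g \<in> ?D \<and> enn2real (?n (f + g)) \<le> 16 * (enn2real (?n f) + enn2real (?n g))"
    if fg: "f \<in> ?D" "g \<in> ?D" for f g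
  proof -
    have sm: "sector_measurable \<gamma> f" "sector_measurable \<gamma> g" and fin: "?n f < \<infinity>" "?n g < \<infinity>"
      using fg by (auto simp: modelled_iff)
    have le: "?n (f + g) \<le> 16 * (?n f + ?n g)"
      using sm p q by (intro md_norm_add) auto
    also have "\<dots> = ennreal (16 * (enn2real (?n f) + enn2real (?n g)))"
      using fin by (auto simp: ennreal_mult ennreal_enn2real_if)
    finally have le': "?n (f + g) \<le> ennreal (16 * (enn2real (?n f) + enn2real (?n g)))" .
    then have "?n (f + g) < \<infinity>" using ennreal_less_top le_less_trans by (metis infinity_ennreal_def)
    moreover have "sector_measurable \<gamma> (f + g)"
      using sector_measurable_lincomb[OF sm, of 1 1] by simp
    ultimately show ?thesis
      using enn2real_leI[OF _ le'] by (simp add: modelled_iff)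
  qed
  have scale: "c *\<^sub>R f \<in> ?D \<and> enn2real (?n (c *\<^sub>R f)) = \<bar>c\<bar> * enn2real (?n f)" if f: "f \<in> ?D" for c f
  proof -
    have sm: "sector_measurable \<gamma> f" and fin: "?n f < \<infinity>"
      using f by (auto simp: modelled_iff)
    have "?n (c *\<^sub>R f) = ennreal \<bar>c\<bar> * ?n f"
      using sm p q by (intro md_norm_scaleR) auto
    moreover have "sector_measurable \<gamma> (c *\<^sub>R f)"
      using sector_measurable_lincomb[OF sm sm, of c 0] by simp
    ultimately show ?thesis
      using fin by (simp add: modelled_iff enn2real_mult ennreal_mult_less_top)
  qed
  show ?thesis
    unfolding quasi_seminorm_on_def md_seminorm_def
    using add scale zero_in_modelled[of p q] p q by (auto intro!: subspaceI exI[of _ 16])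
qed

end

section \<open>The Ito isometry for scalar step processes\<close>

locale brownian =
  fixes M :: "'w measure" and F :: "real \<Rightarrow> 'w measure" and T :: real and W :: "real \<Rightarrow> 'w \<Rightarrow> real"
  assumes filtered: "complete_filtered_prob_space M F" and BM: "brownian_motion M F T W" and T: "T > 0"
begin

sublocale prob_space M
  using filtered by (simp add: complete_filtered_prob_space_def)

lemma space_F: "space (F t) = space M"
  and sets_F: "sets (F t) \<subseteq> events"
  using filtered by (auto simp: complete_filtered_prob_space_def subalgebra_def)

lemma sets_F_mono: "u \<le> t \<Longrightarrow> sets (F u) \<subseteq> sets (F t)"
  using filtered by (intro filtration.sets_F_mono[of "space M"]) (simp_all add: complete_filtered_prob_space_def)

lemma measurable_F: "f \<in> measurable (F t) N \<Longrightarrow> f \<in> measurable M N"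
  by (rule measurable_from_subalg[of M "F t"]) (simp_all add: subalgebra_def sets_F space_F)

lemma measurable_F_mono: "f \<in> measurable (F u) N \<Longrightarrow> u \<le> t \<Longrightarrow> f \<in> measurable (F t) N"
  by (rule measurable_from_subalg[of "F t" "F u"]) (simp_all add: subalgebra_def sets_F_mono space_F)

lemma measurable_W: "0 \<le> u \<Longrightarrow> u \<le> t \<Longrightarrow> t \<le> T \<Longrightarrow> W u \<in> borel_measurable (F t)"
proof (rule measurable_F_mono[of "W u" u])
  assume "0 \<le> u" "u \<le> t" "t \<le> T"
  then have "u \<in> {0..T}" by simp
  then show "W u \<in> borel_measurable (F u)"
    using BM unfolding brownian_motion_def by blast
qed

definition incr :: "real \<Rightarrow> real \<Rightarrow> 'w \<Rightarrow> real"
  where "incr u t w = W t w - W u w"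

lemma measurable_incr: "0 \<le> u \<Longrightarrow> u \<le> t \<Longrightarrow> t \<le> T \<Longrightarrow> incr u t \<in> borel_measurable (F t)"
  unfolding incr_def[abs_def] using measurable_W[of u t] measurable_W[of t t] by simp

lemma incr_moments:
  assumes "0 \<le> u" "u \<le> t" "t \<le> T"
  shows "has_bochner_integral M (incr u t) 0"
    and "has_bochner_integral M (\<lambda>w. (incr u t w)\<^sup>2) (t - u)"
proof -
  have "has_bochner_integral M (incr u t) 0 \<and> has_bochner_integral M (\<lambda>w. (incr u t w)\<^sup>2) (t - u)"
  proof (cases "u = t")
    case True
    then show ?thesis by (simp add: incr_def[abs_def] has_bochner_integral_zero)
  next
    case False
    let ?s = "sqrt (t - u)"
    have s: "?s > 0" using assms False by simp
    have D: "distributed M lborel (incr u t) (normal_density 0 ?s)"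
      using BM assms False unfolding brownian_motion_def incr_def[abs_def] by (meson order_le_imp_less_or_eq)
    have "integrable M (\<lambda>w. (incr u t w) ^ k)" for k
      using distributed_integrable[OF D, of "\<lambda>x. x ^ k"] integrable_normal_moment[OF s, of 0 k] by simp
    from this[of 1] this[of 2] have "integrable M (incr u t)" "integrable M (\<lambda>w. (incr u t w)\<^sup>2)"
      by simp_all
    moreover have "expectation (incr u t) = 0"
      by (rule normal_distributed_expectation[OF s D])
    moreover have "expectation (\<lambda>w. (incr u t w)\<^sup>2) = t - u"
      using normal_distributed_variance[OF s D] \<open>expectation (incr u t) = 0\<close> assms by simp
    ultimately show ?thesis by (metis has_bochner_integral_integrable)
  qed
  then show "has_bochner_integral M (incr u t) 0"
    and "has_bochner_integral M (\<lambda>w. (incr u t w)\<^sup>2) (t - u)" by auto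
qed

text \<open>
  The definition of Brownian motion asserts independence of \<open>\<sigma>\<close>-algebras. The random variables
  \<open>Y\<close> and \<open>g\<close> of the increment generate smaller ones, so the product rule for expectations applies.
\<close>

lemma indep_incr:
  fixes Y :: "'w \<Rightarrow> real" and g :: "real \<Rightarrow> real"
  assumes ut: "0 \<le> u" "u \<le> t" "t \<le> T" and Y: "Y \<in> borel_measurable (F u)" "integrable M Y"
    and g: "g \<in> borel_measurable borel" and int: "has_bochner_integral M (\<lambda>w. g (incr u t w)) v"
  shows "has_bochner_integral M (\<lambda>w. Y w * g (incr u t w)) (expectation Y * v)"
proof (cases "u = t")
  case True
  have "v = g 0"
    using has_bochner_integral_integral_eq[OF int] True by (simp add: incr_def[abs_def] prob_space)
  then show ?thesis
    using Y(2) True by (simp add: incr_def[abs_def] has_bochner_integral_mult_left[OF has_bochner_integral_integrable])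
next
  case False
  let ?X = "\<lambda>w. g (incr u t w)" and ?G = "{(\<lambda>w. W t w - W u w) -` B \<inter> space M | B. B \<in> sets borel}"
  have X_int: "integrable M ?X" and X_v: "expectation ?X = v"
    using int by (auto simp: has_bochner_integral_iff)
  have ind: "indep_set (sets (F u)) ?G"
    using BM ut False unfolding brownian_motion_def by (meson order_le_imp_less_or_eq)
  have A: "sigma_sets (space M) {Y -` A \<inter> space M |A. A \<in> sets borel} \<subseteq> sets (F u)"
    using sets.sigma_sets_subset[of "{Y -` A \<inter> space M |A. A \<in> sets borel}" "F u"] measurable_sets[OF Y(1)]
    by (auto simp: space_F)
  have G: "?G = sets (vimage_algebra (space M) (incr u t) borel)"
    by (subst sets_vimage_algebra2) (auto simp: incr_def[abs_def])
  have "{?X -` A \<inter> space M |A. A \<in> sets borel} \<subseteq> ?G"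
  proof clarify
    fix A :: "real set" assume "A \<in> sets borel"
    then have "g -` A \<in> sets borel" using measurable_sets_borel[OF g] by simp
    then show "\<exists>B. ?X -` A \<inter> space M = (\<lambda>w. W t w - W u w) -` B \<inter> space M \<and> B \<in> sets borel"
      by (intro exI[of _ "g -` A"]) (auto simp: incr_def)
  qed
  then have B: "sigma_sets (space M) {?X -` A \<inter> space M |A. A \<in> sets borel} \<subseteq> ?G"
    using sets.sigma_sets_subset[of "{?X -` A \<inter> space M |A. A \<in> sets borel}" "vimage_algebra (space M) (incr u t) borel"]
    unfolding G by simp
  have "indep_var borel Y borel ?X"
    unfolding indep_var_eq
  proof (intro conjI indep_setI)
    show "Y \<in> borel_measurable M" using Y(2) by simp
    show "?X \<in> borel_measurable M" using X_int by simp
    show "sigma_sets (space M) {Y -` A \<inter> space M |A. A \<in> sets borel} \<subseteq> events"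
      by (rule order.trans[OF A sets_F])
    show "sigma_sets (space M) {?X -` A \<inter> space M |A. A \<in> sets borel} \<subseteq> events"
      by (rule order.trans[OF B indep_setD_ev2[OF ind]])
    show "prob (a \<inter> b) = prob a * prob b"
      if "a \<in> sigma_sets (space M) {Y -` A \<inter> space M |A. A \<in> sets borel}"
        "b \<in> sigma_sets (space M) {?X -` A \<inter> space M |A. A \<in> sets borel}" for a b
      by (rule indep_setD[OF ind subsetD[OF A that(1)] subsetD[OF B that(2)]])
  qed
  from indep_var_integrable[OF this Y(2) X_int] indep_var_lebesgue_integral[OF this Y(2) X_int]
  show ?thesis by (simp add: has_bochner_integral_iff X_v)
qed

text \<open>
  A step process is a list of terms \<open>(a, b, A, c)\<close>, standing for \<open>c\<close> times the indicator of
  \<open>(a, b] \<times> A\<close>. The intervals of different terms may overlap in an arbitrary way, so lists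
  of terms can be concatenated without passing to a common refinement.
\<close>

type_synonym 'x step = "real \<times> real \<times> 'x set \<times> real"

text \<open>
  Stopping produces terms with empty intervals, in which \<open>A\<close> need not be known at time \<open>a\<close>.
\<close>

fun step :: "'w step \<Rightarrow> bool"
  where "step (a, b, A, c) \<longleftrightarrow> 0 \<le> a \<and> a \<le> b \<and> b \<le> T \<and> A \<in> events \<and> (a < b \<longrightarrow> A \<in> sets (F a))"

fun step_integral :: "'w step \<Rightarrow> 'w \<Rightarrow> real"
  where "step_integral (a, b, A, c) w = c * (indicator A w * incr a b w)"

fun step_value :: "'w step \<Rightarrow> 'w \<times> real \<Rightarrow> real"
  where "step_value (a, b, A, c) (w, t) = c * (indicator A w * indicator {a<..b} t)"

text \<open>
  The inner product of two terms, both in \<open>L\<^sup>2(\<Omega> \<times> [0, T])\<close> and, after integration against \<open>W\<close>, in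
  \<open>L\<^sup>2(\<Omega>)\<close>. That the two agree is the isometry.
\<close>

fun step_cov :: "'w step \<Rightarrow> 'w step \<Rightarrow> real"
  where "step_cov (a, b, A, c) (a', b', A', c') = c * c' * (prob (A \<inter> A') * max 0 (min b b' - max a a'))"

text \<open>
  Cut the increment over \<open>(a, b]\<close> at \<open>c\<close>, and both increments at \<open>min b d\<close>. In every product of two
  pieces with disjoint intervals the later one is centred and independent of all the
  other factors, so only the square of the increment over the common interval contributes.
\<close>

lemma incr_product_ordered:
  assumes ac: "a \<le> c" and I: "0 \<le> a" "a < b" "b \<le> T" "c < d" "d \<le> T"
    and A: "A \<in> sets (F a)" and B: "B \<in> sets (F c)"
  shows "has_bochner_integral M (\<lambda>w. indicator A w * incr a b w * (indicator B w * incr c d w))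
    (prob (A \<inter> B) * max 0 (min b d - max a c))"
proof -
  have AM: "A \<in> events" "B \<in> events" using A B sets_F by auto
  have AB: "A \<inter> B \<in> sets (F c)" using A B sets_F_mono[OF ac] by auto
  have zero: "has_bochner_integral M (\<lambda>w. indicator (A \<inter> B) w * incr u v w * incr v' t w) 0"
    if "0 \<le> u" "u \<le> v" "v \<le> v'" "v' \<le> t" "t \<le> T" "c \<le> v'" for u v v' t
  proof -
    have "(\<lambda>w. indicator (A \<inter> B) w * incr u v w) \<in> borel_measurable (F v')"
      using that measurable_F_mono[OF measurable_incr[of u v], of v'] sets_F_mono[of c v'] AB
      by (intro borel_measurable_times borel_measurable_indicator) auto
    moreover have "integrable M (\<lambda>w. indicator (A \<inter> B) w *\<^sub>R incr u v w)"
      using incr_moments(1)[of u v] that AM by (intro integrable_mult_indicator) (auto simp: has_bochner_integral_iff)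
    ultimately have "has_bochner_integral M (\<lambda>w. (indicator (A \<inter> B) w * incr u v w) * id (incr v' t w))
        (expectation (\<lambda>w. indicator (A \<inter> B) w * incr u v w) * 0)"
      using that incr_moments(1)[of v' t] by (intro indep_incr) auto
    then show ?thesis by simp
  qed
  show ?thesis
  proof (cases "b \<le> c")
    case True
    have "has_bochner_integral M (\<lambda>w. indicator (A \<inter> B) w * incr a b w * incr c d w) 0"
      using zero[of a b c d] True I ac by simp
    moreover have "max 0 (min b d - max a c) = 0" using True ac by auto
    ultimately show ?thesis by (simp add: indicator_inter_arith ac_simps)
  next
    case False
    define e where "e = min b d"
    have e: "c < e" "e \<le> b" "e \<le> d" "e \<le> T" using False I by (auto simp: e_def)
    have "has_bochner_integral M (\<lambda>w. indicator (A \<inter> B) w * (\<lambda>x. x\<^sup>2) (incr c e w)) (expectation (indicator (A \<inter> B)) * (e - c))"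
      using AB AM e ac I incr_moments(2)[of c e] by (intro indep_incr integrable_real_indicator) (auto simp: emeasure_eq_measure)
    then have sq: "has_bochner_integral M (\<lambda>w. indicator (A \<inter> B) w * (incr c e w)\<^sup>2) (prob (A \<inter> B) * (e - c))"
      using AM by (simp add: Int_absorb2 sets.sets_into_space)
    have "has_bochner_integral M (\<lambda>w. indicator (A \<inter> B) w * incr a c w * incr c d w
        + indicator (A \<inter> B) w * (incr c e w)\<^sup>2 + indicator (A \<inter> B) w * incr c e w * incr e d w
        + indicator (A \<inter> B) w * incr c e w * incr e b w) (0 + prob (A \<inter> B) * (e - c) + 0 + 0)"
      using e I ac by (intro has_bochner_integral_add sq zero) auto
    moreover have "indicator (A \<inter> B) w * incr a c w * incr c d w
        + indicator (A \<inter> B) w * (incr c e w)\<^sup>2 + indicator (A \<inter> B) w * incr c e w * incr e d w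
        + indicator (A \<inter> B) w * incr c e w * incr e b w
        = indicator A w * incr a b w * (indicator B w * incr c d w)" for w
    proof -
      have "e = b \<or> e = d" by (auto simp: e_def min_def)
      then show ?thesis
        by (auto simp: indicator_def incr_def power2_eq_square algebra_simps)
    qed
    moreover have "max 0 (min b d - max a c) = e - c" using e ac by (simp add: e_def)
    ultimately show ?thesis by simp
  qed
qed

lemma step_integral_cov:
  assumes x: "step x" and y: "step y"
  shows "has_bochner_integral M (\<lambda>w. step_integral x w * step_integral y w) (step_cov x y)"
proof -
  obtain a b A p where x': "x = (a, b, A, p)" by (cases x) auto
  obtain c d B q where y': "y = (c, d, B, q)" by (cases y) auto
  have "has_bochner_integral M (\<lambda>w. indicator A w * incr a b w * (indicator B w * incr c d w))
      (prob (A \<inter> B) * max 0 (min b d - max a c))"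
  proof (cases "a < b \<and> c < d")
    case True
    show ?thesis
    proof (cases "a \<le> c")
      case True
      then show ?thesis using \<open>a < b \<and> c < d\<close> x y x' y' by (intro incr_product_ordered) auto
    next
      case False
      then have "has_bochner_integral M (\<lambda>w. indicator B w * incr c d w * (indicator A w * incr a b w))
          (prob (B \<inter> A) * max 0 (min d b - max c a))"
        using \<open>a < b \<and> c < d\<close> x y x' y' by (intro incr_product_ordered) auto
      then show ?thesis by (simp add: ac_simps min.commute max.commute Int_commute)
    qed
  next
    case False
    then have "a = b \<or> c = d" using x y x' y' by auto
    then have "(\<lambda>w. indicator A w * incr a b w * (indicator B w * incr c d w)) = (\<lambda>w. 0)"
      "max 0 (min b d - max a c) = 0"
      using x y x' y' by (auto simp: incr_def)
    then show ?thesis by (simp add: has_bochner_integral_zero)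
  qed
  from has_bochner_integral_mult_right[OF this, of "p * q"] show ?thesis
    by (simp add: x' y' ac_simps)
qed

lemma step_value_cov:
  assumes x: "step x" and y: "step y"
  shows "has_bochner_integral (M \<Otimes>\<^sub>M lborel) (\<lambda>z. step_value x z * step_value y z) (step_cov x y)"
proof -
  obtain a b A p where x': "x = (a, b, A, p)" by (cases x) auto
  obtain c d B q where y': "y = (c, d, B, q)" by (cases y) auto
  let ?I = "{max a c<..min b d}"
  have AB: "A \<inter> B \<in> events" using x y x' y' by auto
  have "emeasure (M \<Otimes>\<^sub>M lborel) ((A \<inter> B) \<times> ?I) = emeasure M (A \<inter> B) * emeasure lborel ?I"
    using AB by (intro lborel.emeasure_pair_measure_Times) auto
  also have "emeasure lborel ?I = ennreal (max 0 (min b d - max a c))"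
  proof (cases "max a c \<le> min b d")
    case False
    then have "?I = {}" and "min b d - max a c \<le> 0" by auto
    then show ?thesis by (simp only: max_absorb1 emeasure_empty ennreal_0)
  qed simp
  also have "emeasure M (A \<inter> B) * \<dots> = ennreal (prob (A \<inter> B) * max 0 (min b d - max a c))"
    by (simp add: emeasure_eq_measure ennreal_mult)
  finally have em: "emeasure (M \<Otimes>\<^sub>M lborel) ((A \<inter> B) \<times> ?I) = ennreal (prob (A \<inter> B) * max 0 (min b d - max a c))" .
  have "has_bochner_integral (M \<Otimes>\<^sub>M lborel) (indicator ((A \<inter> B) \<times> ?I)) (measure (M \<Otimes>\<^sub>M lborel) ((A \<inter> B) \<times> ?I))"
    using AB em by (intro has_bochner_integral_real_indicator) auto
  then have "has_bochner_integral (M \<Otimes>\<^sub>M lborel) (indicator ((A \<inter> B) \<times> ?I)) (prob (A \<inter> B) * max 0 (min b d - max a c))"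
    by (simp add: measure_def em)
  from has_bochner_integral_mult_right[OF this, of "p * q"]
  have "has_bochner_integral (M \<Otimes>\<^sub>M lborel) (\<lambda>z. p * q * indicator ((A \<inter> B) \<times> ?I) z) (step_cov x y)"
    by (simp add: x' y')
  moreover have "p * q * indicator ((A \<inter> B) \<times> ?I) z = step_value x z * step_value y z" for z
    by (cases z) (auto simp: x' y' indicator_def)
  ultimately show ?thesis by simp
qed

lemma has_bochner_integral_sum_list_product:
  fixes f g :: "'a \<Rightarrow> 'b \<Rightarrow> real"
  assumes "\<And>x y. x \<in> set xs \<Longrightarrow> y \<in> set ys \<Longrightarrow> has_bochner_integral N (\<lambda>w. f x w * g y w) (\<kappa> x y)"
  shows "has_bochner_integral N (\<lambda>w. (\<Sum>x\<leftarrow>xs. f x w) * (\<Sum>y\<leftarrow>ys. g y w)) (\<Sum>x\<leftarrow>xs. \<Sum>y\<leftarrow>ys. \<kappa> x y)"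
  using assms
proof (induction xs)
  case (Cons x xs)
  have "has_bochner_integral N (\<lambda>w. f x w * (\<Sum>y\<leftarrow>zs. g y w)) (\<Sum>y\<leftarrow>zs. \<kappa> x y)" if "set zs \<subseteq> set ys" for zs
    using that
  proof (induction zs)
    case (Cons z zs)
    then have "has_bochner_integral N (\<lambda>w. f x w * g z w + f x w * (\<Sum>y\<leftarrow>zs. g y w)) (\<kappa> x z + (\<Sum>y\<leftarrow>zs. \<kappa> x y))"
      using Cons.prems assms \<open>\<And>x' y. x' \<in> set (x # xs) \<Longrightarrow> y \<in> set ys \<Longrightarrow> has_bochner_integral N (\<lambda>w. f x' w * g y w) (\<kappa> x' y)\<close>
      by (intro has_bochner_integral_add) auto
    then show ?case by (simp add: distrib_left)
  qed (simp add: has_bochner_integral_zero)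
  from has_bochner_integral_add[OF this[OF order.refl] Cons.IH] Cons.prems show ?case
    by (simp add: distrib_right)
qed (simp add: has_bochner_integral_zero)

definition steps_integral :: "'w step list \<Rightarrow> 'w \<Rightarrow> real"
  where "steps_integral xs w = (\<Sum>x\<leftarrow>xs. step_integral x w)"

definition steps_value :: "'w step list \<Rightarrow> 'w \<times> real \<Rightarrow> real"
  where "steps_value xs z = (\<Sum>x\<leftarrow>xs. step_value x z)"

lemma Ito_isometry:
  assumes "\<And>x. x \<in> set xs \<Longrightarrow> step x"
  shows "(\<integral>\<^sup>+w. ennreal ((steps_integral xs w)\<^sup>2) \<partial>M) = (\<integral>\<^sup>+z. ennreal ((steps_value xs z)\<^sup>2) \<partial>(M \<Otimes>\<^sub>M lborel))"
    and "(\<integral>\<^sup>+z. ennreal ((steps_value xs z)\<^sup>2) \<partial>(M \<Otimes>\<^sub>M lborel)) < \<infinity>"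
proof -
  have i: "has_bochner_integral M (\<lambda>w. (steps_integral xs w)\<^sup>2) (\<Sum>x\<leftarrow>xs. \<Sum>y\<leftarrow>xs. step_cov x y)"
    unfolding power2_eq_square steps_integral_def
    by (intro has_bochner_integral_sum_list_product step_integral_cov assms)
  have v: "has_bochner_integral (M \<Otimes>\<^sub>M lborel) (\<lambda>z. (steps_value xs z)\<^sup>2) (\<Sum>x\<leftarrow>xs. \<Sum>y\<leftarrow>xs. step_cov x y)"
    unfolding power2_eq_square steps_value_def
    by (intro has_bochner_integral_sum_list_product step_value_cov assms)
  show "(\<integral>\<^sup>+w. ennreal ((steps_integral xs w)\<^sup>2) \<partial>M) = (\<integral>\<^sup>+z. ennreal ((steps_value xs z)\<^sup>2) \<partial>(M \<Otimes>\<^sub>M lborel))"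
    and "(\<integral>\<^sup>+z. ennreal ((steps_value xs z)\<^sup>2) \<partial>(M \<Otimes>\<^sub>M lborel)) < \<infinity>"
    using i v by (auto simp: has_bochner_integral_iff nn_integral_eq_integral)
qed

section \<open>Stopping a step process\<close>

text \<open>
  For \<open>a \<le> b\<close> the interval \<open>(clip a b u, clip a b v]\<close> is the intersection of \<open>(a, b]\<close> and \<open>(u, v]\<close>.
\<close>

definition clip :: "real \<Rightarrow> real \<Rightarrow> real \<Rightarrow> real"
  where "clip a b u = max a (min b u)"

fun stop_step :: "('w \<Rightarrow> real) \<Rightarrow> real \<Rightarrow> real \<Rightarrow> 'w step \<Rightarrow> 'w step"
  where "stop_step \<rho> u v (a, b, A, c) = (clip a b u, clip a b v, A \<inter> {w \<in> space M. u < \<rho> w}, c)"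

fun step_integral_upto :: "real \<Rightarrow> 'w step \<Rightarrow> 'w \<Rightarrow> real"
  where "step_integral_upto t (a, b, A, c) w = c * (indicator A w * incr (min t a) (min t b) w)"

definition steps_integral_upto :: "real \<Rightarrow> 'w step list \<Rightarrow> 'w \<Rightarrow> real"
  where "steps_integral_upto t xs w = (\<Sum>x\<leftarrow>xs. step_integral_upto t x w)"

lemma step_stop_step:
  assumes \<rho>: "stopping_time F \<rho>" and x: "step x" and uv: "u \<le> v"
  shows "step (stop_step \<rho> u v x)"
proof -
  obtain a b A c where x': "x = (a, b, A, c)" by (cases x) auto
  have I: "0 \<le> a" "a \<le> b" "b \<le> T" "A \<in> events" "a < b \<Longrightarrow> A \<in> sets (F a)" using x by (auto simp: x')
  have R: "{w \<in> space M. u < \<rho> w} \<in> sets (F u)"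
    using stopping_timeD2[OF \<rho>, of u] by (simp add: pred_def space_F)
  have "A \<inter> {w \<in> space M. u < \<rho> w} \<in> sets (F (clip a b u))" if lt: "clip a b u < clip a b v"
  proof -
    have "a < b" "a \<le> clip a b u" "u \<le> clip a b u" using lt I by (auto simp: clip_def)
    then show ?thesis
      using R I(5) sets_F_mono[of a "clip a b u"] sets_F_mono[of u "clip a b u"] by auto
  qed
  moreover have "0 \<le> clip a b u" "clip a b u \<le> clip a b v" "clip a b v \<le> T"
    using I uv by (auto simp: clip_def)
  moreover have "A \<inter> {w \<in> space M. u < \<rho> w} \<in> events" using I(4) R sets_F by blast
  ultimately show ?thesis by (simp add: x')
qed

lemma step_value_stop_step:
  assumes "step x" "w \<in> space M"
  shows "step_value (stop_step \<rho> u v x) (w, t) = step_value x (w, t) * (indicator {w. u < \<rho> w} w * indicator {u<..v} t)"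
proof -
  obtain a b A c where x': "x = (a, b, A, c)" by (cases x) auto
  have "a \<le> b" using assms(1) by (simp add: x')
  then have "t \<in> {clip a b u<..clip a b v} \<longleftrightarrow> t \<in> {a<..b} \<and> t \<in> {u<..v}"
    by (auto simp: clip_def)
  then show ?thesis using assms(2) by (auto simp: x' indicator_def)
qed

text \<open>
  Restricting the step process to \<open>(0, t]\<close> and stopping it at the first point not before \<open>\<rho>\<close> of a
  grid of mesh \<open>t/m\<close> gives a step process again. On \<open>{t \<le> \<rho>}\<close> nothing has been stopped,
  so the integral up to \<open>t\<close> is unchanged, while the isometry bounds it by the
  values of the process before time \<open>\<rho> + t/m\<close>.
\<close>

lemma stopped_integral_bound:
  assumes \<rho>: "stopping_time F \<rho>" and xs: "\<And>x. x \<in> set xs \<Longrightarrow> step x"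
    and t: "0 \<le> t" "t \<le> T" and m: "m > 0"
  shows "(\<integral>\<^sup>+w. indicator {w. t \<le> \<rho> w} w * ennreal ((steps_integral_upto t xs w)\<^sup>2) \<partial>M)
    \<le> (\<integral>\<^sup>+z. indicator {z. 0 < snd z \<and> snd z \<le> T \<and> snd z < \<rho> (fst z) + t / real m} z * ennreal ((steps_value xs z)\<^sup>2) \<partial>(M \<Otimes>\<^sub>M lborel))"
proof -
  define s where "s j = t * real j / real m" for j
  have s_mono: "s j \<le> s k" if "j \<le> k" for j k
    using that t by (simp add: s_def divide_right_mono mult_left_mono)
  have s0: "s 0 = 0" and sm: "s m = t" using m by (auto simp: s_def)
  have s_Suc: "s (Suc j) = s j + t / real m" for j by (simp add: s_def distrib_left add_divide_distrib)
  have s_ge0: "0 \<le> s j" for j using t by (simp add: s_def)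
  define ys where "ys = concat (map (\<lambda>x. map (\<lambda>j. stop_step \<rho> (s j) (s (Suc j)) x) [0..<m]) xs)"
  have ys: "step y" if "y \<in> set ys" for y
    using that xs by (auto simp: ys_def intro!: step_stop_step[OF \<rho>] s_mono)
  have sum_ys: "(\<Sum>y\<leftarrow>ys. h y) = (\<Sum>x\<leftarrow>xs. \<Sum>j<m. h (stop_step \<rho> (s j) (s (Suc j)) x))" for h :: "'w step \<Rightarrow> real"
  proof -
    have "(\<Sum>y\<leftarrow>concat (map (\<lambda>x. map (\<lambda>j. f x j) [0..<m]) xs). h y) = (\<Sum>x\<leftarrow>xs. \<Sum>j<m. h (f x j))" for f
      by (induction xs) (auto simp: o_def interv_sum_list_conv_sum_set_nat lessThan_atLeast0)
    then show ?thesis unfolding ys_def .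
  qed
  \<comment> \<open>The stopping acts on the process as multiplication by \<open>Y\<close>.\<close>
  define Y where "Y z = (\<Sum>j<m. indicator {w. s j < \<rho> w} (fst z) * indicator {s j<..s (Suc j)} (snd z) :: real)" for z
  have steps_value_ys: "steps_value ys z = steps_value xs z * Y z" if z: "z \<in> space (M \<Otimes>\<^sub>M lborel)" for z
  proof -
    have "steps_value ys z = (\<Sum>x\<leftarrow>xs. \<Sum>j<m. step_value x z * (indicator {w. s j < \<rho> w} (fst z) * indicator {s j<..s (Suc j)} (snd z)))"
      unfolding steps_value_def sum_ys using z xs
      by (intro arg_cong[where f = sum_list] map_cong refl sum.cong)
        (cases z, simp add: step_value_stop_step space_pair_measure)
    then show ?thesis
      by (simp add: steps_value_def Y_def sum_distrib_left[symmetric] sum_list_mult_const)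
  qed
  have Y_bound: "\<bar>Y z\<bar> \<le> indicator {z. 0 < snd z \<and> snd z \<le> T \<and> snd z < \<rho> (fst z) + t / real m} z" for z
  proof (cases "\<exists>i<m. snd z \<in> {s i<..s (Suc i)}")
    case True
    then obtain i where i: "i < m" "snd z \<in> {s i<..s (Suc i)}" by blast
    have "indicator {s j<..s (Suc j)} (snd z) = (0::real)" if "j \<noteq> i" for j
      using i(2) that s_mono[of "Suc j" i] s_mono[of "Suc i" j] by (cases j i rule: linorder_cases) (auto simp: indicator_def)
    then have "Y z = (\<Sum>j<m. if j = i then indicator {w. s i < \<rho> w} (fst z) else 0)"
      unfolding Y_def using i(2) by (intro sum.cong) auto
    then have "Y z = indicator {w. s i < \<rho> w} (fst z)" using i(1) by simp
    moreover have "0 < snd z" "snd z \<le> T"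
      using i s_ge0[of i] s_mono[of "Suc i" m] t by (auto simp: sm)
    moreover have "snd z \<le> s i + t / real m" using i(2) by (simp add: s_Suc)
    ultimately show ?thesis by (auto simp: indicator_def)
  next
    case False
    then have "Y z = 0" unfolding Y_def by (intro sum.neutral) (auto simp: indicator_def)
    then show ?thesis by simp
  qed
  have integral: "steps_integral ys w = steps_integral_upto t xs w" if w: "w \<in> space M" "t \<le> \<rho> w" for w
  proof -
    have "(\<Sum>j<m. step_integral (stop_step \<rho> (s j) (s (Suc j)) x) w) = step_integral_upto t x w" if x: "x \<in> set xs" for x
    proof -
      obtain a b A c where x': "x = (a, b, A, c)" by (cases x) auto
      have ab: "0 \<le> a" "a \<le> b" using xs[OF x] by (auto simp: x')
      let ?W = "\<lambda>u. W (clip a b u) w"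
      have "step_integral (stop_step \<rho> (s j) (s (Suc j)) x) w = c * indicator A w * (?W (s (Suc j)) - ?W (s j))" if j: "j < m" for j
      proof (cases "s j < s (Suc j)")
        case True
        then have "s j < \<rho> w" using w s_mono[of "Suc j" m] j by (auto simp: sm)
        then show ?thesis using w by (simp add: x' incr_def indicator_def)
      next
        case False
        then have "s j = s (Suc j)" using s_mono[of j "Suc j"] by simp
        then show ?thesis by (simp add: x' incr_def)
      qed
      then have "(\<Sum>j<m. step_integral (stop_step \<rho> (s j) (s (Suc j)) x) w) = c * indicator A w * (\<Sum>j<m. ?W (s (Suc j)) - ?W (s j))"
        by (simp add: sum_distrib_left)
      also have "(\<Sum>j<m. ?W (s (Suc j)) - ?W (s j)) = ?W t - ?W 0"
        by (subst sum_lessThan_telescope) (simp add: s0 sm)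
      also have "\<dots> = incr (min t a) (min t b) w"
      proof -
        have "clip a b 0 = a" using ab by (simp add: clip_def)
        moreover have "clip a b t = a \<and> min t a = t \<and> min t b = t" if "t \<le> a"
          using that ab by (simp add: clip_def)
        moreover have "clip a b t = min t b \<and> min t a = a" if "a \<le> t"
          using that ab by (simp add: clip_def min.commute)
        ultimately show ?thesis by (cases "t \<le> a") (auto simp: incr_def)
      qed
      finally show ?thesis by (simp add: x' mult.assoc)
    qed
    then show ?thesis
      unfolding steps_integral_def steps_integral_upto_def sum_ys
      by (intro arg_cong[where f = sum_list] map_cong refl) auto
  qed
  have "(\<integral>\<^sup>+w. indicator {w. t \<le> \<rho> w} w * ennreal ((steps_integral_upto t xs w)\<^sup>2) \<partial>M)
      \<le> (\<integral>\<^sup>+w. ennreal ((steps_integral ys w)\<^sup>2) \<partial>M)"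
    using integral by (intro nn_integral_mono) (auto simp: indicator_def)
  also have "\<dots> = (\<integral>\<^sup>+z. ennreal ((steps_value ys z)\<^sup>2) \<partial>(M \<Otimes>\<^sub>M lborel))"
    using ys by (rule Ito_isometry(1))
  also have "\<dots> \<le> (\<integral>\<^sup>+z. indicator {z. 0 < snd z \<and> snd z \<le> T \<and> snd z < \<rho> (fst z) + t / real m} z * ennreal ((steps_value xs z)\<^sup>2) \<partial>(M \<Otimes>\<^sub>M lborel))"
  proof (rule nn_integral_mono)
    fix z :: "'w \<times> real" assume z: "z \<in> space (M \<Otimes>\<^sub>M lborel)"
    let ?S = "{z. 0 < snd z \<and> snd z \<le> T \<and> snd z < \<rho> (fst z) + t / real m}"
    have "(steps_value ys z)\<^sup>2 = (steps_value xs z)\<^sup>2 * \<bar>Y z\<bar>\<^sup>2"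
      by (simp add: steps_value_ys[OF z] power_mult_distrib)
    also have "\<dots> \<le> (steps_value xs z)\<^sup>2 * (indicator ?S z)\<^sup>2"
      by (intro mult_left_mono power_mono Y_bound) auto
    finally show "ennreal ((steps_value ys z)\<^sup>2) \<le> indicator ?S z * ennreal ((steps_value xs z)\<^sup>2)"
      by (auto simp: indicator_def ennreal_leI split: if_splits)
  qed
  finally show ?thesis .
qed

end

section \<open>Uniqueness of scalar stochastic integrals\<close>

lemma strongly_measurable_real:
  fixes f :: "'a \<Rightarrow> real"
  assumes "strongly_measurable M UNIV abs f"
  shows "f \<in> borel_measurable M"
proof -
  obtain u where u: "\<forall>n. simple_function M (u n) \<and> u n ` space M \<subseteq> UNIV"
      "\<forall>w\<in>space M. (\<lambda>n. \<bar>u n w - f w\<bar>) \<longlonglongrightarrow> 0"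
    using assms unfolding strongly_measurable_def by (elim exE conjE)
  show ?thesis
  proof (rule borel_measurable_LIMSEQ_real)
    show "u n \<in> borel_measurable M" for n using u(1) by (simp add: borel_measurable_simple_function)
    show "(\<lambda>n. u n w) \<longlonglongrightarrow> f w" if "w \<in> space M" for w
      using u(2) that by (intro LIM_zero_cancel[of _ "f w"]) (simp add: tendsto_rabs_zero_iff)
  qed
qed

lemma paths_real_continuous: "g \<in> paths T UNIV abs \<Longrightarrow> continuous_on {0..T} g" for g :: "real \<Rightarrow> real"
  unfolding paths_def continuous_on_def by (auto intro: LIM_zero_cancel simp: tendsto_rabs_zero_iff)

lemma abs_le_path_norm:
  fixes g :: "real \<Rightarrow> real"
  assumes "continuous_on {0..T} g" "t \<in> {0..T}"
  shows "\<bar>g t\<bar> \<le> path_norm T abs g"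
proof -
  have "compact ((\<lambda>t. \<bar>g t\<bar>) ` {0..T})"
    by (intro compact_continuous_image continuous_intros assms(1)) auto
  then have "bdd_above ((\<lambda>t. \<bar>g t\<bar>) ` {0..T})"
    by (intro bounded_imp_bdd_above compact_imp_bounded)
  then show ?thesis unfolding path_norm_def using assms(2) by (intro cSUP_upper)
qed

lemma measurable_path_eval:
  fixes I :: "real \<Rightarrow> 'w \<Rightarrow> real"
  assumes I: "strongly_measurable M (paths T UNIV abs) (path_norm T abs) (\<lambda>w t. I t w)" and t: "t \<in> {0..T}"
  shows "I t \<in> borel_measurable M"
proof -
  obtain u where u: "\<forall>n. simple_function M (u n) \<and> u n ` space M \<subseteq> paths T UNIV abs"
      "\<forall>w\<in>space M. (\<lambda>n. path_norm T abs (u n w - (\<lambda>t. I t w))) \<longlonglongrightarrow> 0"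
    using I unfolding strongly_measurable_def by (elim exE conjE)
  show ?thesis
  proof (rule borel_measurable_LIMSEQ_real)
    show "(\<lambda>w. u n w t) \<in> borel_measurable M" for n
      using u(1) by (intro borel_measurable_simple_function simple_function_compose1[of M "u n" "\<lambda>g. g t"]) blast
    fix w assume w: "w \<in> space M"
    have "continuous_on {0..T} (\<lambda>t. I t w)"
      using I w by (intro paths_real_continuous) (auto simp: strongly_measurable_def)
    moreover have "continuous_on {0..T} (u n w)" for n
      using u(1) w by (intro paths_real_continuous) (auto simp: image_subset_iff)
    ultimately have "\<bar>(u n w - (\<lambda>t. I t w)) t\<bar> \<le> path_norm T abs (u n w - (\<lambda>t. I t w))" for n
      by (intro abs_le_path_norm t) (simp add: fun_diff_def continuous_on_diff)
    then have "(\<lambda>n. u n w t - I t w) \<longlonglongrightarrow> 0"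
      by (intro Lim_null_comparison[OF _ u(2)[rule_format, OF w]] always_eventually) simp
    then show "(\<lambda>n. u n w t) \<longlonglongrightarrow> I t w" by (rule LIM_zero_cancel)
  qed
qed

lemma tendsto_0_ennreal_le:
  fixes f g :: "'a \<Rightarrow> ennreal"
  assumes "(g \<longlongrightarrow> 0) F" "\<And>n. f n \<le> g n"
  shows "(f \<longlongrightarrow> 0) F"
  by (rule tendsto_sandwich[OF _ _ tendsto_const assms(1)]) (use assms(2) in auto)

lemma nn_integral_square_sum3:
  fixes f g k :: "'a \<Rightarrow> real"
  assumes "f \<in> borel_measurable M" "g \<in> borel_measurable M" "k \<in> borel_measurable M"
  shows "(\<integral>\<^sup>+x. ennreal ((f x + g x + k x)\<^sup>2) \<partial>M)
    \<le> 3 * ((\<integral>\<^sup>+x. ennreal ((f x)\<^sup>2) \<partial>M) + (\<integral>\<^sup>+x. ennreal ((g x)\<^sup>2) \<partial>M) + (\<integral>\<^sup>+x. ennreal ((k x)\<^sup>2) \<partial>M))"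
proof -
  have "(a + b + c)\<^sup>2 \<le> 3 * (a\<^sup>2 + b\<^sup>2 + c\<^sup>2)" for a b c :: real
  proof -
    have "0 \<le> (a - b)\<^sup>2 + (b - c)\<^sup>2 + (a - c)\<^sup>2" by simp
    then show ?thesis by (simp add: power2_eq_square algebra_simps)
  qed
  then have "(\<integral>\<^sup>+x. ennreal ((f x + g x + k x)\<^sup>2) \<partial>M) \<le> (\<integral>\<^sup>+x. ennreal (3 * ((f x)\<^sup>2 + (g x)\<^sup>2 + (k x)\<^sup>2)) \<partial>M)"
    by (intro nn_integral_mono ennreal_leI)
  also have "\<dots> = (\<integral>\<^sup>+x. 3 * (ennreal ((f x)\<^sup>2) + ennreal ((g x)\<^sup>2) + ennreal ((k x)\<^sup>2)) \<partial>M)"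
    by (simp add: ennreal_mult)
  also have "\<dots> = 3 * ((\<integral>\<^sup>+x. ennreal ((f x)\<^sup>2) \<partial>M) + (\<integral>\<^sup>+x. ennreal ((g x)\<^sup>2) \<partial>M) + (\<integral>\<^sup>+x. ennreal ((k x)\<^sup>2) \<partial>M))"
    using assms by (simp add: nn_integral_cmult nn_integral_add)
  finally show ?thesis .
qed

context brownian
begin

definition elem_steps :: "('w, real) elem_data \<Rightarrow> 'w step list"
  where "elem_steps D = concat (map (\<lambda>n. map (\<lambda>m. (el_t D (n - 1), el_t D n, el_A D m n, el_f D m n)) [1..<Suc (el_M D)]) [1..<Suc (el_N D)])"

lemma sum_list_elem_steps:
  fixes h :: "'w step \<Rightarrow> real"
  shows "(\<Sum>x\<leftarrow>elem_steps D. h x) = (\<Sum>n=1..el_N D. \<Sum>m=1..el_M D. h (el_t D (n - 1), el_t D n, el_A D m n, el_f D m n))"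
proof -
  have "(\<Sum>y\<leftarrow>concat (map (\<lambda>n. map (\<lambda>m. f n m) [1..<Suc k]) ns). h y) = (\<Sum>n\<leftarrow>ns. \<Sum>m=1..k. h (f n m))" for f k and ns :: "nat list"
    by (induction ns) (auto simp: o_def interv_sum_list_conv_sum_set_nat atLeastLessThanSuc_atLeastAtMost simp del: upt_Suc)
  then show ?thesis
    unfolding elem_steps_def
    by (simp add: interv_sum_list_conv_sum_set_nat atLeastLessThanSuc_atLeastAtMost del: upt_Suc)
qed

lemma step_elem_steps:
  assumes D: "elementary F T UNIV D" and x: "x \<in> set (elem_steps D)"
  shows "step x"
proof -
  let ?t = "el_t D"
  have mono: "?t i \<le> ?t j" if "i \<le> j" "j \<le> el_N D" for i j
    using that
  proof (induction j rule: dec_induct)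
    case (step j)
    have "\<forall>n\<in>{1..el_N D}. ?t (n - 1) < ?t n" using D by (simp add: elementary_def)
    from bspec[OF this, of "Suc j"] have "?t j < ?t (Suc j)" using step.prems by simp
    then show ?case using step by simp
  qed simp
  have "\<exists>n\<in>{1..el_N D}. \<exists>m\<in>{1..el_M D}. x = (?t (n - 1), ?t n, el_A D m n, el_f D m n)"
    using x by (fastforce simp: elem_steps_def less_Suc_eq_le simp del: upt_Suc)
  then obtain n m where nm: "n \<in> {1..el_N D}" "m \<in> {1..el_M D}" "x = (?t (n - 1), ?t n, el_A D m n, el_f D m n)"
    by blast
  have "el_A D m n \<in> sets (F (?t (n - 1)))" "?t 0 = 0" "?t (el_N D) = T" "?t (n - 1) < ?t n"
    using D nm by (auto simp: elementary_def)
  then show ?thesis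
    using mono[of 0 "n - 1"] mono[of n "el_N D"] nm sets_F[of "?t (n - 1)"] by auto
qed

lemma elem_process_steps: "elem_process D t w = steps_value (elem_steps D) (w, t)"
  unfolding steps_value_def sum_list_elem_steps elem_process_def by (simp add: ac_simps)

lemma elem_integral_steps: "elem_integral W D t w = steps_integral_upto t (elem_steps D) w"
  unfolding steps_integral_upto_def sum_list_elem_steps elem_integral_def by (simp add: incr_def ac_simps)

fun neg_step :: "'w step \<Rightarrow> 'w step"
  where "neg_step (a, b, A, c) = (a, b, A, - c)"

lemma step_neg_step: "step x \<Longrightarrow> step (neg_step x)"
  by (cases x) auto

lemma steps_value_diff: "steps_value (xs @ map neg_step ys) z = steps_value xs z - steps_value ys z"
proof -
  have "step_value (neg_step y) z = - step_value y z" for y by (cases y; cases z) auto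
  then have "(\<Sum>y\<leftarrow>ys. step_value (neg_step y) z) = - (\<Sum>y\<leftarrow>ys. step_value y z)"
    by (induction ys) auto
  then show ?thesis by (simp add: steps_value_def o_def)
qed

lemma steps_integral_upto_diff:
  "steps_integral_upto t (xs @ map neg_step ys) w = steps_integral_upto t xs w - steps_integral_upto t ys w"
proof -
  have "step_integral_upto t (neg_step y) w = - step_integral_upto t y w" for y by (cases y) auto
  then have "(\<Sum>y\<leftarrow>ys. step_integral_upto t (neg_step y) w) = - (\<Sum>y\<leftarrow>ys. step_integral_upto t y w)"
    by (induction ys) auto
  then show ?thesis by (simp add: steps_integral_upto_def o_def)
qed

lemma measurable_steps_value:
  "(\<And>x. x \<in> set xs \<Longrightarrow> step x) \<Longrightarrow> steps_value xs \<in> borel_measurable (M \<Otimes>\<^sub>M lborel)"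
proof (induction xs)
  case (Cons x xs)
  obtain a b A c where x: "x = (a, b, A, c)" by (cases x) auto
  have [measurable]: "A \<in> events" using Cons.prems[of x] by (simp add: x)
  have "(\<lambda>z. c * (indicator A (fst z) * indicator {a<..b} (snd z)) :: real) \<in> borel_measurable (M \<Otimes>\<^sub>M lborel)"
    by measurable
  moreover have "step_value x = (\<lambda>z. c * (indicator A (fst z) * indicator {a<..b} (snd z)))"
    by (rule ext, case_tac z) (simp add: x)
  ultimately show ?case
    using Cons by (simp add: steps_value_def[abs_def] borel_measurable_add)
qed (simp add: steps_value_def[abs_def])

lemma measurable_steps_integral_upto:
  assumes t: "t \<in> {0..T}"
  shows "(\<And>x. x \<in> set xs \<Longrightarrow> step x) \<Longrightarrow> steps_integral_upto t xs \<in> borel_measurable M"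
proof (induction xs)
  case (Cons x xs)
  obtain a b A c where x: "x = (a, b, A, c)" by (cases x) auto
  have ab: "A \<in> events" "0 \<le> a" "a \<le> b" "b \<le> T" using Cons.prems[of x] by (auto simp: x)
  have "incr (min t a) (min t b) \<in> borel_measurable M"
    using t ab by (intro measurable_F[OF measurable_incr]) auto
  then have "step_integral_upto t x \<in> borel_measurable M"
    using ab by (simp add: x step_integral_upto.simps[abs_def] borel_measurable_times)
  then show ?case
    using Cons by (simp add: steps_integral_upto_def[abs_def] borel_measurable_add)
qed (simp add: steps_integral_upto_def[abs_def])

lemma steps_value_outside:
  assumes "\<And>x. x \<in> set xs \<Longrightarrow> step x" "t \<notin> {0<..T}"
  shows "steps_value xs (w, t) = 0"
  using assms
proof (induction xs)
  case (Cons x xs)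
  obtain a b A c where x: "x = (a, b, A, c)" by (cases x) auto
  have "0 \<le> a" "b \<le> T" using Cons.prems(1)[of x] by (auto simp: x)
  then have "step_value x (w, t) = 0" using Cons.prems(2) by (auto simp: x indicator_def)
  then show ?case using Cons by (simp add: steps_value_def)
qed (simp add: steps_value_def)

text \<open>The integrand on the product space, without time \<open>0\<close>, where all step processes vanish.\<close>

definition joint :: "(real \<Rightarrow> 'w \<Rightarrow> real) \<Rightarrow> 'w \<times> real \<Rightarrow> real"
  where "joint h z = indicator {0<..T} (snd z) * h (snd z) (fst z)"

lemma measurable_joint:
  assumes "adapted_process M F T UNIV abs h"
  shows "joint h \<in> borel_measurable (M \<Otimes>\<^sub>M lborel)"
proof -
  have h: "(\<lambda>(t, w). h t w) \<in> borel_measurable (restrict_space borel {0..T} \<Otimes>\<^sub>M M)"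
    using assms by (intro strongly_measurable_real) (simp add: adapted_process_def)
  let ?p = "\<lambda>z::'w \<times> real. (if snd z \<in> {0..T} then snd z else 0, fst z)"
  have "?p \<in> measurable (M \<Otimes>\<^sub>M lborel) (restrict_space borel {0..T} \<Otimes>\<^sub>M M)"
  proof (intro measurable_Pair measurable_restrict_space2)
    show "(\<lambda>z. if snd z \<in> {0..T} then snd z else 0) \<in> measurable (M \<Otimes>\<^sub>M lborel) borel" by measurable
  qed (use T in auto)
  from measurable_compose[OF this h]
  have "(\<lambda>z. (\<lambda>(t, w). h t w) (?p z)) \<in> borel_measurable (M \<Otimes>\<^sub>M lborel)" .
  moreover have "(\<lambda>z. indicator {0<..T} (snd z) :: real) \<in> borel_measurable (M \<Otimes>\<^sub>M lborel)"
    by measurable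
  ultimately have "(\<lambda>z. indicator {0<..T} (snd z) * (\<lambda>(t, w). h t w) (?p z)) \<in> borel_measurable (M \<Otimes>\<^sub>M lborel)"
    by (rule borel_measurable_times[rotated])
  moreover have "indicator {0<..T} (snd z) * (\<lambda>(t, w). h t w) (?p z) = joint h z" for z
    by (auto simp: joint_def indicator_def)
  ultimately show ?thesis by simp
qed

lemma stoch_integral_approx:
  assumes h: "has_L2_stoch_integral M F T W UNIV abs h I" and t: "t \<in> {0..T}"
  shows "\<exists>xs. (\<forall>n. \<forall>x\<in>set (xs n). step x)
    \<and> (\<lambda>n. \<integral>\<^sup>+z. ennreal ((steps_value (xs n) z - joint h z)\<^sup>2) \<partial>(M \<Otimes>\<^sub>M lborel)) \<longlonglongrightarrow> 0
    \<and> (\<lambda>n. \<integral>\<^sup>+w. ennreal ((steps_integral_upto t (xs n) w - I t w)\<^sup>2) \<partial>M) \<longlonglongrightarrow> 0"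
proof -
  have ad: "adapted_process M F T UNIV abs h" using h by (simp add: has_L2_stoch_integral_def)
  obtain D where D: "\<And>n. elementary F T UNIV (D n)"
    and conv: "\<And>\<xi>. \<xi> \<in> cont_dual UNIV abs \<Longrightarrow>
      (\<lambda>n. \<integral>\<^sup>+w. (\<integral>\<^sup>+t\<in>{0..T}. ennreal ((\<xi> (elem_process (D n) t w) - \<xi> (h t w))\<^sup>2) \<partial>lborel) \<partial>M) \<longlonglongrightarrow> 0"
    and sup: "(\<lambda>n. \<integral>\<^sup>+w. (SUP t\<in>{0..T}. ennreal (\<bar>elem_integral W (D n) t w - I t w\<bar>\<^sup>2)) \<partial>M) \<longlonglongrightarrow> 0"
    using h unfolding has_L2_stoch_integral_def by blast
  let ?xs = "\<lambda>n. elem_steps (D n)"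
  have steps: "step x" if "x \<in> set (?xs n)" for n x
    using step_elem_steps[OF D that] .
  have id: "(\<lambda>x. x) \<in> cont_dual UNIV (abs :: real \<Rightarrow> real)"
    by (auto simp: cont_dual_def intro: exI[of _ 1])
  show ?thesis
  proof (intro exI[of _ ?xs] conjI allI ballI)
    show "step x" if "x \<in> set (?xs n)" for n x using steps that .
    show "(\<lambda>n. \<integral>\<^sup>+z. ennreal ((steps_value (?xs n) z - joint h z)\<^sup>2) \<partial>(M \<Otimes>\<^sub>M lborel)) \<longlonglongrightarrow> 0"
    proof (rule tendsto_0_ennreal_le[OF conv[OF id]])
      show "(\<integral>\<^sup>+z. ennreal ((steps_value (?xs n) z - joint h z)\<^sup>2) \<partial>(M \<Otimes>\<^sub>M lborel))
          \<le> (\<integral>\<^sup>+w. (\<integral>\<^sup>+t\<in>{0..T}. ennreal ((elem_process (D n) t w - h t w)\<^sup>2) \<partial>lborel) \<partial>M)" for n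
      proof -
        have "(\<lambda>z. ennreal ((steps_value (?xs n) z - joint h z)\<^sup>2)) \<in> borel_measurable (M \<Otimes>\<^sub>M lborel)"
          using measurable_steps_value[of "?xs n"] steps measurable_joint[OF ad] by measurable
        then have "(\<integral>\<^sup>+z. ennreal ((steps_value (?xs n) z - joint h z)\<^sup>2) \<partial>(M \<Otimes>\<^sub>M lborel))
            = (\<integral>\<^sup>+w. \<integral>\<^sup>+t. ennreal ((steps_value (?xs n) (w, t) - joint h (w, t))\<^sup>2) \<partial>lborel \<partial>M)"
          by (rule lborel.nn_integral_fst[symmetric])
        also have "\<dots> \<le> (\<integral>\<^sup>+w. (\<integral>\<^sup>+t\<in>{0..T}. ennreal ((elem_process (D n) t w - h t w)\<^sup>2) \<partial>lborel) \<partial>M)"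
        proof (intro nn_integral_mono)
          fix w t
          show "ennreal ((steps_value (?xs n) (w, t) - joint h (w, t))\<^sup>2)
              \<le> ennreal ((elem_process (D n) t w - h t w)\<^sup>2) * indicator {0..T} t"
            using steps_value_outside[of "?xs n" t w] steps
            by (cases "t \<in> {0<..T}") (auto simp: joint_def elem_process_steps indicator_def)
        qed
        finally show ?thesis .
      qed
    qed
    show "(\<lambda>n. \<integral>\<^sup>+w. ennreal ((steps_integral_upto t (?xs n) w - I t w)\<^sup>2) \<partial>M) \<longlonglongrightarrow> 0"
      using t by (intro tendsto_0_ennreal_le[OF sup] nn_integral_mono SUP_upper2[of t]) (auto simp: elem_integral_steps)
  qed
qed

text \<open>
  Two integrands that agree up to a stopping time \<open>\<rho>\<close> have the same integral up to \<open>\<rho>\<close>. The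
  difference of the approximating step processes, stopped shortly after \<open>\<rho>\<close>, is small
  because its limit lives on the short interval between \<open>\<rho>\<close> and the time of stopping.
\<close>

lemma stoch_integral_local:
  assumes h: "has_L2_stoch_integral M F T W UNIV abs h I" and h': "has_L2_stoch_integral M F T W UNIV abs h' I'"
    and \<rho>: "stopping_time F \<rho>"
    and eq: "\<And>w t. w \<in> space M \<Longrightarrow> 0 < t \<Longrightarrow> t \<le> T \<Longrightarrow> t \<le> \<rho> w \<Longrightarrow> h t w = h' t w"
    and t: "t \<in> {0..T}"
  shows "AE w in M. t \<le> \<rho> w \<longrightarrow> I t w = I' t w"
proof -
  let ?\<mu> = "M \<Otimes>\<^sub>M lborel :: ('w \<times> real) measure"
  obtain xs where xs0: "\<forall>n. \<forall>x\<in>set (xs n). step x"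
    and a: "(\<lambda>n. \<integral>\<^sup>+z. ennreal ((steps_value (xs n) z - joint h z)\<^sup>2) \<partial>?\<mu>) \<longlonglongrightarrow> 0" (is "?a \<longlonglongrightarrow> 0")
    and i: "(\<lambda>n. \<integral>\<^sup>+w. ennreal ((steps_integral_upto t (xs n) w - I t w)\<^sup>2) \<partial>M) \<longlonglongrightarrow> 0" (is "?i \<longlonglongrightarrow> 0")
    using stoch_integral_approx[OF h t] by (elim exE conjE)
  obtain xs' where xs0': "\<forall>n. \<forall>x\<in>set (xs' n). step x"
    and a': "(\<lambda>n. \<integral>\<^sup>+z. ennreal ((steps_value (xs' n) z - joint h' z)\<^sup>2) \<partial>?\<mu>) \<longlonglongrightarrow> 0" (is "?a' \<longlonglongrightarrow> 0")
    and i': "(\<lambda>n. \<integral>\<^sup>+w. ennreal ((steps_integral_upto t (xs' n) w - I' t w)\<^sup>2) \<partial>M) \<longlonglongrightarrow> 0" (is "?i' \<longlonglongrightarrow> 0")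
    using stoch_integral_approx[OF h' t] by (elim exE conjE)
  let ?P = "\<lambda>n. steps_integral_upto t (xs n)" and ?P' = "\<lambda>n. steps_integral_upto t (xs' n)"
  let ?V = "\<lambda>n. steps_value (xs n)" and ?V' = "\<lambda>n. steps_value (xs' n)"
  have xs: "step x" if "x \<in> set (xs n)" for n x using xs0 that by blast
  have xs': "step x" if "x \<in> set (xs' n)" for n x using xs0' that by blast
  define ys where "ys n = xs n @ map neg_step (xs' n)" for n
  have ys: "step x" if "x \<in> set (ys n)" for n x
  proof -
    have "x \<in> set (xs n) \<or> x \<in> neg_step ` set (xs' n)"
      using that unfolding ys_def by simp
    then show ?thesis using xs xs' step_neg_step by blast
  qed
  have meas_v [measurable]: "?V n \<in> borel_measurable ?\<mu>" "?V' n \<in> borel_measurable ?\<mu>" for n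
    using xs xs' by (auto intro: measurable_steps_value)
  have meas_ys [measurable]: "steps_value (ys n) \<in> borel_measurable ?\<mu>" for n
    using measurable_steps_value[of "ys n"] ys by blast
  have meas_h [measurable]: "joint h \<in> borel_measurable ?\<mu>" "joint h' \<in> borel_measurable ?\<mu>"
    using h h' by (auto simp: has_L2_stoch_integral_def intro: measurable_joint)
  have meas_I [measurable]: "I t \<in> borel_measurable M" "I' t \<in> borel_measurable M"
    using h h' t by (auto simp: has_L2_stoch_integral_def intro: measurable_path_eval)
  have meas_i [measurable]: "?P n \<in> borel_measurable M" "?P' n \<in> borel_measurable M" for n
    using xs xs' t by (auto intro: measurable_steps_integral_upto)
  have meas_\<rho> [measurable]: "\<rho> \<in> borel_measurable M"
    using measurable_stopping_time[OF \<rho>, of M] sets_F space_F by auto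
  define S where "S m = {z::'w \<times> real. 0 < snd z \<and> snd z \<le> T \<and> snd z < \<rho> (fst z) + t / real (Suc m)}" for m
  have S_meas: "Measurable.pred ?\<mu> (\<lambda>z. z \<in> S m)" for m
    unfolding S_def mem_Collect_eq by measurable
  have ind_S [measurable]: "(\<lambda>z. indicator (S m) z :: real) \<in> borel_measurable ?\<mu>" for m
    using S_meas[of m] by measurable
  let ?e = "\<lambda>m. \<integral>\<^sup>+z. ennreal ((indicator (S m) z * (joint h z - joint h' z))\<^sup>2) \<partial>?\<mu>"
  let ?L = "\<integral>\<^sup>+w. ennreal ((indicator {w. t \<le> \<rho> w} w * (I t w - I' t w))\<^sup>2) \<partial>M"
  have bound: "?L \<le> 3 * (?i n + ?i' n + 3 * (?a n + ?a' n + ?e m))" for n m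
  proof -
    let ?Z = "\<lambda>w. ?P n w - ?P' n w"
    let ?J = "\<lambda>w. indicator {w. t \<le> \<rho> w} w :: real"
    let ?K = "\<lambda>z. indicator (S m) z :: real"
    have "?L = (\<integral>\<^sup>+w. ennreal ((?J w * (I t w - ?P n w)
        + ?J w * (?P' n w - I' t w) + ?J w * ?Z w)\<^sup>2) \<partial>M)"
      by (intro nn_integral_cong arg_cong[where f = ennreal] arg_cong[where f = "\<lambda>x. x\<^sup>2"]) (simp add: algebra_simps)
    also have "\<dots> \<le> 3 * ((\<integral>\<^sup>+w. ennreal ((?J w * (I t w - ?P n w))\<^sup>2) \<partial>M)
        + (\<integral>\<^sup>+w. ennreal ((?J w * (?P' n w - I' t w))\<^sup>2) \<partial>M)
        + (\<integral>\<^sup>+w. ennreal ((?J w * ?Z w)\<^sup>2) \<partial>M))"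
      by (rule nn_integral_square_sum3) measurable
    also have "\<dots> \<le> 3 * (?i n + ?i' n + 3 * (?a n + ?a' n + ?e m))"
    proof (intro mult_left_mono add_mono)
      show "(\<integral>\<^sup>+w. ennreal ((?J w * (I t w - ?P n w))\<^sup>2) \<partial>M) \<le> ?i n"
        by (intro nn_integral_mono) (auto simp: indicator_def power2_commute)
      show "(\<integral>\<^sup>+w. ennreal ((?J w * (?P' n w - I' t w))\<^sup>2) \<partial>M) \<le> ?i' n"
        by (intro nn_integral_mono) (auto simp: indicator_def)
      have "(\<integral>\<^sup>+w. ennreal ((?J w * ?Z w)\<^sup>2) \<partial>M)
          = (\<integral>\<^sup>+w. indicator {w. t \<le> \<rho> w} w * ennreal ((steps_integral_upto t (ys n) w)\<^sup>2) \<partial>M)"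
        by (intro nn_integral_cong) (auto simp: ys_def steps_integral_upto_diff indicator_def)
      also have "\<dots> \<le> (\<integral>\<^sup>+z. indicator (S m) z * ennreal ((steps_value (ys n) z)\<^sup>2) \<partial>?\<mu>)"
        unfolding S_def using t by (intro stopped_integral_bound \<rho> ys) auto
      also have "\<dots> = (\<integral>\<^sup>+z. ennreal ((?K z * (?V n z - joint h z)
          + ?K z * (joint h' z - ?V' n z) + ?K z * (joint h z - joint h' z))\<^sup>2) \<partial>?\<mu>)"
        by (intro nn_integral_cong) (auto simp: ys_def steps_value_diff indicator_def)
      also have "\<dots> \<le> 3 * ((\<integral>\<^sup>+z. ennreal ((?K z * (?V n z - joint h z))\<^sup>2) \<partial>?\<mu>)
          + (\<integral>\<^sup>+z. ennreal ((?K z * (joint h' z - ?V' n z))\<^sup>2) \<partial>?\<mu>) + ?e m)"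
        by (rule nn_integral_square_sum3) measurable
      also have "\<dots> \<le> 3 * (?a n + ?a' n + ?e m)"
        by (intro mult_left_mono add_mono nn_integral_mono) (auto simp: indicator_def power2_commute)
      finally show "(\<integral>\<^sup>+w. ennreal ((?J w * ?Z w)\<^sup>2) \<partial>M) \<le> 3 * (?a n + ?a' n + ?e m)" .
    qed auto
    finally show ?thesis .
  qed
  have L_le: "?L \<le> 9 * ?e m" for m
  proof (rule tendsto_lowerbound)
    have "(\<lambda>n. 3 * (?i n + ?i' n + 3 * (?a n + ?a' n + ?e m))) \<longlonglongrightarrow> 3 * (0 + 0 + 3 * (0 + 0 + ?e m))"
      by (intro ennreal_tendsto_cmult tendsto_add tendsto_const a a' i i') auto
    then show "(\<lambda>n. 3 * (?i n + ?i' n + 3 * (?a n + ?a' n + ?e m))) \<longlonglongrightarrow> 9 * ?e m"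
      by (simp add: mult.assoc[symmetric])
    show "\<forall>\<^sub>F n in sequentially. ?L \<le> 3 * (?i n + ?i' n + 3 * (?a n + ?a' n + ?e m))"
      using bound by simp
  qed simp
  \<comment> \<open>The difference of the integrands vanishes up to \<open>\<rho>\<close>, and the sets \<open>S m\<close>
    shrink to the times in \<open>(0, T]\<close> up to \<open>\<rho>\<close>.\<close>
  have "(\<lambda>m. ?e m) \<longlonglongrightarrow> (\<integral>\<^sup>+z. 0 \<partial>?\<mu>)"
  proof (rule nn_integral_dominated_convergence[where w = "\<lambda>z. ennreal ((joint h z - joint h' z)\<^sup>2)"])
    have "\<forall>\<^sub>F n in sequentially. ?a n < \<infinity> \<and> ?a' n < \<infinity>"
      using order_tendstoD(2)[OF a, of \<infinity>] order_tendstoD(2)[OF a', of \<infinity>] by (auto intro: eventually_conj)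
    then obtain n where n: "?a n < \<infinity>" "?a' n < \<infinity>"
      using eventually_happens sequentially_bot by blast
    have "(\<integral>\<^sup>+z. ennreal ((joint h z - joint h' z)\<^sup>2) \<partial>?\<mu>) = (\<integral>\<^sup>+z. ennreal (((joint h z - ?V n z)
        + (?V' n z - joint h' z) + steps_value (ys n) z)\<^sup>2) \<partial>?\<mu>)"
      by (simp add: ys_def steps_value_diff)
    also have "\<dots> \<le> 3 * ((\<integral>\<^sup>+z. ennreal ((joint h z - ?V n z)\<^sup>2) \<partial>?\<mu>) + ?a' n
        + (\<integral>\<^sup>+z. ennreal ((steps_value (ys n) z)\<^sup>2) \<partial>?\<mu>))"
      by (rule nn_integral_square_sum3) measurable
    also have "\<dots> < \<infinity>"
      using n Ito_isometry(2)[of "ys n", OF ys] by (simp add: power2_commute[of "joint h _"] ennreal_mult_less_top)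
    finally show "(\<integral>\<^sup>+z. ennreal ((joint h z - joint h' z)\<^sup>2) \<partial>?\<mu>) < \<infinity>" .
  next
    show "AE z in ?\<mu>. (\<lambda>m. ennreal ((indicator (S m) z * (joint h z - joint h' z))\<^sup>2)) \<longlonglongrightarrow> 0"
    proof (rule AE_I2)
      fix z assume z: "z \<in> space ?\<mu>"
      obtain w u where wu: "z = (w, u)" "w \<in> space M" using z by (auto simp: space_pair_measure)
      show "(\<lambda>m. ennreal ((indicator (S m) z * (joint h z - joint h' z))\<^sup>2)) \<longlonglongrightarrow> 0"
      proof (cases "u \<le> \<rho> w")
        case True
        then have "joint h z - joint h' z = 0" using eq[of w u] wu by (auto simp: joint_def indicator_def)
        then show ?thesis by simp
      next
        case False
        have "(\<lambda>m. t * inverse (real (Suc m))) \<longlonglongrightarrow> t * 0"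
          by (intro tendsto_mult tendsto_const LIMSEQ_inverse_real_of_nat)
        then have "\<forall>\<^sub>F m in sequentially. t * inverse (real (Suc m)) < u - \<rho> w"
          using False by (intro order_tendstoD) auto
        then have "\<forall>\<^sub>F m in sequentially. ennreal ((indicator (S m) z * (joint h z - joint h' z))\<^sup>2) = 0"
          by eventually_elim (auto simp: S_def wu indicator_def divide_inverse)
        then show ?thesis by (rule tendsto_eventually)
      qed
    qed
  next
    show "AE z in ?\<mu>. ennreal ((indicator (S m) z * (joint h z - joint h' z))\<^sup>2) \<le> ennreal ((joint h z - joint h' z)\<^sup>2)" for m
      by (intro AE_I2) (auto simp: indicator_def)
  qed measurable
  then have "(\<lambda>m. 9 * ?e m) \<longlonglongrightarrow> 9 * 0"
    by (intro ennreal_tendsto_cmult) auto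
  then have "?L \<le> 9 * 0"
    by (rule tendsto_lowerbound) (use L_le in auto)
  then have "?L = 0" by simp
  then have "AE w in M. ennreal ((indicator {w. t \<le> \<rho> w} w * (I t w - I' t w))\<^sup>2) = 0"
    by (subst (asm) nn_integral_0_iff_AE) measurable
  then show ?thesis
    by eventually_elim (auto simp: indicator_def split: if_splits)
qed

lemma stoch_integral_local_paths:
  assumes h: "has_L2_stoch_integral M F T W UNIV abs h I" and h': "has_L2_stoch_integral M F T W UNIV abs h' I'"
    and \<rho>: "stopping_time F \<rho>"
    and eq: "\<And>w t. w \<in> space M \<Longrightarrow> 0 < t \<Longrightarrow> t \<le> T \<Longrightarrow> t \<le> \<rho> w \<Longrightarrow> h t w = h' t w"
  shows "AE w in M. \<forall>t\<in>{0..T}. t \<le> \<rho> w \<longrightarrow> I t w = I' t w"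
proof -
  have "AE w in M. \<forall>t\<in>\<rat> \<inter> {0..T}. t \<le> \<rho> w \<longrightarrow> I t w = I' t w"
    using countable_rat by (subst AE_ball_countable) (auto intro: stoch_integral_local[OF h h' \<rho> eq])
  then show ?thesis
  proof (rule AE_mp, intro AE_I2 impI ballI)
    fix w t
    assume w: "w \<in> space M" and Q: "\<forall>t\<in>\<rat> \<inter> {0..T}. t \<le> \<rho> w \<longrightarrow> I t w = I' t w"
      and t: "t \<in> {0..T}" "t \<le> \<rho> w"
    have cont: "continuous_on {0..T} (\<lambda>t. I t w)" "continuous_on {0..T} (\<lambda>t. I' t w)"
      using h h' w by (auto simp: has_L2_stoch_integral_def strongly_measurable_def intro!: paths_real_continuous)
    show "I t w = I' t w"
    proof (cases "t = 0")
      case False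
      then have t0: "0 < t" using t by simp
      have "closure ({0<..<t} \<inter> \<rat>) = closure {0<..<t}"
        by (rule closure_open_Int_superset) (auto simp: Rats_closure_real)
      also have "\<dots> = {0..t}" using t0 by simp
      finally have cl: "closure ({0<..<t} \<inter> \<rat>) = {0..t}" .
      have "I t w - I' t w = 0"
      proof (rule continuous_constant_on_closure[where S = "{0<..<t} \<inter> \<rat>" and f = "\<lambda>t. I t w - I' t w"])
        show "continuous_on (closure ({0<..<t} \<inter> \<rat>)) (\<lambda>t. I t w - I' t w)"
          unfolding cl using t by (intro continuous_on_subset[OF continuous_on_diff[OF cont]]) auto
        show "t \<in> closure ({0<..<t} \<inter> \<rat>)" unfolding cl using t0 by simp
        show "I u w - I' u w = 0" if "u \<in> {0<..<t} \<inter> \<rat>" for u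
        proof -
          have "u \<in> \<rat> \<inter> {0..T}" "u \<le> \<rho> w" using that t by auto
          then show ?thesis using Q by simp
        qed
      qed
      then show ?thesis by simp
    qed (use Q t in auto)
  qed
qed

end

text \<open>The gluing step of \<open>stoch_integral\<close>, separated from the choice of the data so that choices can be compared.\<close>

definition glued :: "(nat \<Rightarrow> 'w \<Rightarrow> real) \<times> (nat \<Rightarrow> real \<Rightarrow> 'w \<Rightarrow> 'e::real_vector) \<Rightarrow> real \<Rightarrow> 'w \<Rightarrow> 'e"
  where "glued L = (let (\<tau>, J) = L in (\<lambda>t w. if \<exists>k. t \<le> \<tau> k w then J (LEAST k. t \<le> \<tau> k w) t w else 0))"

lemma stoch_integral_eq_glued:
  "stoch_integral M F T W E N H = glued (SOME L. localized_integrals M F T W E N H L)"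
  by (simp add: stoch_integral_def glued_def)

text \<open>
  On \<open>[0, \<tau> k \<and> \<sigma> j]\<close> the two truncated integrands agree, hence so do \<open>J k\<close> and \<open>K j\<close>, whichever
  indices \<open>k\<close> and \<open>j\<close> the two constructions pick at a given time.
\<close>

lemma (in brownian) glued_unique:
  assumes L: "localized_integrals M F T W UNIV abs h (\<tau>, J)" and L': "localized_integrals M F T W UNIV abs h (\<sigma>, K)"
  shows "AE w in M. \<forall>t\<in>{0..T}. glued (\<tau>, J) t w = glued (\<sigma>, K) t w"
proof -
  have "AE w in M. \<forall>t\<in>{0..T}. t \<le> min (\<tau> k w) (\<sigma> j w) \<longrightarrow> J k t w = K j t w" for k j
  proof (rule stoch_integral_local_paths)
    show "has_L2_stoch_integral M F T W UNIV abs (restrict_to (\<tau> k) h) (J k)"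
      "has_L2_stoch_integral M F T W UNIV abs (restrict_to (\<sigma> j) h) (K j)"
      using L L' by (auto simp: localized_integrals_def)
    show "stopping_time F (\<lambda>w. min (\<tau> k w) (\<sigma> j w))"
      using L L' by (intro stopping_time_min) (auto simp: localized_integrals_def localizing_def)
  qed (auto simp: restrict_to_def)
  then have "AE w in M. \<forall>k j. \<forall>t\<in>{0..T}. t \<le> min (\<tau> k w) (\<sigma> j w) \<longrightarrow> J k t w = K j t w"
    by (simp add: AE_all_countable)
  moreover have "AE w in M. \<forall>\<^sub>F k in sequentially. \<tau> k w = T" "AE w in M. \<forall>\<^sub>F k in sequentially. \<sigma> k w = T"
    using L L' by (auto simp: localized_integrals_def localizing_def)
  ultimately show ?thesis
  proof eventually_elim
    case (elim w)
    obtain k j where kj: "\<tau> k w = T" "\<sigma> j w = T"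
      using elim(2,3) by (meson eventually_happens sequentially_bot)
    show ?case
    proof
      fix t assume t: "t \<in> {0..T}"
      have ex: "\<exists>k. t \<le> \<tau> k w" "\<exists>j. t \<le> \<sigma> j w"
        using kj t by (auto intro: exI[of _ k] exI[of _ j])
      have "t \<le> \<tau> (LEAST k. t \<le> \<tau> k w) w" "t \<le> \<sigma> (LEAST j. t \<le> \<sigma> j w) w"
        using LeastI_ex[OF ex(1)] LeastI_ex[OF ex(2)] by auto
      then have "J (LEAST k. t \<le> \<tau> k w) t w = K (LEAST j. t \<le> \<sigma> j w) t w"
        using elim(1) t by auto
      then show "glued (\<tau>, J) t w = glued (\<sigma>, K) t w"
        using ex by (simp add: glued_def)
    qed
  qed
qed

section \<open>Bounded functionals and stochastic integrals\<close>

text \<open>This is applied to suprema over uncountable sets of times, which need not be measurable.\<close>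

lemma nn_integral_cmult_le:
  assumes "0 \<le> c"
  shows "(\<integral>\<^sup>+x. ennreal c * f x \<partial>M) \<le> ennreal c * (\<integral>\<^sup>+x. f x \<partial>M)"
proof (cases "c = 0")
  case False
  then have c: "c > 0" using assms by simp
  show ?thesis
    unfolding nn_integral_def[of M "\<lambda>x. ennreal c * f x"]
  proof (rule SUP_least, clarify)
    fix g assume g: "simple_function M g" "g \<le> (\<lambda>x. ennreal c * f x)"
    have inv: "ennreal c * (ennreal (inverse c) * y) = y" "ennreal (inverse c) * (ennreal c * y) = y" for y
      using c by (simp_all add: mult.assoc[symmetric] ennreal_mult[symmetric])
    have "integral\<^sup>S M g = (\<integral>\<^sup>+x. ennreal c * (ennreal (inverse c) * g x) \<partial>M)"
      using g(1) by (simp add: nn_integral_eq_simple_integral inv)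
    also have "\<dots> = ennreal c * (\<integral>\<^sup>+x. ennreal (inverse c) * g x \<partial>M)"
      using g(1) by (intro nn_integral_cmult borel_measurable_times_ennreal) (auto intro: borel_measurable_simple_function)
    also have "\<dots> \<le> ennreal c * (\<integral>\<^sup>+x. f x \<partial>M)"
    proof (intro mult_left_mono nn_integral_mono)
      fix x
      have "ennreal (inverse c) * g x \<le> ennreal (inverse c) * (ennreal c * f x)"
        using g(2) by (intro mult_left_mono) (auto simp: le_fun_def)
      then show "ennreal (inverse c) * g x \<le> f x" by (simp add: inv)
    qed simp
    finally show "integral\<^sup>S M g \<le> ennreal c * (\<integral>\<^sup>+x. f x \<partial>M)" .
  qed
qed simp

locale bounded_functional =
  fixes E :: "'e::real_vector set" and N :: "'e \<Rightarrow> real" and l :: "'e \<Rightarrow> real" and C :: real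
  assumes quasi: "quasi_seminorm_on E N"
    and lincomb: "\<And>a b f g. f \<in> E \<Longrightarrow> g \<in> E \<Longrightarrow> l (a *\<^sub>R f + b *\<^sub>R g) = a * l f + b * l g"
    and bound: "\<And>f. f \<in> E \<Longrightarrow> \<bar>l f\<bar> \<le> C * N f" and C: "0 \<le> C"
begin

lemma subspace_E: "subspace E"
  using quasi by (simp add: quasi_seminorm_on_def)

lemma zero: "l 0 = 0"
  using lincomb[of 0 0 0 0] subspace_0[OF subspace_E] by simp

lemma scale: "f \<in> E \<Longrightarrow> l (c *\<^sub>R f) = c * l f"
  using lincomb[of f f c 0] by simp

lemma diff: "f \<in> E \<Longrightarrow> g \<in> E \<Longrightarrow> l (f - g) = l f - l g"
  using lincomb[of f g 1 "-1"] by simp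

lemma sum: "(\<And>i. i \<in> S \<Longrightarrow> f i \<in> E) \<Longrightarrow> l (\<Sum>i\<in>S. f i) = (\<Sum>i\<in>S. l (f i))"
proof (induction S rule: infinite_finite_induct)
  case (insert i S)
  then have "f i \<in> E" "(\<Sum>i\<in>S. f i) \<in> E"
    by (auto intro: subspace_sum[OF subspace_E])
  then show ?case using lincomb[of "f i" "\<Sum>i\<in>S. f i" 1 1] insert by simp
qed (auto simp: zero)

lemma diff_bound: "f \<in> E \<Longrightarrow> g \<in> E \<Longrightarrow> \<bar>l f - l g\<bar> \<le> C * N (f - g)"
  using bound[of "f - g"] subspace_diff[OF subspace_E] by (simp add: diff)

lemma strongly_measurable_l:
  assumes f: "strongly_measurable M E N f"
  shows "strongly_measurable M UNIV abs (\<lambda>w. l (f w))"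
proof -
  have fE: "\<forall>w\<in>space M. f w \<in> E" using f by (auto simp: strongly_measurable_def)
  obtain u where u: "\<forall>n. simple_function M (u n) \<and> u n ` space M \<subseteq> E"
      "\<forall>w\<in>space M. (\<lambda>n. N (u n w - f w)) \<longlonglongrightarrow> 0"
    using f unfolding strongly_measurable_def by (elim exE conjE)
  show ?thesis
  proof (rule strongly_measurableI)
    show "simple_function M (\<lambda>w. l (u n w))" for n
      using u(1) by (intro simple_function_compose1[of M "u n" l]) blast
    fix w assume w: "w \<in> space M"
    show "(\<lambda>n. \<bar>l (u n w) - l (f w)\<bar>) \<longlonglongrightarrow> 0"
    proof (rule Lim_null_comparison)
      show "(\<lambda>n. C * N (u n w - f w)) \<longlonglongrightarrow> 0"
        using tendsto_mult_left[OF u(2)[rule_format, OF w], of C] by simp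
      have "u n w \<in> E" for n using u(1) w by blast
      then show "\<forall>\<^sub>F n in sequentially. norm \<bar>l (u n w) - l (f w)\<bar> \<le> C * N (u n w - f w)"
        using fE w by (intro always_eventually) (auto intro: diff_bound)
    qed
  qed auto
qed

lemma adapted_process_l:
  assumes "adapted_process M F T E N H"
  shows "adapted_process M F T UNIV abs (\<lambda>t w. l (H t w))"
  unfolding adapted_process_def split_beta
proof (intro conjI ballI strongly_measurable_l)
  show "strongly_measurable (restrict_space borel {0..T} \<Otimes>\<^sub>M M) E N (\<lambda>z. H (fst z) (snd z))"
    using assms unfolding adapted_process_def split_beta by (rule conjunct1)
  show "strongly_measurable (F t) E N (H t)" if "t \<in> {0..T}" for t
    using assms that unfolding adapted_process_def by blast
qed

lemma paths_l:
  assumes g: "g \<in> paths T E N"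
  shows "(\<lambda>t. l (g t)) \<in> paths T UNIV abs"
  unfolding paths_def
proof (intro CollectI ballI conjI UNIV_I)
  fix t assume t: "t \<in> {0..T}"
  then have lim: "((\<lambda>u. N (g u - g t)) \<longlongrightarrow> 0) (at t within {0..T})" and gE: "\<And>u. u \<in> {0..T} \<Longrightarrow> g u \<in> E"
    using g by (auto simp: paths_def)
  show "((\<lambda>u. \<bar>l (g u) - l (g t)\<bar>) \<longlongrightarrow> 0) (at t within {0..T})"
  proof (rule Lim_null_comparison)
    show "((\<lambda>u. C * N (g u - g t)) \<longlongrightarrow> 0) (at t within {0..T})"
      using tendsto_mult_left[OF lim, of C] by simp
    show "\<forall>\<^sub>F u in at t within {0..T}. norm \<bar>l (g u) - l (g t)\<bar> \<le> C * N (g u - g t)"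
      unfolding eventually_at_filter using t gE by (intro always_eventually) (auto intro: diff_bound)
  qed
qed

lemma paths_diff:
  assumes g: "g \<in> paths T E N" and g': "g' \<in> paths T E N"
  shows "g - g' \<in> paths T E N"
  unfolding paths_def
proof (intro CollectI ballI conjI)
  fix t assume t: "t \<in> {0..T}"
  have gE: "g u \<in> E" "g' u \<in> E" if "u \<in> {0..T}" for u using g g' that by (auto simp: paths_def)
  then show "(g - g') t \<in> E" using t by (auto intro: subspace_diff[OF subspace_E])
  have N: "\<And>a. a \<in> E \<Longrightarrow> 0 \<le> N a" "\<And>c a. a \<in> E \<Longrightarrow> N (c *\<^sub>R a) \<le> \<bar>c\<bar> * N a"
    and "\<exists>K\<ge>0. \<forall>a\<in>E. \<forall>b\<in>E. N (a + b) \<le> K * (N a + N b)"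
    using quasi unfolding quasi_seminorm_on_def by blast+
  then obtain K where K: "K \<ge> 0" "\<And>a b. a \<in> E \<Longrightarrow> b \<in> E \<Longrightarrow> N (a + b) \<le> K * (N a + N b)"
    by blast
  have lim: "((\<lambda>u. N (g u - g t)) \<longlongrightarrow> 0) (at t within {0..T})" "((\<lambda>u. N (g' u - g' t)) \<longlongrightarrow> 0) (at t within {0..T})"
    using g g' t by (auto simp: paths_def)
  show "((\<lambda>u. N ((g - g') u - (g - g') t)) \<longlongrightarrow> 0) (at t within {0..T})"
  proof (rule Lim_null_comparison)
    show "((\<lambda>u. K * (N (g u - g t) + N (g' u - g' t))) \<longlongrightarrow> 0) (at t within {0..T})"
      using tendsto_mult_left[OF tendsto_add[OF lim], of K] by simp
    have "norm (N ((g - g') u - (g - g') t)) \<le> K * (N (g u - g t) + N (g' u - g' t))" if u: "u \<in> {0..T}" for u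
    proof -
      have d: "g u - g t \<in> E" "g' u - g' t \<in> E" using gE u t by (auto intro: subspace_diff[OF subspace_E])
      have m: "(-1) *\<^sub>R (g' u - g' t) \<in> E" by (rule subspace_scale[OF subspace_E d(2)])
      have eq: "(g - g') u - (g - g') t = (g u - g t) + (-1) *\<^sub>R (g' u - g' t)"
        by (simp add: fun_diff_def)
      have "N ((g u - g t) + (-1) *\<^sub>R (g' u - g' t)) \<le> K * (N (g u - g t) + N ((-1) *\<^sub>R (g' u - g' t)))"
        using d m by (intro K)
      also have "\<dots> \<le> K * (N (g u - g t) + N (g' u - g' t))"
        using N(2)[OF d(2), of "-1"] by (intro mult_left_mono K) simp
      finally show ?thesis
        unfolding eq using N(1)[OF subspace_add[OF subspace_E d(1) m]] by simp
    qed
    then show "\<forall>\<^sub>F u in at t within {0..T}. norm (N ((g - g') u - (g - g') t)) \<le> K * (N (g u - g t) + N (g' u - g' t))"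
      unfolding eventually_at_filter by (intro always_eventually) auto
  qed
qed

text \<open>
  The quasi-triangle inequality makes \<open>N\<close> locally bounded along a path, although
  \<open>N\<close> itself need not be continuous along it.
\<close>

lemma paths_bdd:
  assumes g: "g \<in> paths T E N"
  shows "bdd_above ((\<lambda>t. N (g t)) ` {0..T})"
proof -
  obtain K where K: "K \<ge> 0" "\<And>a b. a \<in> E \<Longrightarrow> b \<in> E \<Longrightarrow> N (a + b) \<le> K * (N a + N b)"
    using quasi unfolding quasi_seminorm_on_def by blast
  have gE: "g u \<in> E" if "u \<in> {0..T}" for u using g that by (auto simp: paths_def)
  have "\<exists>U B. open U \<and> t \<in> U \<and> (\<forall>u\<in>U \<inter> {0..T}. N (g u) \<le> B)" if t: "t \<in> {0..T}" for t
  proof -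
    have "((\<lambda>u. N (g u - g t)) \<longlongrightarrow> 0) (at t within {0..T})"
      using g t by (auto simp: paths_def)
    then have "\<forall>\<^sub>F u in at t within {0..T}. N (g u - g t) < 1"
      by (rule order_tendstoD) simp
    then obtain U where U: "open U" "t \<in> U" "\<And>u. u \<in> U \<Longrightarrow> u \<noteq> t \<Longrightarrow> u \<in> {0..T} \<Longrightarrow> N (g u - g t) < 1"
      unfolding eventually_at_topological by blast
    have "N (g u) \<le> max (N (g t)) (K * (1 + N (g t)))" if u: "u \<in> U \<inter> {0..T}" for u
    proof (cases "u = t")
      case False
      have "N ((g u - g t) + g t) \<le> K * (N (g u - g t) + N (g t))"
        using gE t u by (intro K subspace_diff[OF subspace_E]) auto
      also have "\<dots> \<le> K * (1 + N (g t))"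
        using U(3)[of u] u False by (intro mult_left_mono K) auto
      finally show ?thesis by simp
    qed simp
    then show ?thesis using U(1,2) by blast
  qed
  then obtain U B where UB: "\<And>t. t \<in> {0..T} \<Longrightarrow> open (U t)" "\<And>t. t \<in> {0..T} \<Longrightarrow> t \<in> U t"
      "\<And>t u. t \<in> {0..T} \<Longrightarrow> u \<in> U t \<inter> {0..T} \<Longrightarrow> N (g u) \<le> B t"
    by metis
  have "\<exists>S\<subseteq>{0..T}. finite S \<and> {0..T} \<subseteq> (\<Union>t\<in>S. U t)"
    by (rule compactE_image[of "{0..T}" "{0..T}" U]) (use UB in \<open>auto intro: exI\<close>)
  then obtain S where S: "S \<subseteq> {0..T}" "finite S" "{0..T} \<subseteq> (\<Union>t\<in>S. U t)" by blast
  have "N (g u) \<le> (\<Sum>t\<in>S. \<bar>B t\<bar>)" if u: "u \<in> {0..T}" for u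
  proof -
    obtain t where t: "t \<in> S" "u \<in> U t" using S(3) u by blast
    have "N (g u) \<le> \<bar>B t\<bar>" using UB(3)[of t u] t S(1) u by force
    also have "\<dots> \<le> (\<Sum>t\<in>S. \<bar>B t\<bar>)" using S(2) t(1) by (intro member_le_sum) auto
    finally show ?thesis .
  qed
  then show ?thesis by (rule bdd_aboveI2)
qed

lemma strongly_measurable_paths_l:
  assumes T: "0 \<le> T" and I: "strongly_measurable M (paths T E N) (path_norm T N) (\<lambda>w t. I t w)"
  shows "strongly_measurable M (paths T UNIV abs) (path_norm T abs) (\<lambda>w t. l (I t w))"
proof -
  have Ip: "\<forall>w\<in>space M. (\<lambda>t. I t w) \<in> paths T E N" using I by (auto simp: strongly_measurable_def)
  obtain u where u: "\<forall>n. simple_function M (u n) \<and> u n ` space M \<subseteq> paths T E N"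
      "\<forall>w\<in>space M. (\<lambda>n. path_norm T N (u n w - (\<lambda>t. I t w))) \<longlonglongrightarrow> 0"
    using I unfolding strongly_measurable_def by (elim exE conjE)
  show ?thesis
  proof (rule strongly_measurableI)
    show "simple_function M (\<lambda>w t. l (u n w t))" for n
      using u(1) by (intro simple_function_compose1[of M "u n" "\<lambda>g t. l (g t)"]) blast
    fix w assume w: "w \<in> space M"
    show "(\<lambda>t. l (I t w)) \<in> paths T UNIV abs" using Ip w by (auto intro: paths_l)
    have up: "u n w \<in> paths T E N" for n using u(1) w by blast
    then show "(\<lambda>t. l (u n w t)) \<in> paths T UNIV abs" for n by (rule paths_l)
    let ?e = "\<lambda>n. (\<lambda>t. l (u n w t)) - (\<lambda>t. l (I t w))"
    show "(\<lambda>n. path_norm T abs (?e n)) \<longlonglongrightarrow> 0"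
    proof (rule Lim_null_comparison)
      have "norm (path_norm T abs (?e n)) \<le> C * path_norm T N (u n w - (\<lambda>t. I t w))" for n
      proof -
        let ?d = "u n w - (\<lambda>t. I t w)"
        have d: "?d \<in> paths T E N" using up Ip w by (auto intro: paths_diff)
        have le: "\<bar>l (u n w t) - l (I t w)\<bar> \<le> C * path_norm T N ?d" if t: "t \<in> {0..T}" for t
        proof -
          have "u n w t \<in> E" "I t w \<in> E" using up[of n] Ip w t by (auto simp: paths_def)
          then have "\<bar>l (u n w t) - l (I t w)\<bar> \<le> C * N (?d t)" using diff_bound by (simp add: fun_diff_def)
          also have "\<dots> \<le> C * path_norm T N ?d"
            unfolding path_norm_def using t by (intro mult_left_mono cSUP_upper paths_bdd d C)
          finally show ?thesis .
        qed
        then have "path_norm T abs (?e n) \<le> C * path_norm T N ?d"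
          unfolding path_norm_def[of T abs] using T by (intro cSUP_least) (auto simp: fun_diff_def)
        moreover have "0 \<le> path_norm T abs (?e n)"
        proof -
          have "bdd_above ((\<lambda>t. \<bar>(?e n) t\<bar>) ` {0..T})"
            using le by (intro bdd_aboveI2[where M = "C * path_norm T N ?d"]) (simp add: fun_diff_def)
          then show ?thesis
            unfolding path_norm_def using T by (intro cSUP_upper2[of _ _ 0]) auto
        qed
        ultimately show ?thesis by simp
      qed
      then show "\<forall>\<^sub>F n in sequentially. norm (path_norm T abs (?e n)) \<le> C * path_norm T N (u n w - (\<lambda>t. I t w))"
        by (rule always_eventually[OF allI])
      show "(\<lambda>n. C * path_norm T N (u n w - (\<lambda>t. I t w))) \<longlonglongrightarrow> 0"
        using tendsto_mult_left[OF u(2)[rule_format, OF w], of C] by simp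
    qed
  qed
qed

definition elem_l :: "('w, 'e) elem_data \<Rightarrow> ('w, real) elem_data"
  where "elem_l D = \<lparr>el_N = el_N D, el_M = el_M D, el_t = el_t D, el_A = el_A D, el_f = (\<lambda>m n. l (el_f D m n))\<rparr>"

lemma elementary_elem_l: "elementary F T E D \<Longrightarrow> elementary F T UNIV (elem_l D)"
  by (auto simp: elementary_def elem_l_def)

lemma elem_process_l:
  assumes "elementary F T E D"
  shows "elem_process (elem_l D) t w = l (elem_process D t w)" "elem_integral W (elem_l D) t w = l (elem_integral W D t w)"
    and "elem_process D t w \<in> E" "elem_integral W D t w \<in> E"
proof -
  have f: "el_f D m n \<in> E" if "n \<in> {1..el_N D}" "m \<in> {1..el_M D}" for m n
    using assms that by (auto simp: elementary_def)
  have E: "(\<Sum>m=1..el_M D. c n m *\<^sub>R el_f D m n) \<in> E" if "n \<in> {1..el_N D}" for c n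
    using f that by (intro subspace_sum subspace_scale subspace_E)
  have comb: "l (\<Sum>n=1..el_N D. \<Sum>m=1..el_M D. c n m *\<^sub>R el_f D m n) = (\<Sum>n=1..el_N D. \<Sum>m=1..el_M D. c n m *\<^sub>R l (el_f D m n))" for c
  proof -
    have "l (\<Sum>n=1..el_N D. \<Sum>m=1..el_M D. c n m *\<^sub>R el_f D m n) = (\<Sum>n=1..el_N D. l (\<Sum>m=1..el_M D. c n m *\<^sub>R el_f D m n))"
      using E by (intro sum)
    also have "\<dots> = (\<Sum>n=1..el_N D. \<Sum>m=1..el_M D. c n m *\<^sub>R l (el_f D m n))"
    proof (intro sum.cong refl)
      fix n assume n: "n \<in> {1..el_N D}"
      have "l (\<Sum>m=1..el_M D. c n m *\<^sub>R el_f D m n) = (\<Sum>m=1..el_M D. l (c n m *\<^sub>R el_f D m n))"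
        using f n by (intro sum subspace_scale[OF subspace_E])
      then show "l (\<Sum>m=1..el_M D. c n m *\<^sub>R el_f D m n) = (\<Sum>m=1..el_M D. c n m *\<^sub>R l (el_f D m n))"
        using f n by (simp add: scale)
    qed
    finally show ?thesis .
  qed
  show "elem_process (elem_l D) t w = l (elem_process D t w)" "elem_integral W (elem_l D) t w = l (elem_integral W D t w)"
    unfolding elem_process_def elem_integral_def comb by (simp_all add: elem_l_def)
  show "elem_process D t w \<in> E"
    unfolding elem_process_def by (intro subspace_sum[OF subspace_E] E)
  show "elem_integral W D t w \<in> E"
    unfolding elem_integral_def by (intro subspace_sum[OF subspace_E] E)
qed

text \<open>
  Apply \<open>l\<close> to the values of the approximating elementary processes. Functionals on the real
  line composed with \<open>l\<close> are functionals on \<open>E\<close>, which gives the weak convergence of the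
  integrands, and the bound on \<open>l\<close> transfers the uniform convergence of the integrals.
\<close>

lemma has_L2_stoch_integral_l:
  assumes T: "0 \<le> T" and H: "has_L2_stoch_integral M F T W E N H I"
  shows "has_L2_stoch_integral M F T W UNIV abs (\<lambda>t w. l (H t w)) (\<lambda>t w. l (I t w))"
proof -
  obtain D where D: "\<And>n. elementary F T E (D n)"
    and conv: "\<And>\<xi>. \<xi> \<in> cont_dual E N \<Longrightarrow>
      (\<lambda>n. \<integral>\<^sup>+w. (\<integral>\<^sup>+t\<in>{0..T}. ennreal ((\<xi> (elem_process (D n) t w) - \<xi> (H t w))\<^sup>2) \<partial>lborel) \<partial>M) \<longlonglongrightarrow> 0"
    and sup: "(\<lambda>n. \<integral>\<^sup>+w. (SUP t\<in>{0..T}. ennreal ((N (elem_integral W (D n) t w - I t w))\<^sup>2)) \<partial>M) \<longlonglongrightarrow> 0"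
    using H unfolding has_L2_stoch_integral_def by blast
  have IE: "I t w \<in> E" if "w \<in> space M" "t \<in> {0..T}" for t w
    using H that by (auto simp: has_L2_stoch_integral_def strongly_measurable_def paths_def image_subset_iff)
  have ad: "adapted_process M F T UNIV abs (\<lambda>t w. l (H t w))"
    using H by (intro adapted_process_l) (simp add: has_L2_stoch_integral_def)
  have dual: "(\<lambda>f. \<xi> (l f)) \<in> cont_dual E N" if \<xi>: "\<xi> \<in> cont_dual UNIV abs" for \<xi> :: "real \<Rightarrow> real"
  proof -
    obtain C' where C': "\<And>a. \<bar>\<xi> a\<bar> \<le> C' * \<bar>a\<bar>" and lin: "\<And>c a. \<xi> (c *\<^sub>R a) = c * \<xi> a" "\<And>a b. \<xi> (a + b) = \<xi> a + \<xi> b"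
      using \<xi> by (auto simp: cont_dual_def)
    have "\<bar>\<xi> (l a)\<bar> \<le> \<bar>C'\<bar> * C * N a" if "a \<in> E" for a
    proof -
      have "\<bar>\<xi> (l a)\<bar> \<le> \<bar>C'\<bar> * \<bar>l a\<bar>"
        using C'[of "l a"] by (intro order.trans[OF C' mult_right_mono]) auto
      also have "\<dots> \<le> \<bar>C'\<bar> * (C * N a)" using bound[OF that] by (intro mult_left_mono) auto
      finally show ?thesis by (simp add: mult.assoc)
    qed
    moreover have "\<xi> (l (c *\<^sub>R a)) = c * \<xi> (l a)" if "a \<in> E" for c a
      using lin(1)[of c "l a"] scale[OF that] by simp
    moreover have "\<xi> (l (a + b)) = \<xi> (l a) + \<xi> (l b)" if "a \<in> E" "b \<in> E" for a b
      using lin(2) lincomb[OF that, of 1 1] by simp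
    ultimately show ?thesis unfolding cont_dual_def by blast
  qed
  have "(\<lambda>n. \<integral>\<^sup>+w. (SUP t\<in>{0..T}. ennreal (\<bar>elem_integral W (elem_l (D n)) t w - l (I t w)\<bar>\<^sup>2)) \<partial>M) \<longlonglongrightarrow> 0"
  proof (rule tendsto_0_ennreal_le)
    let ?S = "\<lambda>n w. SUP t\<in>{0..T}. ennreal ((N (elem_integral W (D n) t w - I t w))\<^sup>2)"
    show "(\<integral>\<^sup>+w. (SUP t\<in>{0..T}. ennreal (\<bar>elem_integral W (elem_l (D n)) t w - l (I t w)\<bar>\<^sup>2)) \<partial>M)
        \<le> ennreal (C\<^sup>2) * (\<integral>\<^sup>+w. ?S n w \<partial>M)" for n
    proof (rule order.trans[OF nn_integral_mono nn_integral_cmult_le])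
      fix w assume w: "w \<in> space M"
      show "(SUP t\<in>{0..T}. ennreal (\<bar>elem_integral W (elem_l (D n)) t w - l (I t w)\<bar>\<^sup>2)) \<le> ennreal (C\<^sup>2) * ?S n w"
      proof (rule SUP_least)
        fix t assume t: "t \<in> {0..T}"
        let ?N = "N (elem_integral W (D n) t w - I t w)"
        have "\<bar>elem_integral W (elem_l (D n)) t w - l (I t w)\<bar> \<le> C * ?N"
          unfolding elem_process_l(2)[OF D] by (intro diff_bound elem_process_l(4)[OF D] IE w t)
        then have "\<bar>elem_integral W (elem_l (D n)) t w - l (I t w)\<bar>\<^sup>2 \<le> (C * ?N)\<^sup>2"
          by (intro power_mono) auto
        then have "ennreal (\<bar>elem_integral W (elem_l (D n)) t w - l (I t w)\<bar>\<^sup>2) \<le> ennreal (C\<^sup>2) * ennreal (?N\<^sup>2)"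
          by (simp add: ennreal_mult[symmetric] power_mult_distrib ennreal_leI)
        also have "\<dots> \<le> ennreal (C\<^sup>2) * ?S n w"
          using t by (intro mult_left_mono SUP_upper) auto
        finally show "ennreal (\<bar>elem_integral W (elem_l (D n)) t w - l (I t w)\<bar>\<^sup>2) \<le> ennreal (C\<^sup>2) * ?S n w" .
      qed
    qed simp
    show "(\<lambda>n. ennreal (C\<^sup>2) * (\<integral>\<^sup>+w. ?S n w \<partial>M)) \<longlonglongrightarrow> 0"
      using ennreal_tendsto_cmult[OF _ sup, of "ennreal (C\<^sup>2)"] by simp
  qed
  moreover have "(\<lambda>n. \<integral>\<^sup>+w. (\<integral>\<^sup>+t\<in>{0..T}. ennreal ((\<xi> (elem_process (elem_l (D n)) t w) - \<xi> (l (H t w)))\<^sup>2) \<partial>lborel) \<partial>M) \<longlonglongrightarrow> 0"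
    if "\<xi> \<in> cont_dual UNIV abs" for \<xi>
    using conv[OF dual[OF that]] by (simp add: elem_process_l(1)[OF D])
  moreover have "strongly_measurable M (paths T UNIV abs) (path_norm T abs) (\<lambda>w t. l (I t w))"
    using H by (intro strongly_measurable_paths_l[OF T]) (simp add: has_L2_stoch_integral_def)
  ultimately show ?thesis
    unfolding has_L2_stoch_integral_def
    by (intro conjI ad exI[of _ "\<lambda>n. elem_l (D n)"] allI ballI elementary_elem_l D) auto
qed

lemma localized_integrals_l:
  assumes T: "0 \<le> T" and L: "localized_integrals M F T W E N H (\<tau>, J)"
  shows "localized_integrals M F T W UNIV abs (\<lambda>t w. l (H t w)) (\<tau>, \<lambda>k t w. l (J k t w))"
proof -
  have eq: "restrict_to (\<tau> k) (\<lambda>t w. l (H t w)) = (\<lambda>t w. l (restrict_to (\<tau> k) H t w))" for k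
    by (intro ext) (auto simp: restrict_to_def indicator_def zero)
  have "has_L2_stoch_integral M F T W UNIV abs (restrict_to (\<tau> k) (\<lambda>t w. l (H t w))) (\<lambda>t w. l (J k t w))" for k
    unfolding eq by (rule has_L2_stoch_integral_l[OF T]) (use L in \<open>simp add: localized_integrals_def\<close>)
  then show ?thesis
    using L by (simp add: localized_integrals_def)
qed

text \<open>
  A bounded functional maps a localized integral of \<open>H\<close> to a localized integral of \<open>l (H)\<close>.
  The process \<open>stoch_integral\<close> of \<open>l (H)\<close> may be built from another localizing sequence and other
  versions, but scalar localized integrals are unique up to indistinguishability.
\<close>

lemma stoch_integral_l:
  assumes B: "brownian M F T W" and H: "locally_stoch_integrable M F T W E N H"
  shows "locally_stoch_integrable M F T W UNIV abs (\<lambda>t w. l (H t w))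
    \<and> (AE w in M. \<forall>t\<in>{0..T}. l (stoch_integral M F T W E N H t w) = stoch_integral M F T W UNIV abs (\<lambda>t w. l (H t w)) t w)"
proof -
  interpret B: brownian M F T W by (rule B)
  have T: "0 \<le> T" using B.T by simp
  let ?h = "\<lambda>t w. l (H t w)"
  obtain \<tau> J where L0: "(SOME L. localized_integrals M F T W E N H L) = (\<tau>, J)" by fastforce
  have "\<exists>L. localized_integrals M F T W E N H L"
    using H by (simp add: locally_stoch_integrable_def)
  then have "localized_integrals M F T W E N H (SOME L. localized_integrals M F T W E N H L)"
    by (rule someI_ex)
  then have L: "localized_integrals M F T W UNIV abs ?h (\<tau>, \<lambda>k t w. l (J k t w))"
    unfolding L0 by (rule localized_integrals_l[OF T])
  have "adapted_process M F T UNIV abs ?h"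
    using H by (intro adapted_process_l) (simp add: locally_stoch_integrable_def)
  then have loc: "locally_stoch_integrable M F T W UNIV abs ?h"
    using L by (auto simp: locally_stoch_integrable_def)
  obtain \<sigma> K where L0': "(SOME L. localized_integrals M F T W UNIV abs ?h L) = (\<sigma>, K)" by fastforce
  have "\<exists>L. localized_integrals M F T W UNIV abs ?h L"
    using L by (rule exI)
  then have "localized_integrals M F T W UNIV abs ?h (SOME L. localized_integrals M F T W UNIV abs ?h L)"
    by (rule someI_ex)
  then have L': "localized_integrals M F T W UNIV abs ?h (\<sigma>, K)" unfolding L0' .
  have "l (glued (\<tau>, J) t w) = glued (\<tau>, \<lambda>k t w. l (J k t w)) t w" for t w
    by (simp add: glued_def zero)
  then have "AE w in M. \<forall>t\<in>{0..T}. l (stoch_integral M F T W E N H t w) = stoch_integral M F T W UNIV abs ?h t w"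
    using B.glued_unique[OF L L'] by (simp add: stoch_integral_eq_glued L0 L0')
  then show ?thesis using loc by blast
qed

end

section \<open>Reconstruction commutes with stochastic integration\<close>

text \<open>
  Since \<open>k > \<bar>inf A\<bar>\<close>, there is an \<open>a < inf A\<close> with \<open>\<bar>a\<bar> < k\<close>, and \<open>Rec\<close> is continuous into the Besov
  space of that regularity with test functions in \<open>\<B>\<^sup>k\<close>. The pairing with \<open>\<psi>\<close> is bounded on this
  space, so its composition with \<open>Rec\<close> is linear and bounded near \<open>0\<close>.
\<close>

lemma (in reg_model) reconstruction_functional:
  assumes rec: "reconstruction s r R Pmod \<Gamma> \<gamma> p q Rec" and p: "1 < p" and q: "1 < q"
    and \<alpha>\<^sub>0: "Inf (idx R) \<notin> \<int>" and k: "real k > \<bar>Inf (idx R)\<bar>" and \<psi>: "\<psi> \<in> test_ball s k"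
  shows "\<exists>C. bounded_functional (modelled s R \<Gamma> \<gamma> p q) (md_seminorm s R \<Gamma> \<gamma> p q) (\<lambda>f. pairing k (Rec f) \<psi>) C"
proof -
  let ?D = "modelled s R \<Gamma> \<gamma> p q" and ?N = "md_norm s R \<Gamma> \<gamma> p q" and ?l = "\<lambda>f. pairing k (Rec f) \<psi>"
  have "0 \<in> idx R" "bdd_below (idx R)" using R by (auto simp: regularity_structure_def)
  then have "Inf (idx R) \<le> 0" by (rule cInf_lower)
  moreover have "Inf (idx R) \<noteq> 0" using \<alpha>\<^sub>0 by auto
  ultimately have neg: "Inf (idx R) < 0" by simp
  define a where "a = (Inf (idx R) - real k) / 2"
  have a: "a < Inf (idx R)" "\<bar>a\<bar> < real k" "a < 0" using neg k by (auto simp: a_def)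
  have lin: "Rec (b *\<^sub>R f + c *\<^sub>R g) \<phi> = b * Rec f \<phi> + c * Rec g \<phi>"
    if "f \<in> ?D" "g \<in> ?D" "test_fun \<phi>" for f g b c \<phi>
    using rec that unfolding reconstruction_def Let_def by blast
  have bes: "Rec f \<in> besov s k a p q" if "f \<in> ?D" for f
    using rec that a unfolding reconstruction_def Let_def by blast
  have cont: "\<exists>\<delta>>0. \<forall>g\<in>?D. ?N (g - f) < \<delta> \<longrightarrow> besov_norm s k a p q (Rec g - Rec f) < \<epsilon>" if "f \<in> ?D" "\<epsilon> > 0" for f \<epsilon>
    using rec that a unfolding reconstruction_def Let_def by blast
  have \<psi>': "C_fun k \<psi>" "compact (fsupport \<psi>)" using \<psi> by (auto simp: test_ball_def)
  have l_lin: "?l (b *\<^sub>R f + c *\<^sub>R g) = b * ?l f + c * ?l g" if "f \<in> ?D" "g \<in> ?D" for f g b c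
    using bes that lin by (intro pairing_lincomb \<psi>') (auto simp: besov_def)
  have zero: "0 \<in> ?D" using zero_in_modelled p q by simp
  obtain c where c: "c > 0" "\<And>\<xi>. ennreal (c * \<bar>pairing k \<xi> \<psi>\<bar>) \<le> besov_norm s k a p q \<xi>"
    using pairing_le_besov_norm[OF s \<psi>, of p q a] p q a by auto
  obtain \<delta> where \<delta>: "\<delta> > 0" "\<And>g. g \<in> ?D \<Longrightarrow> ?N (g - 0) < \<delta> \<Longrightarrow> besov_norm s k a p q (Rec g - Rec 0) < 1"
    using cont[OF zero, of 1] by auto
  obtain d where d: "d > 0" "ennreal d \<le> \<delta>"
  proof (cases \<delta>)
    case (real d)
    then show ?thesis using \<delta>(1) by (intro that[of d]) auto
  qed (use that[of 1] in auto)
  have small: "\<bar>?l g\<bar> \<le> 1 / c" if g: "g \<in> ?D" "?N g < ennreal d" for g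
  proof -
    \<comment> \<open>\<open>Rec 0\<close> vanishes on test functions, but need not be the zero function.\<close>
    have "Rec 0 \<phi> = 0" if "test_fun \<phi>" for \<phi>
      using lin[OF zero zero that, of 0 0] by simp
    then have "?l g = pairing k (Rec g - Rec 0) \<psi>"
      by (intro pairing_cong) (simp add: fun_diff_def)
    then have "ennreal (c * \<bar>?l g\<bar>) \<le> besov_norm s k a p q (Rec g - Rec 0)"
      using c(2) by simp
    also have "\<dots> < 1"
      using g d by (intro \<delta>(2)) (auto intro: order.strict_trans2)
    finally have "c * \<bar>?l g\<bar> < 1"
      using c(1) by (simp add: ennreal_less_one_iff)
    then show ?thesis using c(1) by (simp add: field_simps)
  qed
  \<comment> \<open>A linear map bounded on a small ball is bounded; if the seminorm vanishes, arbitrarily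
    large multiples stay in the ball.\<close>
  have bound: "\<bar>?l g\<bar> \<le> 2 / (c * d) * md_seminorm s R \<Gamma> \<gamma> p q g" if g: "g \<in> ?D" for g
  proof -
    let ?n = "md_seminorm s R \<Gamma> \<gamma> p q g"
    have sm: "sector_measurable \<gamma> g" and fin: "?N g < \<infinity>" using g by (auto simp: modelled_iff)
    have n: "?N g = ennreal ?n" "0 \<le> ?n" using fin by (auto simp: md_seminorm_def)
    have scaled: "t * \<bar>?l g\<bar> \<le> 1 / c" if t: "0 \<le> t" "t * ?n < d" for t
    proof -
      have "t *\<^sub>R g \<in> ?D"
        using quasi_seminorm_modelled[OF p q] g by (auto simp: quasi_seminorm_on_def intro: subspace_scale)
      moreover have "?N (t *\<^sub>R g) < ennreal d"
        using md_norm_scaleR[OF sm, of p q t] p q t n d(1)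
        by (simp add: ennreal_mult[symmetric] ennreal_lessI)
      ultimately have "\<bar>?l (t *\<^sub>R g)\<bar> \<le> 1 / c" by (rule small)
      moreover have "?l (t *\<^sub>R g) = t * ?l g" using l_lin[OF g g, of t 0] by simp
      ultimately show ?thesis using t by (simp add: abs_mult)
    qed
    show ?thesis
    proof (cases "?n = 0")
      case True
      have "\<bar>?l g\<bar> = 0"
      proof (rule ccontr)
        assume "\<bar>?l g\<bar> \<noteq> 0"
        then have pos: "\<bar>?l g\<bar> > 0" by simp
        have "2 / (c * \<bar>?l g\<bar>) * \<bar>?l g\<bar> \<le> 1 / c"
          using pos c(1) d(1) True by (intro scaled) auto
        then show False using pos c(1) by (simp add: field_simps)
      qed
      then show ?thesis using True by simp
    next
      case False
      then have "?n > 0" using n by simp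
      then have "d / (2 * ?n) * \<bar>?l g\<bar> \<le> 1 / c"
        using d(1) by (intro scaled) auto
      then show ?thesis using \<open>?n > 0\<close> c(1) d(1) by (simp add: field_simps)
    qed
  qed
  have "bounded_functional ?D (md_seminorm s R \<Gamma> \<gamma> p q) ?l (2 / (c * d))"
    by unfold_locales (use quasi_seminorm_modelled[OF p q] l_lin bound c(1) d(1) in auto)
  then show ?thesis by blast
qed

theorem theorem3p3:
  fixes s :: "'d::finite \<Rightarrow> nat"
    and \<T> :: "'v::real_vector reg_struct"
    and Pmod :: "real^'d \<Rightarrow> 'v \<Rightarrow> 'd distr"
    and \<Gamma> :: "real^'d \<Rightarrow> real^'d \<Rightarrow> 'v \<Rightarrow> 'v"
    and r :: nat and \<alpha>\<^sub>0 \<gamma> p q T :: real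
    and M :: "'w measure" and F :: "real \<Rightarrow> 'w measure"
    and W :: "real \<Rightarrow> 'w \<Rightarrow> real"
    and H :: "real \<Rightarrow> 'w \<Rightarrow> real^'d \<Rightarrow> 'v"
    and Rec :: "(real^'d \<Rightarrow> 'v) \<Rightarrow> 'd distr"
  assumes "\<forall>i. s i > 0"
    and "regularity_structure \<T>"
    and "\<alpha>\<^sub>0 = Inf (idx \<T>)" and "\<alpha>\<^sub>0 \<notin> \<int>" and "\<gamma> > \<alpha>\<^sub>0"
    and "real r > \<bar>\<alpha>\<^sub>0\<bar>"
    and "model s r \<T> Pmod \<Gamma>"
    and "\<forall>\<alpha>\<in>idx \<T>. umd_space (sector \<T> \<alpha>) (cnorm \<T> \<alpha>)"
    and "complete_filtered_prob_space M F"
    and "T > 0"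
    and "brownian_motion M F T W"
    and "1 < p" and "1 < q"
    and "locally_stoch_integrable M F T W
           (modelled s \<T> \<Gamma> \<gamma> p q) (md_seminorm s \<T> \<Gamma> \<gamma> p q) H"
    and "reconstruction s r \<T> Pmod \<Gamma> \<gamma> p q Rec"
  shows "\<forall>k. real k > \<bar>\<alpha>\<^sub>0\<bar> \<longrightarrow> (\<forall>\<psi>\<in>test_ball s k.
      locally_stoch_integrable M F T W UNIV abs (\<lambda>t w. pairing k (Rec (H t w)) \<psi>)
    \<and> (AE w in M. \<forall>t\<in>{0..T}.
         pairing k (Rec (stoch_integral M F T W
           (modelled s \<T> \<Gamma> \<gamma> p q) (md_seminorm s \<T> \<Gamma> \<gamma> p q) H t w)) \<psi>
         = stoch_integral M F T W UNIV abs (\<lambda>t w. pairing k (Rec (H t w)) \<psi>) t w))"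
proof (intro allI impI ballI)
  fix k and \<psi> :: "real^'d \<Rightarrow> real"
  assume k: "real k > \<bar>\<alpha>\<^sub>0\<bar>" and \<psi>: "\<psi> \<in> test_ball s k"
  interpret reg_model \<T> s r Pmod \<Gamma>
    using assms by unfold_locales auto
  obtain C where "bounded_functional (modelled s \<T> \<Gamma> \<gamma> p q) (md_seminorm s \<T> \<Gamma> \<gamma> p q)
      (\<lambda>f. pairing k (Rec f) \<psi>) C"
    using reconstruction_functional[of \<gamma> p q Rec k \<psi>] assms k \<psi> by blast
  then interpret bounded_functional "modelled s \<T> \<Gamma> \<gamma> p q" "md_seminorm s \<T> \<Gamma> \<gamma> p q"
    "\<lambda>f. pairing k (Rec f) \<psi>" C .
  have "brownian M F T W"
    using assms by unfold_locales auto
  then show "locally_stoch_integrable M F T W UNIV abs (\<lambda>t w. pairing k (Rec (H t w)) \<psi>)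
    \<and> (AE w in M. \<forall>t\<in>{0..T}.
         pairing k (Rec (stoch_integral M F T W
           (modelled s \<T> \<Gamma> \<gamma> p q) (md_seminorm s \<T> \<Gamma> \<gamma> p q) H t w)) \<psi>
         = stoch_integral M F T W UNIV abs (\<lambda>t w. pairing k (Rec (H t w)) \<psi>) t w)"
    using assms by (intro stoch_integral_l)
qed

end
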